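(* Let $n\ge1$, $c>1$, let $g$ be a $c$-bounded Riemannian metric on $\mathbb{S}^n$, let $\epsilon>0$, $d>0$ and $a>\mathsf{a}+1$, where $\mathsf{a}=\mathsf{a}(\epsilon,n+1)$ is the number defined in the context. Then the metric $\mathcal{T}_{a,d}\,g$ is $(B_a,\epsilon)$-close to hyperbolic provided $$C_2'\left(e^{-a}+\frac1d\right)\le\epsilon,$$ where $C_2'=e\,C_2$ and $C_2=C_2(c,n)$ is the constant described in the context.
   Context: $B_r\subset\mathbb{R}^{n+1}$ is the ball of radius $r$ centered at the origin; $\mathbb{R}^{n+1}\setminus\{0\}$ is identified with $\mathbb{S}^n\times(0,\infty)$ by polar coordinates; $\sigma_{\mathbb{S}^n}$ is the canonical round metric. "Outside $B_r$" means on $\mathbb{R}^{n+1}\setminus B_r$. Two variable warping deformation: fix a smooth function $\rho:\mathbb{R}\to[0,1]$ with $\rho(t)=0$ for $t\le0$, $\rho(t)=1$ for $t\ge1$, $|\rho'|<3$ and $|\rho''|<12$. For $a,d>0$ put $\rho_{a,d}(t)=\rho\big(2\frac{t-a}{d}\big)$, $(g_{a,d})_t=\sigma_{\mathbb{S}^n}+\rho_{a,d}(t)(g-\sigma_{\mathbb{S}^n})$ and $$\mathcal{T}_{a,d}\,g=\sinh^2(t)\,(g_{a,d})_t+dt^2,$$ a Riemannian metric on $\mathbb{R}^{n+1}$. $c$-bounded ($c>1$): for each $n$ fix a finite atlas of $\mathbb{S}^n$ whose charts $\psi:U\to\mathbb{S}^n$, $U\subset\mathbb{R}^n$, extend to the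 compact closure of their domains and such that for every $p\in\mathbb{S}^n$ some chart satisfies $d_{\mathbb{R}^n}(\psi^{-1}(p),\mathbb{R}^n\setminus U)\ge1$. A metric $g$ on $\mathbb{S}^n$ is $c$-bounded if in every chart of this atlas its matrix satisfies $|g|_{C^2}<c$ and $|\det g|>1/c$ at every point. Here $|\cdot|_{C^2}$ is the uniform $C^2$ norm: the maximum of the sup norms of all partial derivatives of order $\le 2$ of the entries. Fix $c_{\mathbb{S}^n}>1$ such that $\sigma_{\mathbb{S}^n}$ is $c_{\mathbb{S}^n}$-bounded. Radially $\epsilon$-close to hyperbolic: let $\mathbb{B}\subset\mathbb{R}^n$ be the unit ball and $\mathbb{T}=\mathbb{B}\times(-1,1)$ with metric $\sigma=e^{2t}\sigma_{\mathbb{R}^n}+dt^2$, $\sigma_{\mathbb{R}^n}$ flat. A metric $h$ on $\mathbb{S}^n\times(0,\infty)$ of the form $\tilde g_t+dt^2$ is radially $\epsilon$-close to hyperbolic on a subset $S$ if for every $p\in S$ there is a chart (diffeomorphism onto an open subset) $\phi:\mathbb{T}\to\mathbb{S}^n\times(0,\infty)$ with $\phi(0,0)=p$, of the form $\phi(x,t)=(\phi_1(x),t+t_0)$ for some number $t_0$ and chart $\phi_1$ of $\mathbb{S}^n$, such that $|\phi^*h-\sigma|_{C^2}<\epsilon$. $(B_a,\epsilon)$-close to hyperbolic: a metric $h$ on $\mathbb{R}^{n+1}$ such that (1) on $B_a\setminus\{0\}=\mathbb{S}^n\times(0,a)$ one has $h=\sinh^2(t)\sigma_{\mathbb{S}^n}+dt^2$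 (so $h$ is hyperbolic on $B_a$), and (2) $h$ is radially $\epsilon$-close to hyperbolic outside $B_{a-1}$. The constants: $C_2(c,n)$ is the constant, depending only on $c$ and $n$, for which it is known that whenever $g$ is $c$-bounded, $a,d>0$, $b>1$ and $C_2(e^{-b}+\frac1d)\le\epsilon$, the metric $\mathcal{T}_{a,d}\,g$ is radially $\epsilon$-close to hyperbolic outside $B_b$. Explicitly (formula for $n\ge2$), put $c_3(c)=3c^{3/2}+\frac92 n!\,c^{n+2}$, $c_4(c)=\sqrt{n\,n!\,c^n}$, $C(c)=27\,e^{2}n^4c_4(c)^4c_3(c)\,c^2$, $C_1(c)=30\,C(6^nc)$, and $A(x)=x\,\big(n+3n^{3/2}n!\,(x')^{n+2}\big)\,n^2\,\big(n!\,(x')^n\big)^{3/2}$ with $x'=[n!\,x^{n+1}]^n$; then one takes $C_2(c,n)=\big(1+12A(c+c_{\mathbb{S}^n})\big)\,C_1(c+c_{\mathbb{S}^n})$. Finally $\mathsf{a}(\epsilon,n+1)=\ln\big(C_1(c_{\mathbb{S}^n})/\epsilon\big)$; hyperbolic space $\mathbb{H}^{n+1}$ (metric $\sinh^2(t)\sigma_{\mathbb{S}^n}+dt^2$) is radially $\epsilon$-close to hyperbolic outside $B_r$ for $r\ge\mathsf{a}$.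
   Formalization: The formal theorem also assumes a > 2; for a < 2 (possible only for very large ε) the claim is false, since a chart (φ₁(x), t+t₀), |t|<1, at a point with t₀ < 1 leaves S^n×(0,∞). For n = 1, C₂ and C₁ are unspecified constants with the described properties. *)

theory Defs
  imports "HOL-Analysis.Analysis"
begin

section \<open>Smooth maps and symmetric bilinear tensor fields\<close>

text \<open>Both notions are meant for open sets \<open>S\<close>.\<close>

primrec Ck_on :: "nat \<Rightarrow> ('a::real_normed_vector \<Rightarrow> 'b::real_normed_vector) \<Rightarrow> 'a set \<Rightarrow> bool" where
  "Ck_on 0 f S \<longleftrightarrow> continuous_on S f"
| "Ck_on (Suc k) f S \<longleftrightarrow>
     (\<forall>x\<in>S. f differentiable (at x)) \<and>
     (\<forall>v. Ck_on k (\<lambda>x. frechet_derivative f (at x) v) S)"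

definition smooth_on :: "'a set \<Rightarrow> ('a::real_normed_vector \<Rightarrow> 'b::real_normed_vector) \<Rightarrow> bool" where
  "smooth_on S f \<longleftrightarrow> (\<forall>k. Ck_on k f S)"

text \<open>
  A covariant 2-tensor field is a function of a base point and two tangent vectors. For a tensor on
  a submanifold of a Euclidean space only its values on tangent vectors at points of the
  submanifold are relevant; all notions below respect this.
\<close>

type_synonym 'a tensor2 = "'a \<Rightarrow> 'a \<Rightarrow> 'a \<Rightarrow> real"

definition pullback :: "('a::euclidean_space \<Rightarrow> 'b::euclidean_space) \<Rightarrow> 'b tensor2 \<Rightarrow> 'a tensor2" where
  "pullback \<phi> h = (\<lambda>x u v. h (\<phi> x) (frechet_derivative \<phi> (at x) u) (frechet_derivative \<phi> (at x) v))"

definition inner_product_on :: "'a::real_vector set \<Rightarrow> ('a \<Rightarrow> 'a \<Rightarrow> real) \<Rightarrow> bool" where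
  "inner_product_on V B \<longleftrightarrow>
     (\<forall>u\<in>V. \<forall>v\<in>V. B u v = B v u) \<and>
     (\<forall>u\<in>V. \<forall>v\<in>V. \<forall>w\<in>V. \<forall>r. B (r *\<^sub>R u + v) w = r * B u w + B v w) \<and>
     (\<forall>u\<in>V. u \<noteq> 0 \<longrightarrow> 0 < B u u)"

definition riemannian_metric :: "'a::euclidean_space tensor2 \<Rightarrow> bool" where
  "riemannian_metric h \<longleftrightarrow>
     (\<forall>x. inner_product_on UNIV (h x)) \<and> (\<forall>u v. smooth_on UNIV (\<lambda>x. h x u v))"

definition partial_deriv :: "'a \<Rightarrow> ('a::euclidean_space \<Rightarrow> real) \<Rightarrow> 'a \<Rightarrow> real" where
  "partial_deriv i f = (\<lambda>x. frechet_derivative f (at x) i)"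

definition sup_norm :: "'a set \<Rightarrow> ('a \<Rightarrow> real) \<Rightarrow> ereal" where
  "sup_norm U f = (SUP x\<in>U. ereal \<bar>f x\<bar>)"

definition C2_norm :: "'a set \<Rightarrow> 'a::euclidean_space tensor2 \<Rightarrow> ereal" where
  "C2_norm U F =
     (SUP u\<in>Basis. SUP v\<in>Basis.
        max (sup_norm U (\<lambda>x. F x u v))
       (max (SUP i\<in>Basis. sup_norm U (partial_deriv i (\<lambda>x. F x u v)))
            (SUP i\<in>Basis. SUP j\<in>Basis. sup_norm U (partial_deriv j (partial_deriv i (\<lambda>x. F x u v))))))"


section \<open>The round sphere, its charts, and bounded metrics\<close>

text \<open>
  Throughout, \<open>n = CARD('n)\<close>, the model space is \<open>real ^ 'n\<close>, the Euclidean space of dimension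
  \<open>n + 1\<close> is \<open>(real ^ 'n) \<times> real\<close> with its Euclidean norm, and the \<open>n\<close>-sphere is its unit sphere.
\<close>

type_synonym 'n space = "(real ^ 'n) \<times> real"

definition sph :: "('n::finite) space set" where
  "sph = sphere 0 1"

definition tangent :: "('n::finite) space \<Rightarrow> 'n space set" where
  "tangent p = {u. u \<bullet> p = 0}"

text \<open>
  A diffeomorphism of \<open>U\<close> onto an open subset of the sphere. Smoothness of the inverse on that
  subset means that it is the restriction of a smooth map on an open set of the ambient space.
\<close>

definition sphere_chart :: "(real ^ 'n) set \<Rightarrow> (real ^ 'n \<Rightarrow> ('n::finite) space) \<Rightarrow> bool" where
  "sphere_chart U \<psi> \<longleftrightarrow> open U \<and> smooth_on U \<psi> \<and>
     (\<exists>W \<theta>. open W \<and> \<psi> ` U = W \<inter> sph \<and> smooth_on W \<theta> \<and> (\<forall>x\<in>U. \<theta> (\<psi> x) = x))"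

definition sphere_metric :: "('n::finite) space tensor2 \<Rightarrow> bool" where
  "sphere_metric g \<longleftrightarrow>
     (\<forall>p\<in>sph. inner_product_on (tangent p) (g p)) \<and>
     (\<forall>U \<psi>. sphere_chart U \<psi> \<longrightarrow> (\<forall>u v. smooth_on U (\<lambda>x. pullback \<psi> g x u v)))"

definition round_metric :: "('n::finite) space tensor2" where
  "round_metric = (\<lambda>p u v. u \<bullet> v)"

definition sphere_atlas :: "((real ^ 'n) set \<times> (real ^ 'n \<Rightarrow> ('n::finite) space)) set \<Rightarrow> bool" where
  "sphere_atlas \<A> \<longleftrightarrow> finite \<A> \<and>
     (\<forall>(U, \<psi>)\<in>\<A>. sphere_chart U \<psi> \<and> compact (closure U) \<and>
        (\<exists>V \<psi>'. closure U \<subseteq> V \<and> sphere_chart V \<psi>' \<and> (\<forall>x\<in>U. \<psi>' x = \<psi> x))) \<and>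
     (\<forall>p\<in>sph. \<exists>(U, \<psi>)\<in>\<A>. \<exists>x\<in>U. \<psi> x = p \<and> infdist x (- U) \<ge> 1)"

definition c_bounded ::
  "((real ^ 'n) set \<times> (real ^ 'n \<Rightarrow> ('n::finite) space)) set \<Rightarrow> real \<Rightarrow> 'n space tensor2 \<Rightarrow> bool" where
  "c_bounded \<A> c g \<longleftrightarrow>
     (\<forall>(U, \<psi>)\<in>\<A>.
        C2_norm U (pullback \<psi> g) < ereal c \<and>
        (\<forall>x\<in>U. \<bar>det (\<chi> i j. pullback \<psi> g x (axis i 1) (axis j 1))\<bar> > 1 / c))"


section \<open>Metrics in polar coordinates\<close>

text \<open>
  Points of \<open>sph \<times> (0,\<infinity>)\<close> are pairs \<open>(p, t)\<close>; tangent vectors at \<open>(p, t)\<close> are pairs \<open>(u, s)\<close>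
  with \<open>u \<in> tangent p\<close>.
\<close>

definition to_polar :: "('n::finite) space \<Rightarrow> 'n space \<times> real" where
  "to_polar x = (sgn x, norm x)"

definition from_polar :: "('n::finite) space \<times> real \<Rightarrow> 'n space" where
  "from_polar = (\<lambda>(p, t). t *\<^sub>R p)"

text \<open>\<open>warped G\<close> is \<open>sinh\<^sup>2(t) G\<^sub>t + dt\<^sup>2\<close>.\<close>

definition warped :: "(real \<Rightarrow> ('n::finite) space tensor2) \<Rightarrow> ('n space \<times> real) tensor2" where
  "warped G = (\<lambda>(p, t) (u, s) (v, s'). (sinh t)\<^sup>2 * G t p u v + s * s')"

definition hyperbolic_polar :: "(('n::finite) space \<times> real) tensor2" where
  "hyperbolic_polar = warped (\<lambda>t. round_metric)"

text \<open>\<open>\<rho>\<close> is the cut-off function used in the deformation.\<close>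

definition cutoff :: "(real \<Rightarrow> real) \<Rightarrow> bool" where
  "cutoff \<rho> \<longleftrightarrow> smooth_on UNIV \<rho> \<and> (\<forall>t. 0 \<le> \<rho> t \<and> \<rho> t \<le> 1) \<and>
     (\<forall>t\<le>0. \<rho> t = 0) \<and> (\<forall>t\<ge>1. \<rho> t = 1) \<and>
     (\<forall>t. \<bar>deriv \<rho> t\<bar> < 3) \<and> (\<forall>t. \<bar>deriv (deriv \<rho>) t\<bar> < 12)"

definition deformed_family ::
  "(real \<Rightarrow> real) \<Rightarrow> real \<Rightarrow> real \<Rightarrow> ('n::finite) space tensor2 \<Rightarrow> real \<Rightarrow> 'n space tensor2" where
  "deformed_family \<rho> a d g t = (\<lambda>p u v.
     round_metric p u v + \<rho> (2 * ((t - a) / d)) * (g p u v - round_metric p u v))"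

text \<open>
  Near the origin the two variable warping deformation is \<open>sinh\<^sup>2(t) \<sigma> + dt\<^sup>2\<close>, whose smooth
  extension to the origin is the Euclidean inner product there.
\<close>

definition two_var_warp ::
  "(real \<Rightarrow> real) \<Rightarrow> real \<Rightarrow> real \<Rightarrow> ('n::finite) space tensor2 \<Rightarrow> 'n space tensor2" where
  "two_var_warp \<rho> a d g = (\<lambda>x.
     if x = 0 then (\<lambda>v w. v \<bullet> w)
     else pullback to_polar (warped (deformed_family \<rho> a d g)) x)"


section \<open>Closeness to hyperbolic\<close>

text \<open>The base \<open>ball 0 1 \<times> (-1,1)\<close> with the metric \<open>e\<^sup>2\<^sup>t \<sigma> + dt\<^sup>2\<close>, \<open>\<sigma>\<close> flat.\<close>

definition model_domain :: "('n::finite) space set" where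
  "model_domain = ball 0 1 \<times> {-1<..<1}"

definition model_metric :: "('n::finite) space tensor2" where
  "model_metric = (\<lambda>(x, t) (u, s) (v, s'). exp (2 * t) * (u \<bullet> v) + s * s')"

text \<open>A metric on \<open>sph \<times> (0,\<infinity>)\<close> of the form \<open>h\<^sub>t + dt\<^sup>2\<close>.\<close>

definition radial_form :: "(('n::finite) space \<times> real) tensor2 \<Rightarrow> bool" where
  "radial_form h \<longleftrightarrow>
     (\<forall>p\<in>sph. \<forall>t>0. \<forall>u\<in>tangent p. \<forall>v\<in>tangent p. \<forall>s s'.
        h (p, t) (u, s) (v, s') = h (p, t) (u, 0) (v, 0) + s * s')"

text \<open>
  A map \<open>\<lambda>(x, t). (\<phi>\<^sub>1 x, t + t\<^sub>0)\<close> into \<open>sph \<times> (0,\<infinity>)\<close> with \<open>\<phi>\<^sub>1\<close> a chart is automatically a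
  diffeomorphism onto an open subset.
\<close>

definition radially_close :: "real \<Rightarrow> (('n::finite) space \<times> real) tensor2 \<Rightarrow> ('n space \<times> real) set \<Rightarrow> bool" where
  "radially_close \<epsilon> h S \<longleftrightarrow> radial_form h \<and>
     (\<forall>p\<in>S. \<exists>\<phi>1 t0. let \<phi> = (\<lambda>(x, t). (\<phi>1 x, t + t0)) in
        sphere_chart (ball 0 1) \<phi>1 \<and>
        \<phi> ` model_domain \<subseteq> sph \<times> {0<..} \<and>
        \<phi> (0, 0) = p \<and>
        C2_norm model_domain (\<lambda>y u v. pullback \<phi> h y u v - model_metric y u v) < ereal \<epsilon>)"

definition outside_ball :: "real \<Rightarrow> (('n::finite) space \<times> real) set" where
  "outside_ball r = {(p, t). p \<in> sph \<and> t > 0 \<and> from_polar (p, t) \<notin> ball 0 r}"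

text \<open>
  For \<open>a < 2\<close> no metric satisfies the last condition: its points \<open>(p, t)\<close> then include some with
  \<open>t < 1\<close>, for which the chart \<open>(x, s) \<mapsto> (\<phi>\<^sub>1 x, s + t)\<close> on \<open>ball 0 1 \<times> (-1,1)\<close> leaves
  \<open>sph \<times> (0,\<infinity>)\<close>.
\<close>

definition B_close_to_hyperbolic :: "real \<Rightarrow> real \<Rightarrow> ('n::finite) space tensor2 \<Rightarrow> bool" where
  "B_close_to_hyperbolic a \<epsilon> h \<longleftrightarrow>
     riemannian_metric h \<and>
     (\<forall>p\<in>sph. \<forall>t\<in>{0<..<a}. \<forall>u\<in>tangent p. \<forall>v\<in>tangent p. \<forall>s s'.
        pullback from_polar h (p, t) (u, s) (v, s') = hyperbolic_polar (p, t) (u, s) (v, s')) \<and>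
     radially_close \<epsilon> (pullback from_polar h) (outside_ball (a - 1))"


section \<open>The constants\<close>

definition c3 :: "nat \<Rightarrow> real \<Rightarrow> real" where
  "c3 n c = 3 * c powr (3/2) + 9/2 * fact n * c ^ (n + 2)"

definition c4 :: "nat \<Rightarrow> real \<Rightarrow> real" where
  "c4 n c = sqrt (real n * fact n * c ^ n)"

definition C0 :: "nat \<Rightarrow> real \<Rightarrow> real" where
  "C0 n c = 27 * (exp 1)\<^sup>2 * real n ^ 4 * c4 n c ^ 4 * c3 n c * c\<^sup>2"

definition C1_formula :: "nat \<Rightarrow> real \<Rightarrow> real" where
  "C1_formula n c = 30 * C0 n (6 ^ n * c)"

definition A_fun :: "nat \<Rightarrow> real \<Rightarrow> real" where
  "A_fun n x = (let x' = (fact n * x ^ (n + 1)) ^ n in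
     x * (real n + 3 * real n powr (3/2) * fact n * x' ^ (n + 2)) * (real n)\<^sup>2 *
       (fact n * x' ^ n) powr (3/2))"

definition C2_formula :: "nat \<Rightarrow> real \<Rightarrow> real \<Rightarrow> real" where
  "C2_formula n cS c = (1 + 12 * A_fun n (c + cS)) * C1_formula n (c + cS)"

text \<open>
  The explicit constants are for \<open>n \<ge> 2\<close>; for \<open>n = 1\<close> the constants are only known to exist, and
  are taken to be unspecified constants with the property they are known for. The argument \<open>\<A>\<close>
  fixes the atlas (and the dimension), \<open>cS\<close> the bound of the round metric.
\<close>

definition C2_property ::
  "(real \<Rightarrow> real) \<Rightarrow> ((real ^ 'n) set \<times> (real ^ 'n \<Rightarrow> ('n::finite) space)) set \<Rightarrow> real \<Rightarrow> real \<Rightarrow> bool" where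
  "C2_property \<rho> \<A> c K \<longleftrightarrow>
     (\<forall>(g :: 'n space tensor2) a d b \<epsilon>.
        sphere_metric g \<longrightarrow> c_bounded \<A> c g \<longrightarrow> 0 < a \<longrightarrow> 0 < d \<longrightarrow> 1 < b \<longrightarrow>
        K * (exp (- b) + 1 / d) \<le> \<epsilon> \<longrightarrow>
        radially_close \<epsilon> (pullback from_polar (two_var_warp \<rho> a d g)) (outside_ball b))"

definition C2_const ::
  "(real \<Rightarrow> real) \<Rightarrow> ((real ^ 'n) set \<times> (real ^ 'n \<Rightarrow> ('n::finite) space)) set \<Rightarrow> real \<Rightarrow> real \<Rightarrow> real" where
  "C2_const \<rho> \<A> cS c =
     (if CARD('n) \<ge> 2 then C2_formula CARD('n) cS c
      else (SOME K. K > 0 \<and> C2_property \<rho> \<A> c K))"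

text \<open>
  \<open>K\<close> stands for the constant \<open>C\<^sub>1(c\<^sub>S)\<close>. As in the property of \<open>C\<^sub>2\<close>, only radii \<open>r > 1\<close> are
  meant: charts exist only at points with \<open>t \<ge> 1\<close>.
\<close>

definition C1_property :: "'n::finite itself \<Rightarrow> real \<Rightarrow> bool" where
  "C1_property _ K \<longleftrightarrow>
     (\<forall>\<epsilon> r. 0 < \<epsilon> \<longrightarrow> 1 < r \<longrightarrow> ln (K / \<epsilon>) \<le> r \<longrightarrow>
        radially_close \<epsilon> (hyperbolic_polar :: ('n space \<times> real) tensor2) (outside_ball r))"

definition C1_sphere :: "'n::finite itself \<Rightarrow> real \<Rightarrow> real" where
  "C1_sphere T cS =
     (if CARD('n) \<ge> 2 then C1_formula CARD('n) cS
      else (SOME K. K > 0 \<and> C1_property T K))"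

text \<open>The number \<open>a(\<epsilon>, n + 1)\<close>.\<close>

definition hyp_radius :: "'n::finite itself \<Rightarrow> real \<Rightarrow> real \<Rightarrow> real" where
  "hyp_radius T cS \<epsilon> = ln (C1_sphere T cS / \<epsilon>)"

end

theory Submission
  imports Defs
begin

text \<open>
  At a point \<open>(p, t\<^sub>0)\<close> take a chart \<open>\<psi>\<close> of the atlas with \<open>\<psi> z = p\<close> and a linear map \<open>T\<close> whose columns
  are orthonormal at \<open>z\<close> for the metric \<open>(1 - r) \<sigma> + r g\<close> of the slice \<open>t = t\<^sub>0\<close>; Cramer's rule applied to the
  determinant bounds controls \<open>T\<close>. In the chart \<open>\<phi>\<^sub>1 y = \<psi> (z + \<mu> T y)\<close> with \<open>\<mu> = 2 exp (-t\<^sub>0)\<close> one has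
  \<open>\<mu>\<^sup>2 sinh\<^sup>2 (t + t\<^sub>0) = exp (2 t) + O(exp (-t\<^sub>0))\<close>, every derivative in \<open>y\<close> costs a factor \<open>O(exp (-t\<^sub>0))\<close>, and
  the cut-off varies by \<open>O(1/d)\<close> on the slab, so that the distance to the model is \<open>O(exp (-t\<^sub>0) + 1/d)\<close>. This
  works for small \<open>\<epsilon>\<close>; for \<open>\<epsilon> > 37\<close> a chart with tiny \<open>\<mu>\<close> suffices, since then the difference is nearly
  \<open>-exp (2 t) \<delta>\<close>, whose norm is at most \<open>4 e\<^sup>2 < 37\<close>. The resulting constant lies below \<open>C\<^sub>2\<close> (and witnesses the
  existence of \<open>C\<^sub>2\<close> when \<open>n = 1\<close>), and the theorem is the case \<open>b = a - 1\<close>.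
\<close>

section \<open>Calculus of smooth maps\<close>

text \<open>Inside the transition region a slice metric need not be near \<open>\<sigma>\<close>, so
  the frame is normalised for the slice metric itself. At the centre the slice then matches the flat
  model exactly, and what is left is a variation over the chart, the \<open>sinh\<close> remainder
  or a cut-off increment. The obstacle is that
  \<open>K * (exp (- t0) + 1 / d) \<le> \<epsilon>\<close> forces smallness only for bounded
  \<open>\<epsilon>\<close>. Up to 37 the size of \<open>K\<close> yields
  \<open>2 * exp (- t0) * L \<le> 1\<close>, where \<open>L\<close> bounds the frame, so the chart
  stays in the unit ball guaranteed by the atlas; it also yields \<open>d \<ge> 1\<close>, so that
  the second derivative of the cut-off, of order \<open>1 / d^2\<close>, is covered by
  \<open>1 / d\<close>. For larger \<open>\<epsilon>\<close> neither is available: \<open>d\<close>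
  may be tiny, and the chart is shrunk until even these derivatives are harmless. The factor
  \<open>e\<close> in the constant of the theorem is the price of replacing \<open>a\<close> by
  \<open>a - 1\<close>.\<close>

lemma Ck_on_cong:
  assumes "open S" "\<And>x. x \<in> S \<Longrightarrow> f x = g x" "Ck_on k f S"
  shows "Ck_on k g S"
  using assms
proof (induction k arbitrary: f g)
  case 0
  then show ?case by (auto cong: continuous_on_cong)
next
  case (Suc k)
  have d: "(g has_derivative frechet_derivative f (at x)) (at x)" if "x \<in> S" for x
  proof -
    have "(f has_derivative frechet_derivative f (at x)) (at x)"
      using Suc.prems(3) that frechet_derivative_works by auto
    then show ?thesis
      using has_derivative_transform_within_open[OF _ Suc.prems(1) that] Suc.prems(2) by blast
  qed
  have e: "frechet_derivative f (at x) = frechet_derivative g (at x)" if "x \<in> S" for x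
    using frechet_derivative_at[OF d[OF that]] .
  have "Ck_on k (\<lambda>x. frechet_derivative g (at x) v) S" for v
    by (rule Suc.IH[where f="\<lambda>x. frechet_derivative f (at x) v"]) (use Suc.prems e in auto)
  then show ?case using d by (auto simp: differentiable_def)
qed

text \<open>On an open set any explicit derivative formula may stand in for
  \<open>frechet_derivative\<close>, to which the definition of \<open>Ck_on\<close> is
  tied.\<close>

lemma Ck_on_SucI:
  assumes "open S" "\<And>x. x \<in> S \<Longrightarrow> (f has_derivative f' x) (at x)" "\<And>v. Ck_on k (\<lambda>x. f' x v) S"
  shows "Ck_on (Suc k) f S"
proof -
  have "Ck_on k (\<lambda>x. frechet_derivative f (at x) v) S" for v
    by (rule Ck_on_cong[OF assms(1) _ assms(3)[of v]]) (use frechet_derivative_at[OF assms(2)] in auto)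
  then show ?thesis using assms(2) by (auto simp: differentiable_def)
qed

lemma Ck_on_SucD:
  assumes "Ck_on (Suc k) f S" "x \<in> S"
  shows "(f has_derivative frechet_derivative f (at x)) (at x)"
  using assms frechet_derivative_works by auto

lemma Ck_on_Suc_imp: "Ck_on (Suc k) f S \<Longrightarrow> Ck_on k f S"
proof (induction k arbitrary: f)
  case 0
  then show ?case
    by (auto intro!: continuous_at_imp_continuous_on differentiable_imp_continuous_within)
next
  case (Suc k)
  then show ?case by (metis Ck_on.simps(2))
qed

lemma Ck_on_subset: "Ck_on k f S \<Longrightarrow> T \<subseteq> S \<Longrightarrow> Ck_on k f T"
proof (induction k arbitrary: f)
  case 0
  then show ?case by (auto intro: continuous_on_subset)
next
  case (Suc k)
  then show ?case by (simp add: subset_iff)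
qed

text \<open>Holds because \<open>Ck_on\<close> takes derivatives at points of the whole space, not
  within \<open>S\<close>. It allows smoothness to be checked chart by chart, and the description at
  the origin to be glued to the one away from it.\<close>

lemma Ck_on_local:
  assumes "\<And>x. x \<in> S \<Longrightarrow> \<exists>T. open T \<and> x \<in> T \<and> Ck_on k f T"
  shows "Ck_on k f S"
  using assms
proof (induction k arbitrary: f)
  case 0
  then show ?case
    by (auto intro!: continuous_at_imp_continuous_on) (metis continuous_on_eq_continuous_at)
next
  case (Suc k)
  have "Ck_on k (\<lambda>x. frechet_derivative f (at x) v) S" for v
    by (rule Suc.IH) (use Suc.prems in \<open>metis Ck_on.simps(2)\<close>)
  moreover have "f differentiable (at x)" if "x \<in> S" for x
    using Suc.prems[OF that] by auto
  ultimately show ?case by auto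
qed

lemma Ck_on_const: "Ck_on k (\<lambda>x. c) S"
  by (induction k arbitrary: c) auto

lemma Ck_on_add:
  assumes "open S" "Ck_on k f S" "Ck_on k g S"
  shows "Ck_on k (\<lambda>x. f x + g x) S"
  using assms(2,3)
proof (induction k arbitrary: f g)
  case (Suc k)
  show ?case
    by (rule Ck_on_SucI[OF assms(1) has_derivative_add]) (use Suc in \<open>auto intro!: Ck_on_SucD\<close>)
qed (auto intro: continuous_intros)

text \<open>The Leibniz rule reproduces \<open>pr\<close>-products with one differentiated factor;
  the other factor is lowered to order \<open>k\<close> by \<open>Ck_on_Suc_imp\<close> before the
  induction hypothesis applies.\<close>

lemma Ck_on_bilinear:
  assumes "open S" "bounded_bilinear pr" "Ck_on k f S" "Ck_on k g S"
  shows "Ck_on k (\<lambda>x. pr (f x) (g x)) S"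
  using assms(3,4)
proof (induction k arbitrary: f g)
  case 0
  then show ?case using bounded_bilinear.continuous_on[OF assms(2)] by auto
next
  case (Suc k)
  show ?case
    by (rule Ck_on_SucI[OF assms(1) bounded_bilinear.FDERIV[OF assms(2)]])
      (use Suc Ck_on_Suc_imp[OF Suc.prems(1)] Ck_on_Suc_imp[OF Suc.prems(2)] in
        \<open>auto intro!: Ck_on_add[OF assms(1)] Ck_on_SucD\<close>)
qed

lemma Ck_on_bounded_linear:
  assumes "open S" "bounded_linear L" "Ck_on k f S"
  shows "Ck_on k (\<lambda>x. L (f x)) S"
  using assms(3)
proof (induction k arbitrary: f)
  case 0
  then show ?case using bounded_linear.continuous_on[OF assms(2)] by auto
next
  case (Suc k)
  show ?case
    by (rule Ck_on_SucI[OF assms(1) bounded_linear.has_derivative[OF assms(2)]])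
      (use Suc in \<open>auto intro!: Ck_on_SucD\<close>)
qed

lemma Ck_on_linear:
  assumes "open S" "bounded_linear L"
  shows "Ck_on k L S"
proof (cases k)
  case 0
  then show ?thesis using assms linear_continuous_on by auto
next
  case (Suc j)
  then show ?thesis
    using Ck_on_SucI[OF assms(1) bounded_linear_imp_has_derivative[OF assms(2)]] Ck_on_const by blast
qed

lemma Ck_on_sum:
  assumes "open S" "\<And>i. i \<in> I \<Longrightarrow> Ck_on k (f i) S"
  shows "Ck_on k (\<lambda>x. \<Sum>i\<in>I. f i x) S"
  using assms(2)
  by (induction I rule: infinite_finite_induct) (auto intro!: Ck_on_const Ck_on_add[OF assms(1)])

text \<open>In the chain rule the direction fed to the derivative of \<open>f\<close> varies with
  \<open>x\<close>, while the induction hypothesis covers fixed directions only. Expanding that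
  direction in \<open>Basis\<close> repairs this, whence the Euclidean domain of
  \<open>f\<close>.\<close>

lemma Ck_on_compose:
  fixes f :: "'b::euclidean_space \<Rightarrow> 'c::real_normed_vector"
  assumes "open S" "open T" "Ck_on k g S" "Ck_on k f T" "g ` S \<subseteq> T"
  shows "Ck_on k (\<lambda>x. f (g x)) S"
  using assms(3,4)
proof (induction k arbitrary: f)
  case 0
  then show ?case using assms(5) continuous_on_compose2[of T f S g] by simp
next
  case (Suc k)
  let ?Dg = "\<lambda>x. frechet_derivative g (at x)"
  let ?Df = "\<lambda>x. frechet_derivative f (at x)"
  show ?case
  proof (rule Ck_on_SucI[OF assms(1)])
    fix x assume x: "x \<in> S"
    show "((\<lambda>x. f (g x)) has_derivative (\<lambda>v. \<Sum>b\<in>Basis. (?Dg x v \<bullet> b) *\<^sub>R ?Df (g x) b)) (at x)"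
    proof -
      have f: "(f has_derivative ?Df (g x)) (at (g x))"
        using Ck_on_SucD[OF Suc.prems(2)] x assms(5) by blast
      interpret bounded_linear "?Df (g x)" using f has_derivative_bounded_linear by blast
      have *: "?Df (g x) w = (\<Sum>b\<in>Basis. (w \<bullet> b) *\<^sub>R ?Df (g x) b)" for w
      proof -
        have "?Df (g x) (\<Sum>b\<in>Basis. (w \<bullet> b) *\<^sub>R b) = (\<Sum>b\<in>Basis. (w \<bullet> b) *\<^sub>R ?Df (g x) b)"
          by (simp only: sum scaleR)
        then show ?thesis by (simp only: euclidean_representation)
      qed
      show ?thesis
        using has_derivative_compose[OF Ck_on_SucD[OF Suc.prems(1) x] f]
        by (rule has_derivative_eq_rhs) (rule ext, rule *)
    qed
  next
    fix v
    have "Ck_on k (\<lambda>x. ?Dg x v) S" using Suc.prems(1) by simp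
    then have 1: "Ck_on k (\<lambda>x. ?Dg x v \<bullet> b) S" for b
      by (rule Ck_on_bounded_linear[OF assms(1) bounded_linear_inner_left])
    have 2: "Ck_on k (\<lambda>x. ?Df (g x) b) S" for b
    proof (rule Suc.IH)
      show "Ck_on k g S" using Suc.prems(1) by (rule Ck_on_Suc_imp)
      show "Ck_on k (\<lambda>y. ?Df y b) T" using Suc.prems(2) by simp
    qed
    show "Ck_on k (\<lambda>x. \<Sum>b\<in>Basis. (?Dg x v \<bullet> b) *\<^sub>R ?Df (g x) b) S"
      by (rule Ck_on_sum[OF assms(1)], rule Ck_on_bilinear[OF assms(1) bounded_bilinear_scaleR 1 2])
  qed
qed

lemma smooth_on_D: "smooth_on S f \<Longrightarrow> Ck_on k f S"
  by (simp add: smooth_on_def)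

lemma smooth_on_cong:
  "open S \<Longrightarrow> (\<And>x. x \<in> S \<Longrightarrow> f x = g x) \<Longrightarrow> smooth_on S f \<Longrightarrow> smooth_on S g"
  unfolding smooth_on_def using Ck_on_cong by blast

lemma smooth_on_subset: "smooth_on S f \<Longrightarrow> T \<subseteq> S \<Longrightarrow> smooth_on T f"
  unfolding smooth_on_def using Ck_on_subset by blast

lemma smooth_on_local:
  "(\<And>x. x \<in> S \<Longrightarrow> \<exists>T. open T \<and> x \<in> T \<and> smooth_on T f) \<Longrightarrow> smooth_on S f"
  unfolding smooth_on_def using Ck_on_local by metis

lemma smooth_on_const: "smooth_on S (\<lambda>x. c)"
  unfolding smooth_on_def using Ck_on_const by blast

lemma smooth_on_add:
  "open S \<Longrightarrow> smooth_on S f \<Longrightarrow> smooth_on S g \<Longrightarrow> smooth_on S (\<lambda>x. f x + g x)"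
  unfolding smooth_on_def using Ck_on_add by blast

lemma smooth_on_linear: "open S \<Longrightarrow> bounded_linear L \<Longrightarrow> smooth_on S L"
  unfolding smooth_on_def using Ck_on_linear by blast

lemma smooth_on_bounded_linear:
  "open S \<Longrightarrow> bounded_linear L \<Longrightarrow> smooth_on S f \<Longrightarrow> smooth_on S (\<lambda>x. L (f x))"
  unfolding smooth_on_def using Ck_on_bounded_linear by blast

lemma smooth_on_bilinear:
  "open S \<Longrightarrow> bounded_bilinear pr \<Longrightarrow> smooth_on S f \<Longrightarrow> smooth_on S g \<Longrightarrow>
    smooth_on S (\<lambda>x. pr (f x) (g x))"
  unfolding smooth_on_def using Ck_on_bilinear by blast

lemmas smooth_on_mult = smooth_on_bilinear[OF _ bounded_bilinear_mult]
lemmas smooth_on_inner = smooth_on_bilinear[OF _ bounded_bilinear_inner]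
lemmas smooth_on_scaleR = smooth_on_bilinear[OF _ bounded_bilinear_scaleR]

lemma smooth_on_uminus: "open S \<Longrightarrow> smooth_on S f \<Longrightarrow> smooth_on S (\<lambda>x. - f x)"
  by (rule smooth_on_bounded_linear[OF _ bounded_linear_minus[OF bounded_linear_ident]])

lemma smooth_on_diff:
  "open S \<Longrightarrow> smooth_on S f \<Longrightarrow> smooth_on S g \<Longrightarrow> smooth_on S (\<lambda>x. f x - g x)"
  using smooth_on_add[of S f "\<lambda>x. - g x"] smooth_on_uminus[of S g] by simp

lemma smooth_on_sum:
  "open S \<Longrightarrow> (\<And>i. i \<in> I \<Longrightarrow> smooth_on S (f i)) \<Longrightarrow> smooth_on S (\<lambda>x. \<Sum>i\<in>I. f i x)"
  unfolding smooth_on_def using Ck_on_sum by metis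

lemma smooth_on_compose:
  fixes f :: "'b::euclidean_space \<Rightarrow> 'c::real_normed_vector"
  shows "open S \<Longrightarrow> open T \<Longrightarrow> smooth_on S g \<Longrightarrow> smooth_on T f \<Longrightarrow> g ` S \<subseteq> T \<Longrightarrow>
    smooth_on S (\<lambda>x. f (g x))"
  unfolding smooth_on_def using Ck_on_compose by blast

lemma smooth_on_has_derivative:
  "smooth_on S f \<Longrightarrow> x \<in> S \<Longrightarrow> (f has_derivative frechet_derivative f (at x)) (at x)"
  using smooth_on_D Ck_on_SucD by blast

lemma smooth_on_derivative: "smooth_on S f \<Longrightarrow> smooth_on S (\<lambda>x. frechet_derivative f (at x) v)"
  unfolding smooth_on_def by (metis Ck_on.simps(2))

lemma smooth_on_imp_continuous_on: "smooth_on S f \<Longrightarrow> continuous_on S f"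
  using smooth_on_D[of S f 0] by simp

section \<open>Smoothness of elementary functions\<close>

text \<open>A sequence closed under differentiation consists of smooth functions; the induction must
  run over all members at once. Each elementary function below is placed at level 0 of such a
  tower.\<close>

lemma smooth_on_real_derivatives:
  fixes f :: "nat \<Rightarrow> real \<Rightarrow> real"
  assumes "open S" "\<And>k x. x \<in> S \<Longrightarrow> (f k has_real_derivative f (Suc k) x) (at x)"
  shows "smooth_on S (f j)"
proof -
  have "Ck_on k (f j) S" for k
  proof (induction k arbitrary: j)
    case 0
    show ?case
      using assms(2) by (auto intro!: continuous_at_imp_continuous_on DERIV_isCont)
  next
    case (Suc k)
    show ?case
      by (rule Ck_on_SucI[OF assms(1) assms(2)[unfolded has_field_derivative_def]])
        (use Suc in \<open>auto intro!: Ck_on_bounded_linear[OF assms(1) bounded_linear_mult_left]\<close>)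
  qed
  then show ?thesis by (simp add: smooth_on_def)
qed

lemma smooth_on_inverse_real: "smooth_on {0<..} (inverse :: real \<Rightarrow> real)"
proof -
  define F :: "nat \<Rightarrow> real \<Rightarrow> real" where "F = (\<lambda>k x. (-1)^k * fact k * inverse x ^ Suc k)"
  have "smooth_on {0<..} (F 0)"
  proof (rule smooth_on_real_derivatives)
    fix k x assume "x \<in> {0::real<..}"
    then have x: "x \<noteq> 0" by simp
    show "(F k has_real_derivative F (Suc k) x) (at x)"
      unfolding F_def
      by (rule derivative_eq_intros refl x | simp add: x field_simps)+
  qed auto
  then show ?thesis by (simp add: F_def)
qed

lemma smooth_on_sqrt: "smooth_on {0<..} sqrt"
proof -
  \<comment> \<open>The k-th derivative of \<open>x powr (1/2)\<close>, the product collecting the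
    exponents brought down.\<close>
  define F :: "nat \<Rightarrow> real \<Rightarrow> real" where
    "F = (\<lambda>k x. (\<Prod>i<k. 1/2 - real i) * x powr (1/2 - real k))"
  have "smooth_on {0<..} (F 0)"
  proof (rule smooth_on_real_derivatives)
    fix k x assume "x \<in> {0::real<..}"
    then have x: "x > 0" by simp
    show "(F k has_real_derivative F (Suc k) x) (at x)"
      unfolding F_def
      by (rule derivative_eq_intros refl x | simp add: x algebra_simps)+
  qed auto
  then show ?thesis
    by (rule smooth_on_cong[rotated 2]) (auto simp: F_def powr_half_sqrt)
qed

lemma smooth_on_norm: "smooth_on (- {0}) (norm :: 'a::euclidean_space \<Rightarrow> real)"
proof -
  have "smooth_on (- {0}) (\<lambda>x::'a. sqrt (x \<bullet> x))"
    by (rule smooth_on_compose[OF _ _ smooth_on_inner smooth_on_sqrt])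
      (auto intro!: smooth_on_linear bounded_linear_ident)
  then show ?thesis by (simp add: norm_eq_sqrt_inner[abs_def])
qed

lemma smooth_on_sgn: "smooth_on (- {0}) (sgn :: 'a::euclidean_space \<Rightarrow> 'a)"
proof -
  have "smooth_on (- {0}) (\<lambda>x::'a. inverse (norm x) *\<^sub>R x)"
    by (intro smooth_on_scaleR smooth_on_compose[OF _ _ smooth_on_norm smooth_on_inverse_real]
        smooth_on_linear bounded_linear_ident) auto
  then show ?thesis by (simp add: sgn_div_norm[abs_def])
qed

lemma smooth_on_sinh: "smooth_on UNIV (sinh :: real \<Rightarrow> real)"
proof -
  have "smooth_on UNIV ((\<lambda>k::nat. if even k then (sinh :: real \<Rightarrow> real) else cosh) 0)"
    by (rule smooth_on_real_derivatives) (auto intro!: derivative_eq_intros)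
  then show ?thesis by simp
qed

text \<open>\<open>diffs\<close> gives the coefficients of the termwise derivative, and convergence
  on the whole line passes from each series to its derivative. Needed for the behaviour of the
  metric at the origin.\<close>

lemma smooth_on_power_series:
  fixes c :: "nat \<Rightarrow> real"
  assumes "\<And>y. summable (\<lambda>n. c n * y ^ n)"
  shows "smooth_on UNIV (\<lambda>x. \<Sum>n. c n * x ^ n)"
proof -
  define F where "F = (\<lambda>k x. \<Sum>n. (diffs ^^ k) c n * x ^ n)"
  have s: "summable (\<lambda>n. (diffs ^^ k) c n * y ^ n)" for k y
    by (induction k arbitrary: y) (auto intro: assms termdiff_converges_all)
  have "smooth_on UNIV (F 0)"
  proof (rule smooth_on_real_derivatives)
    fix k x
    show "(F k has_real_derivative F (Suc k) x) (at x)"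
      using termdiffs_strong_converges_everywhere[OF s[of k]] unfolding F_def by simp
  qed auto
  then show ?thesis by (simp add: F_def)
qed

section \<open>Inner products: orthonormal families and lower bounds\<close>

lemma inner_product_on_D:
  assumes "inner_product_on V B"
  shows "u \<in> V \<Longrightarrow> v \<in> V \<Longrightarrow> B u v = B v u"
    and "u \<in> V \<Longrightarrow> v \<in> V \<Longrightarrow> w \<in> V \<Longrightarrow> B (r *\<^sub>R u + v) w = r * B u w + B v w"
    and "u \<in> V \<Longrightarrow> u \<noteq> 0 \<Longrightarrow> 0 < B u u"
  subgoal using assms unfolding inner_product_on_def by (elim conjE) (drule (1) bspec, drule (1) bspec, assumption)
  subgoal using assms unfolding inner_product_on_def by (elim conjE) (rotate_tac -2, drule (1) bspec, drule (1) bspec, drule (1) bspec, erule spec)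
  subgoal using assms unfolding inner_product_on_def by (elim conjE) (rotate_tac -1, drule (1) bspec, drule (1) mp)
  done

lemma inner_product_on_bilinear:
  assumes "inner_product_on V B" "subspace V" "u \<in> V" "v \<in> V" "w \<in> V"
  shows "B (u + v) w = B u w + B v w" "B w (u + v) = B w u + B w v"
    "B (r *\<^sub>R u) w = r * B u w" "B w (r *\<^sub>R u) = r * B w u"
    "B (u - v) w = B u w - B v w" "B w (u - v) = B w u - B w v"
    "B 0 w = 0" "B w 0 = 0"
proof -
  note D = inner_product_on_D[OF assms(1)] and S = subspace_0[OF assms(2)] subspace_add[OF assms(2)]
    subspace_scale[OF assms(2)] subspace_diff[OF assms(2)]
  have 0: "B 0 x = 0" if "x \<in> V" for x
    using D(2)[of 0 0 x 1] that S by simp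
  have sc: "B (s *\<^sub>R x) y = s * B x y" if "x \<in> V" "y \<in> V" for s x y
    using D(2)[of x 0 y s] that S 0 by simp
  have ad: "B (x + y) z = B x z + B y z" if "x \<in> V" "y \<in> V" "z \<in> V" for x y z
    using D(2)[of x y z 1] that by simp
  have mi: "B (x - y) z = B x z - B y z" if "x \<in> V" "y \<in> V" "z \<in> V" for x y z
    using D(2)[of y x z "-1"] that by simp
  show "B (u + v) w = B u w + B v w" "B (r *\<^sub>R u) w = r * B u w" "B (u - v) w = B u w - B v w" "B 0 w = 0"
    using ad sc mi 0 assms by auto
  show "B w (u + v) = B w u + B w v" "B w (r *\<^sub>R u) = r * B w u" "B w (u - v) = B w u - B w v" "B w 0 = 0"
    using ad sc mi 0 D(1)[of w] S assms by simp_all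
qed

lemma inner_product_on_sum:
  assumes "inner_product_on V B" "subspace V" "w \<in> V" "\<And>i. i \<in> I \<Longrightarrow> u i \<in> V"
  shows "B (\<Sum>i\<in>I. r i *\<^sub>R u i) w = (\<Sum>i\<in>I. r i * B (u i) w)"
    and "B w (\<Sum>i\<in>I. r i *\<^sub>R u i) = (\<Sum>i\<in>I. r i * B w (u i))"
proof -
  note bl = inner_product_on_bilinear[OF assms(1,2)]
  have *: "(\<Sum>i\<in>J. r i *\<^sub>R u i) \<in> V" if "J \<subseteq> I" for J
    using that assms by (intro subspace_sum subspace_scale) auto
  have "B (\<Sum>i\<in>J. r i *\<^sub>R u i) w = (\<Sum>i\<in>J. r i * B (u i) w) \<and>
     B w (\<Sum>i\<in>J. r i *\<^sub>R u i) = (\<Sum>i\<in>J. r i * B w (u i))" if "J \<subseteq> I" for J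
    using that
  proof (induction J rule: infinite_finite_induct)
    case (insert j J)
    then have "u j \<in> V" "r j *\<^sub>R u j \<in> V" "(\<Sum>i\<in>J. r i *\<^sub>R u i) \<in> V"
      using assms * by (auto intro: subspace_scale)
    with insert show ?case
      using bl(1,2)[of "r j *\<^sub>R u j" "\<Sum>i\<in>J. r i *\<^sub>R u i" w] bl(3,4)[of "u j" w w] assms(3) by auto
  qed (use bl(7,8)[of w w w] assms(3) in auto)
  from this[OF subset_refl]
  show "B (\<Sum>i\<in>I. r i *\<^sub>R u i) w = (\<Sum>i\<in>I. r i * B (u i) w)"
    and "B w (\<Sum>i\<in>I. r i *\<^sub>R u i) = (\<Sum>i\<in>I. r i * B w (u i))" by auto
qed

text \<open>Gram-Schmidt for an abstract form \<open>B\<close>; the elements of \<open>Basis\<close>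
  serve merely as \<open>DIM('a)\<close> many indices.\<close>

lemma exists_orthonormal_family:
  fixes B :: "'a::euclidean_space \<Rightarrow> 'a \<Rightarrow> real"
  assumes B: "inner_product_on UNIV B"
  shows "\<exists>f :: 'a \<Rightarrow> 'a. \<forall>i\<in>Basis. \<forall>j\<in>Basis. B (f i) (f j) = (if i = j then 1 else 0 :: real)"
proof -
  note bl = inner_product_on_bilinear[OF B subspace_UNIV UNIV_I UNIV_I UNIV_I]
  note sm = inner_product_on_sum[OF B subspace_UNIV UNIV_I UNIV_I]
  have "\<exists>f :: 'a \<Rightarrow> 'a. \<forall>i\<in>I. \<forall>j\<in>I. B (f i) (f j) = (if i = j then 1 else 0 :: real)"
    if "I \<subseteq> (Basis :: 'a set)" for I
    using finite_subset[OF that finite_Basis] that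
  proof (induction I rule: finite_induct)
    case (insert a I)
    then obtain f :: "'a \<Rightarrow> 'a" where f: "\<And>i j. i \<in> I \<Longrightarrow> j \<in> I \<Longrightarrow> B (f i) (f j) = (if i = j then 1 else 0 :: real)"
      by auto
    \<comment> \<open>Fewer than \<open>DIM('a)\<close> vectors cannot span, so some
      \<open>w\<close> lies outside; removing its \<open>B\<close>-projections leaves a nonzero
      vector.\<close>
    have "card I < DIM('a)"
      using insert psubset_card_mono[of "Basis :: 'a set" I] by auto
    then have "dim (f ` I) < DIM('a)"
      using dim_le_card'[of "f ` I"] card_image_le[OF insert(1), of f] insert(1) by simp
    then obtain w where w: "w \<notin> span (f ` I)"
      by (metis UNIV_eq_I dim_UNIV dim_span less_irrefl)
    define w' where "w' = w - (\<Sum>i\<in>I. B w (f i) *\<^sub>R f i)"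
    have "(\<Sum>i\<in>I. B w (f i) *\<^sub>R f i) \<in> span (f ` I)"
      by (intro span_sum span_scale span_base) auto
    then have "w' \<noteq> 0" using w unfolding w'_def by auto
    then have pos: "B w' w' > 0" using inner_product_on_D(3)[OF B] by auto
    have orth: "B w' (f j) = 0" if "j \<in> I" for j
    proof -
      have "(\<Sum>i\<in>I. B w (f i) * B (f i) (f j)) = (\<Sum>i\<in>I. if i = j then B w (f i) else 0)"
        using f that by (intro sum.cong) auto
      then show ?thesis
        unfolding w'_def bl(5) sm using that insert(1) by simp
    qed
    define f' where "f' = f(a := (1 / sqrt (B w' w')) *\<^sub>R w')"
    have "B (f' a) (f' a) = 1"
      using pos by (simp add: f'_def bl(3,4))
    moreover have "B (f' a) (f' j) = 0" "B (f' j) (f' a) = 0" if "j \<in> I" for j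
      using orth[OF that] inner_product_on_D(1)[OF B, of "f j" w'] that insert(2)
      by (auto simp: f'_def bl(3,4))
    moreover have "B (f' i) (f' j) = (if i = j then 1 else 0 :: real)" if "i \<in> I" "j \<in> I" for i j
      using f that insert(2) by (auto simp: f'_def)
    ultimately have "\<forall>i\<in>insert a I. \<forall>j\<in>insert a I. B (f' i) (f' j) = (if i = j then 1 else 0 :: real)"
      using insert(2) by auto
    then show ?case by blast
  qed simp
  from this[OF subset_refl] show ?thesis .
qed

section \<open>Ellipticity from bounds on entries and determinant\<close>

lemma abs_det_le:
  fixes A :: "real ^ 'n ^ 'n"
  assumes "\<And>i j. \<bar>A $ i $ j\<bar> \<le> K"
  shows "\<bar>det A\<bar> \<le> fact CARD('n) * K ^ CARD('n)"
proof -
  have "\<bar>det A\<bar> \<le> (\<Sum>p\<in>{p. p permutes (UNIV::'n set)}. \<bar>of_int (sign p) * (\<Prod>i\<in>UNIV. A $ i $ p i)\<bar>)"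
    unfolding det_def by (rule sum_abs)
  also have "\<dots> \<le> (\<Sum>p\<in>{p. p permutes (UNIV::'n set)}. K ^ CARD('n))"
  proof (rule sum_mono)
    fix p
    have "\<bar>\<Prod>i\<in>UNIV. A $ i $ p i\<bar> \<le> (\<Prod>i\<in>(UNIV::'n set). K)"
      unfolding abs_prod by (rule prod_mono) (simp add: assms)
    then show "\<bar>of_int (sign p) * (\<Prod>i\<in>UNIV. A $ i $ p i)\<bar> \<le> K ^ CARD('n)"
      by (simp add: abs_mult sign_def)
  qed
  also have "\<dots> = fact CARD('n) * K ^ CARD('n)"
    by (simp add: card_permutations)
  finally show ?thesis .
qed

text \<open>The Gram matrix factors as the transpose of \<open>A\<close> times \<open>A\<close>,
  with \<open>A\<close> the inverse of an orthonormal frame \<open>F\<close>. The diagonal of the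
  Gram matrix bounds the columns of \<open>A\<close> by \<open>sqrt c\<close>, its determinant
  bounds that of \<open>A\<close> from below, and Cramer's rule then bounds the entries of
  \<open>F\<close>. Since \<open>B u u\<close> is the squared length of \<open>A *v u\<close>,
  writing \<open>u = F *v (A *v u)\<close> finishes.\<close>

lemma inner_product_lower_bound:
  fixes B :: "real ^ 'n \<Rightarrow> real ^ 'n \<Rightarrow> real"
  assumes B: "inner_product_on UNIV B" and c: "c \<ge> 1"
    and entry: "\<And>i j. \<bar>B (axis i 1) (axis j 1)\<bar> \<le> c"
    and det: "\<bar>det (\<chi> i j. B (axis i 1) (axis j 1))\<bar> > 1 / c"
  shows "u \<bullet> u \<le> (real CARD('n) * fact CARD('n))\<^sup>2 * c ^ (CARD('n) + 1) * B u u"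
proof -
  let ?n = "CARD('n)"
  note sm = inner_product_on_sum[OF B subspace_UNIV UNIV_I UNIV_I]
  define M :: "real ^ 'n ^ 'n" where "M = (\<chi> i j. B (axis i 1) (axis j 1))"
  have BM: "B u v = u \<bullet> (M *v v)" for u v
  proof -
    have *: "w = (\<Sum>i\<in>UNIV. (w $ i) *\<^sub>R axis i 1)" for w :: "real ^ 'n"
      using basis_expansion[of w] by (simp add: scalar_mult_eq_scaleR)
    have "B u v = B (\<Sum>i\<in>UNIV. (u $ i) *\<^sub>R axis i 1) (\<Sum>i\<in>UNIV. (v $ i) *\<^sub>R axis i 1)"
      using *[of u] *[of v] by simp
    also have "\<dots> = (\<Sum>i\<in>UNIV. u $ i * (\<Sum>j\<in>UNIV. v $ j * B (axis i 1) (axis j 1)))"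
      unfolding sm(1) by (simp only: sm(2))
    finally show ?thesis
      by (simp add: inner_vec_def matrix_vector_mult_def M_def mult.commute)
  qed
  obtain f :: "real ^ 'n \<Rightarrow> real ^ 'n"
    where f: "\<forall>i\<in>Basis. \<forall>j\<in>Basis. B (f i) (f j) = (if i = j then 1 else 0 :: real)"
    using exists_orthonormal_family[OF B] by blast
  define F :: "real ^ 'n ^ 'n" where "F = (\<chi> i k. f (axis k 1) $ i)"
  have Fv: "F *v axis k 1 = f (axis k 1)" for k
    by (simp add: F_def matrix_vector_mult_basis column_def vec_eq_iff)
  have sym: "transpose M = M"
    using inner_product_on_D(1)[OF B] by (simp add: M_def transpose_def vec_eq_iff)
  \<comment> \<open>Orthonormality of the columns of \<open>F\<close> says precisely that this
    matrix is a left inverse of \<open>F\<close>.\<close>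
  define A where "A = transpose F ** M"
  have AF: "A ** F = mat 1"
  proof -
    have "(A ** F) $ i $ j = (mat 1 :: real ^ 'n ^ 'n) $ i $ j" for i j
    proof -
      have "(A ** F) $ i $ j = axis i 1 \<bullet> ((A ** F) *v axis j 1)"
        by (simp add: matrix_vector_mult_basis column_def inner_axis')
      also have "\<dots> = axis i 1 \<bullet> (transpose F *v (M *v (F *v axis j 1)))"
        by (simp add: A_def matrix_vector_mul_assoc matrix_mul_assoc)
      also have "\<dots> = (F *v axis i 1) \<bullet> (M *v (F *v axis j 1))"
        by (metis dot_lmul_matrix inner_commute transpose_matrix_vector)
      also have "\<dots> = B (f (axis i 1)) (f (axis j 1))" by (simp add: BM Fv)
      also have "\<dots> = (if i = j then 1 else 0)"
        using f by (auto simp: axis_in_Basis_iff axis_eq_axis)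
      finally show ?thesis by (simp add: mat_def)
    qed
    then show ?thesis by (simp add: vec_eq_iff)
  qed
  then have FA: "F ** A = mat 1" by (simp add: matrix_left_right_inverse)
  have AA: "transpose A ** A = M"
  proof -
    have "transpose A ** A = M ** (F ** A)"
      by (simp add: A_def matrix_transpose_mul sym matrix_mul_assoc)
    then show ?thesis by (simp add: FA)
  qed
  have BA: "B u u = (A *v u) \<bullet> (A *v u)" for u
  proof -
    have "B u u = u \<bullet> (transpose A *v (A *v u))"
      unfolding BM AA[symmetric] by (simp add: matrix_vector_mul_assoc)
    also have "\<dots> = (A *v u) \<bullet> (A *v u)"
      by (metis dot_lmul_matrix inner_commute transpose_matrix_vector)
    finally show ?thesis .
  qed
  have Ale: "\<bar>A $ k $ i\<bar> \<le> sqrt c" for k i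
  proof -
    have "(A $ k $ i)\<^sup>2 \<le> (\<Sum>k\<in>UNIV. (A $ k $ i)\<^sup>2)"
      by (rule member_le_sum) auto
    also have "\<dots> = (transpose A ** A) $ i $ i"
      by (simp add: matrix_matrix_mult_def transpose_def power2_eq_square)
    also have "\<dots> \<le> c" unfolding AA using entry[of i i] by (simp add: M_def)
    finally show ?thesis using real_le_rsqrt by fastforce
  qed
  have sc: "sqrt c \<ge> 1" using c by simp
  have detA: "\<bar>det A\<bar> \<ge> 1 / sqrt c"
  proof -
    have "det M = (det A)\<^sup>2" unfolding AA[symmetric] by (simp add: det_mul det_transpose power2_eq_square)
    then have "(1 / sqrt c)\<^sup>2 \<le> \<bar>det A\<bar>\<^sup>2" using det c by (simp add: M_def power_divide)
    then show ?thesis using abs_ge_zero power2_le_imp_le by blast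
  qed
  then have d0: "det A \<noteq> 0" using sc by auto
  have Fle: "\<bar>F $ i $ k\<bar> \<le> fact ?n * sqrt c ^ (?n + 1)" for i k
  proof -
    have "A *v (F *v axis k 1) = axis k 1" by (simp add: matrix_vector_mul_assoc AF)
    then have "F *v axis k 1 = (\<chi> i. det (\<chi> i' j. if j = i then axis k 1 $ i' else A $ i' $ j) / det A)"
      using cramer[OF d0] by blast
    then have "F $ i $ k = det (\<chi> i' j. if j = i then axis k 1 $ i' else A $ i' $ j) / det A"
      by (simp add: matrix_vector_mult_basis column_def vec_eq_iff)
    \<comment> \<open>The column replaced in Cramer's rule has entries 0 and 1, which
      \<open>c \<ge> 1\<close> keeps below \<open>sqrt c\<close>.\<close>
    moreover have "\<bar>det (\<chi> i' j. if j = i then axis k 1 $ i' else A $ i' $ j)\<bar> \<le> fact ?n * sqrt c ^ ?n"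
    proof (rule abs_det_le)
      fix i' j
      show "\<bar>(\<chi> i' j. if j = i then axis k 1 $ i' else A $ i' $ j) $ i' $ j\<bar> \<le> sqrt c"
        using Ale[of i' j] sc by (simp add: axis_def)
    qed
    moreover have "inverse \<bar>det A\<bar> \<le> sqrt c"
      using le_imp_inverse_le[OF detA] sc by (simp add: field_simps)
    ultimately have "\<bar>F $ i $ k\<bar> \<le> (fact ?n * sqrt c ^ ?n) * sqrt c"
      unfolding abs_divide divide_inverse by (auto simp: abs_mult intro!: mult_mono)
    then show ?thesis by (simp add: algebra_simps)
  qed
  have Fsq: "(F $ i $ k)\<^sup>2 \<le> (fact ?n)\<^sup>2 * c ^ (?n + 1)" for i k
  proof -
    have "\<bar>F $ i $ k\<bar>\<^sup>2 \<le> (fact ?n * sqrt c ^ (?n + 1))\<^sup>2" using Fle by (rule power_mono) simp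
    also have "\<dots> = (fact ?n)\<^sup>2 * ((sqrt c)\<^sup>2) ^ (?n + 1)"
      by (simp only: power_mult_distrib power_mult[symmetric] mult.commute)
    finally show ?thesis using c by simp
  qed
  define a where "a = A *v u"
  have u: "u = F *v a" by (simp add: a_def matrix_vector_mul_assoc FA)
  \<comment> \<open>One factor \<open>n\<close> comes from Cauchy-Schwarz here, the second from
    summing over \<open>i\<close> afterwards.\<close>
  have "(u $ i)\<^sup>2 \<le> real ?n * ((fact ?n)\<^sup>2 * c ^ (?n + 1)) * (a \<bullet> a)" for i
  proof -
    have "(u $ i)\<^sup>2 = (\<Sum>k\<in>UNIV. F $ i $ k * a $ k)\<^sup>2" by (simp add: u matrix_vector_mult_def)
    also have "\<dots> \<le> (\<Sum>k\<in>UNIV. (F $ i $ k)\<^sup>2) * (\<Sum>k\<in>UNIV. (a $ k)\<^sup>2)"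
      by (rule Cauchy_Schwarz_ineq_sum)
    also have "\<dots> \<le> (\<Sum>k\<in>(UNIV::'n set). (fact ?n)\<^sup>2 * c ^ (?n + 1)) * (a \<bullet> a)"
      using Fsq c by (intro mult_mono sum_mono) (auto simp: inner_vec_def power2_eq_square intro!: sum_nonneg)
    finally show ?thesis by simp
  qed
  then have "(\<Sum>i\<in>UNIV. (u $ i)\<^sup>2) \<le> (\<Sum>i\<in>(UNIV::'n set). real ?n * ((fact ?n)\<^sup>2 * c ^ (?n + 1)) * (a \<bullet> a))"
    by (intro sum_mono)
  also have "\<dots> = (real ?n * fact ?n)\<^sup>2 * c ^ (?n + 1) * B u u"
    by (simp add: BA a_def power2_eq_square algebra_simps)
  finally show ?thesis by (simp add: inner_vec_def power2_eq_square)
qed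

section \<open>Estimates up to second order\<close>

text \<open>
  The bound \<open>M0\<close> on the values is kept apart from the bound \<open>M1\<close> on the derivatives because a rescaling of
  the argument makes only the latter small.
\<close>

definition C2_le :: "real \<Rightarrow> real \<Rightarrow> 'a set \<Rightarrow> ('a::euclidean_space \<Rightarrow> real) \<Rightarrow> bool" where
  "C2_le M0 M1 U f \<longleftrightarrow>
     (\<forall>x\<in>U. f differentiable (at x) \<and> \<bar>f x\<bar> \<le> M0 \<and>
       (\<forall>i\<in>Basis. \<bar>partial_deriv i f x\<bar> \<le> M1 \<and> partial_deriv i f differentiable (at x) \<and>
         (\<forall>j\<in>Basis. \<bar>partial_deriv j (partial_deriv i f) x\<bar> \<le> M1)))"

text \<open>Openness of \<open>U\<close> makes the formula for the first partial derivatives valid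
  near each point, so that it can be differentiated once more.\<close>

lemma C2_leI:
  assumes "open U"
    and "\<And>x. x \<in> U \<Longrightarrow> (f has_derivative f' x) (at x)"
    and "\<And>x i. x \<in> U \<Longrightarrow> i \<in> Basis \<Longrightarrow> ((\<lambda>x. f' x i) has_derivative f'' i x) (at x)"
    and "\<And>x. x \<in> U \<Longrightarrow> \<bar>f x\<bar> \<le> M0"
    and "\<And>x i. x \<in> U \<Longrightarrow> i \<in> Basis \<Longrightarrow> \<bar>f' x i\<bar> \<le> M1"
    and "\<And>x i j. x \<in> U \<Longrightarrow> i \<in> Basis \<Longrightarrow> j \<in> Basis \<Longrightarrow> \<bar>f'' i x j\<bar> \<le> M1"
  shows "C2_le M0 M1 U f"
proof -
  have 1: "partial_deriv i f x = f' x i" if "x \<in> U" for x i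
    using frechet_derivative_at[OF assms(2)[OF that]] by (simp add: partial_deriv_def)
  have 2: "(partial_deriv i f has_derivative f'' i x) (at x)" if "x \<in> U" "i \<in> Basis" for x i
    by (rule has_derivative_transform_within_open[OF assms(3)[OF that] assms(1) that(1)]) (simp add: 1)
  have 3: "partial_deriv j (partial_deriv i f) x = f'' i x j" if "x \<in> U" "i \<in> Basis" for x i j
    using frechet_derivative_at[OF 2[OF that]] by (simp add: partial_deriv_def)
  show ?thesis
    unfolding C2_le_def
  proof (intro ballI conjI)
    fix x assume x: "x \<in> U"
    show "f differentiable (at x)" using assms(2)[OF x] by (auto simp: differentiable_def)
    show "\<bar>f x\<bar> \<le> M0" using assms(4)[OF x] .
    fix i :: 'a assume i: "i \<in> Basis"
    show "\<bar>partial_deriv i f x\<bar> \<le> M1" using assms(5)[OF x i] 1[OF x] by simp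
    show "partial_deriv i f differentiable (at x)" using 2[OF x i] by (auto simp: differentiable_def)
    fix j :: 'a assume j: "j \<in> Basis"
    show "\<bar>partial_deriv j (partial_deriv i f) x\<bar> \<le> M1"
      using assms(6)[OF x i j] 3[OF x i] by simp
  qed
qed

lemma C2_leD:
  assumes "C2_le M0 M1 U f" "x \<in> U"
  shows "(f has_derivative frechet_derivative f (at x)) (at x)" "\<bar>f x\<bar> \<le> M0"
    and "i \<in> Basis \<Longrightarrow> \<bar>frechet_derivative f (at x) i\<bar> \<le> M1"
    and "i \<in> Basis \<Longrightarrow> ((\<lambda>x. frechet_derivative f (at x) i) has_derivative
      frechet_derivative (\<lambda>x. frechet_derivative f (at x) i) (at x)) (at x)"
    and "i \<in> Basis \<Longrightarrow> j \<in> Basis \<Longrightarrow>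
      \<bar>frechet_derivative (\<lambda>x. frechet_derivative f (at x) i) (at x) j\<bar> \<le> M1"
  using assms unfolding C2_le_def partial_deriv_def by (simp_all add: frechet_derivative_works[symmetric])

lemma C2_le_cong:
  assumes "open U" "C2_le M0 M1 U f" "\<And>x. x \<in> U \<Longrightarrow> f x = g x"
  shows "C2_le M0 M1 U g"
proof (rule C2_leI[where f''="\<lambda>i x. frechet_derivative (\<lambda>x. frechet_derivative f (at x) i) (at x)", OF assms(1)])
  fix x assume x: "x \<in> U"
  show "(g has_derivative frechet_derivative f (at x)) (at x)"
    by (rule has_derivative_transform_within_open[OF C2_leD(1)[OF assms(2) x] assms(1) x assms(3)])
  show "\<bar>g x\<bar> \<le> M0" using C2_leD(2)[OF assms(2) x] assms(3)[OF x] by simp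
qed (use C2_leD[OF assms(2)] in auto)

lemma C2_le_mono: "C2_le M0 M1 U f \<Longrightarrow> M0 \<le> N0 \<Longrightarrow> M1 \<le> N1 \<Longrightarrow> V \<subseteq> U \<Longrightarrow> C2_le N0 N1 V f"
  unfolding C2_le_def by (blast intro: order_trans)

lemma C2_le_const: "C2_le \<bar>k\<bar> 0 U (\<lambda>x. k)"
  by (simp add: C2_le_def partial_deriv_def)

lemma C2_le_add:
  assumes "open U" "C2_le M0 M1 U f" "C2_le N0 N1 U g"
  shows "C2_le (M0 + N0) (M1 + N1) U (\<lambda>x. f x + g x)"
proof (rule C2_leI[OF assms(1)])
  note D = C2_leD[OF assms(2)] C2_leD[OF assms(3)]
  fix x assume x: "x \<in> U"
  show "((\<lambda>x. f x + g x) has_derivative (\<lambda>v. frechet_derivative f (at x) v + frechet_derivative g (at x) v)) (at x)"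
    by (rule has_derivative_add[OF D(1,6)[OF x]])
  show "\<bar>f x + g x\<bar> \<le> M0 + N0" using D(2,7)[OF x] by linarith
  fix i :: 'a assume i: "i \<in> Basis"
  show "\<bar>frechet_derivative f (at x) i + frechet_derivative g (at x) i\<bar> \<le> M1 + N1"
    using D(3,8)[OF x i] by linarith
  show "((\<lambda>x. frechet_derivative f (at x) i + frechet_derivative g (at x) i) has_derivative
    (\<lambda>v. frechet_derivative (\<lambda>x. frechet_derivative f (at x) i) (at x) v +
      frechet_derivative (\<lambda>x. frechet_derivative g (at x) i) (at x) v)) (at x)"
    by (rule has_derivative_add[OF D(4,9)[OF x i]])
  fix j :: 'a assume j: "j \<in> Basis"
  show "\<bar>frechet_derivative (\<lambda>x. frechet_derivative f (at x) i) (at x) j +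
      frechet_derivative (\<lambda>x. frechet_derivative g (at x) i) (at x) j\<bar> \<le> M1 + N1"
    using D(5,10)[OF x i j] by linarith
qed

lemma C2_le_cmult:
  assumes "open U" "C2_le M0 M1 U f"
  shows "C2_le (\<bar>r\<bar> * M0) (\<bar>r\<bar> * M1) U (\<lambda>x. r * f x)"
proof (rule C2_leI[OF assms(1)])
  note D = C2_leD[OF assms(2)]
  fix x assume x: "x \<in> U"
  show "((\<lambda>x. r * f x) has_derivative (\<lambda>v. r * frechet_derivative f (at x) v)) (at x)"
    by (rule has_derivative_mult_right[OF D(1)[OF x]])
  show "\<bar>r * f x\<bar> \<le> \<bar>r\<bar> * M0" using D(2)[OF x] by (simp add: abs_mult mult_left_mono)
  fix i :: 'a assume i: "i \<in> Basis"
  show "\<bar>r * frechet_derivative f (at x) i\<bar> \<le> \<bar>r\<bar> * M1"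
    using D(3)[OF x i] by (simp add: abs_mult mult_left_mono)
  show "((\<lambda>x. r * frechet_derivative f (at x) i) has_derivative
    (\<lambda>v. r * frechet_derivative (\<lambda>x. frechet_derivative f (at x) i) (at x) v)) (at x)"
    by (rule has_derivative_mult_right[OF D(4)[OF x i]])
  fix j :: 'a assume j: "j \<in> Basis"
  show "\<bar>r * frechet_derivative (\<lambda>x. frechet_derivative f (at x) i) (at x) j\<bar> \<le> \<bar>r\<bar> * M1"
    using D(5)[OF x i j] by (simp add: abs_mult mult_left_mono)
qed

lemma C2_le_sum:
  assumes "open U" "finite I" "\<And>i. i \<in> I \<Longrightarrow> C2_le M0 M1 U (f i)"
  shows "C2_le ((\<Sum>i\<in>I. \<bar>r i\<bar>) * M0) ((\<Sum>i\<in>I. \<bar>r i\<bar>) * M1) U (\<lambda>x. \<Sum>i\<in>I. r i * f i x)"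
  using assms(2,3)
proof (induction I rule: finite_induct)
  case empty
  show ?case using C2_le_const[of 0] by simp
next
  case (insert a I)
  have "C2_le (\<bar>r a\<bar> * M0 + (\<Sum>i\<in>I. \<bar>r i\<bar>) * M0) (\<bar>r a\<bar> * M1 + (\<Sum>i\<in>I. \<bar>r i\<bar>) * M1) U
     (\<lambda>x. r a * f a x + (\<Sum>i\<in>I. r i * f i x))"
    by (intro C2_le_add[OF assms(1)] C2_le_cmult[OF assms(1)]) (use insert in auto)
  then show ?case using insert(1,2) by (simp add: distrib_right)
qed

text \<open>The sum norm is the one dual to bounds on basis vectors, which is why frames are
  measured in it throughout.\<close>

lemma linear_bound_by_basis:
  fixes T :: "'a::euclidean_space \<Rightarrow> real"
  assumes "linear T" "\<And>b. b \<in> Basis \<Longrightarrow> \<bar>T b\<bar> \<le> M"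
  shows "\<bar>T v\<bar> \<le> (\<Sum>b\<in>Basis. \<bar>v \<bullet> b\<bar>) * M"
proof -
  have "T v = T (\<Sum>b\<in>Basis. (v \<bullet> b) *\<^sub>R b)" by (simp add: euclidean_representation)
  also have "\<dots> = (\<Sum>b\<in>Basis. (v \<bullet> b) * T b)"
    by (simp add: linear_sum[OF assms(1)] linear_scale[OF assms(1)])
  also have "\<bar>\<dots>\<bar> \<le> (\<Sum>b\<in>Basis. \<bar>v \<bullet> b\<bar> * M)"
    by (rule order_trans[OF sum_abs]) (auto simp: abs_mult intro!: sum_mono mult_left_mono assms)
  finally show ?thesis by (simp add: sum_distrib_right)
qed

text \<open>First derivatives gain \<open>\<tau>\<close> and second ones \<open>\<tau>^2\<close>;
  with \<open>\<tau> \<le> 1\<close> the single factor \<open>\<tau>\<close> serves for both orders,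
  while the values gain nothing.\<close>

lemma C2_le_affine:
  fixes T :: "'b::euclidean_space \<Rightarrow> 'a::euclidean_space"
  assumes "open V" "C2_le M0 M1 U f" "linear T" "\<And>y. y \<in> V \<Longrightarrow> z + T y \<in> U"
    and \<tau>: "\<And>i. i \<in> Basis \<Longrightarrow> (\<Sum>b\<in>Basis. \<bar>T i \<bullet> b\<bar>) \<le> \<tau>" "\<tau> \<le> 1" and "0 \<le> M1"
  shows "C2_le M0 (\<tau> * M1) V (\<lambda>y. f (z + T y))"
proof (rule C2_leI[OF assms(1)])
  note D = C2_leD[OF assms(2)]
  have T: "((\<lambda>y. z + T y) has_derivative T) (at y)" for y
    using linear_imp_has_derivative[OF assms(3)] by (auto intro!: derivative_eq_intros)
  let ?D = "\<lambda>x v. frechet_derivative f (at x) v"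
  let ?DD = "\<lambda>b x. frechet_derivative (\<lambda>x. frechet_derivative f (at x) b) (at x)"
  fix y assume y: "y \<in> V"
  note z = assms(4)[OF y]
  have lin: "?D x v = (\<Sum>b\<in>Basis. (v \<bullet> b) * ?D x b)" if "x \<in> U" for x v
  proof -
    have L: "linear (?D x)" using D(1)[OF that] has_derivative_linear by blast
    have "?D x (\<Sum>b\<in>Basis. (v \<bullet> b) *\<^sub>R b) = (\<Sum>b\<in>Basis. (v \<bullet> b) * ?D x b)"
      by (simp only: linear_sum[OF L] linear_scale[OF L] real_scaleR_def)
    then show ?thesis by (simp only: euclidean_representation)
  qed
  have L: "linear (?D (z + T y))" using D(1)[OF z] has_derivative_linear by blast
  show "((\<lambda>y. f (z + T y)) has_derivative (\<lambda>v. \<Sum>b\<in>Basis. (T v \<bullet> b) * ?D (z + T y) b)) (at y)"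
    using has_derivative_compose[OF T D(1)[OF z]]
    by (rule has_derivative_eq_rhs) (rule ext, rule lin[OF z])
  show "\<bar>f (z + T y)\<bar> \<le> M0" using D(2)[OF z] .
  fix i :: 'b assume i: "i \<in> Basis"
  have "\<bar>?D (z + T y) (T i)\<bar> \<le> (\<Sum>b\<in>Basis. \<bar>T i \<bullet> b\<bar>) * M1"
    by (rule linear_bound_by_basis[OF L D(3)[OF z]])
  also have "\<dots> \<le> \<tau> * M1" using \<tau>(1)[OF i] assms(7) by (rule mult_right_mono)
  finally show "\<bar>\<Sum>b\<in>Basis. (T i \<bullet> b) * ?D (z + T y) b\<bar> \<le> \<tau> * M1"
    unfolding lin[OF z, of "T i", symmetric] .
  have d: "((\<lambda>y. ?D (z + T y) b) has_derivative (\<lambda>v. ?DD b (z + T y) (T v))) (at y)" if "b \<in> Basis" for b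
    by (rule has_derivative_compose[OF T D(4)[OF z that]])
  show "((\<lambda>y. \<Sum>b\<in>Basis. (T i \<bullet> b) * ?D (z + T y) b) has_derivative
     (\<lambda>v. \<Sum>b\<in>Basis. (T i \<bullet> b) * ?DD b (z + T y) (T v))) (at y)"
    by (intro has_derivative_sum has_derivative_mult_right d)
  fix j :: 'b assume j: "j \<in> Basis"
  have \<tau>0: "0 \<le> \<tau>" by (rule order_trans[OF sum_nonneg \<tau>(1)[OF i]]) simp
  have "\<bar>?DD b (z + T y) (T j)\<bar> \<le> \<tau> * M1" if b: "b \<in> Basis" for b
  proof -
    have "linear (?DD b (z + T y))" using D(4)[OF z b] has_derivative_linear by blast
    then have "\<bar>?DD b (z + T y) (T j)\<bar> \<le> (\<Sum>b\<in>Basis. \<bar>T j \<bullet> b\<bar>) * M1"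
      by (rule linear_bound_by_basis[OF _ D(5)[OF z b]])
    also have "\<dots> \<le> \<tau> * M1" using \<tau>(1)[OF j] assms(7) by (rule mult_right_mono)
    finally show ?thesis .
  qed
  then have "\<bar>\<Sum>b\<in>Basis. (T i \<bullet> b) * ?DD b (z + T y) (T j)\<bar> \<le> (\<Sum>b\<in>Basis. \<bar>T i \<bullet> b\<bar> * (\<tau> * M1))"
    by (intro order_trans[OF sum_abs] sum_mono) (auto simp: abs_mult intro!: mult_left_mono)
  also have "\<dots> \<le> \<tau> * (\<tau> * M1)"
    unfolding sum_distrib_right[symmetric] using \<tau>(1)[OF i] \<tau>0 assms(7) by (intro mult_right_mono) auto
  also have "\<dots> \<le> \<tau> * M1"
    using \<tau>(2) \<tau>0 assms(7) by (simp add: mult_left_le_one_le)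
  finally show "\<bar>\<Sum>b\<in>Basis. (T i \<bullet> b) * ?DD b (z + T y) (T j)\<bar> \<le> \<tau> * M1" .
qed

lemma sum_abs_Basis_le_DIM: "norm v \<le> 1 \<Longrightarrow> (\<Sum>b\<in>Basis. \<bar>v \<bullet> b\<bar>) \<le> real DIM('a)" for v :: "'a::euclidean_space"
  using sum_bounded_above[of Basis "\<lambda>b. \<bar>v \<bullet> b\<bar>" 1] Basis_le_norm[of _ v] by fastforce

text \<open>The mean value theorem on the segment from 0 to \<open>x\<close> converts the derivative
  bound into a bound on values. After a rescaling this makes the deviation from the value at the
  centre small.\<close>

lemma C2_le_minus_center:
  fixes f :: "'a::euclidean_space \<Rightarrow> real"
  assumes "C2_le M0 M1 (ball 0 1) f" "0 \<le> M1"
  shows "C2_le (real DIM('a) * M1) M1 (ball 0 1) (\<lambda>x. f x - f 0)"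
proof (rule C2_leI[where f''="\<lambda>i x. frechet_derivative (\<lambda>x. frechet_derivative f (at x) i) (at x)"])
  note D = C2_leD[OF assms(1)]
  fix x :: 'a assume x: "x \<in> ball 0 1"
  show "((\<lambda>x. f x - f 0) has_derivative frechet_derivative f (at x)) (at x)"
    using has_derivative_diff[OF D(1)[OF x] has_derivative_const[of "f 0"]] by simp
  show "\<bar>f x - f 0\<bar> \<le> real DIM('a) * M1"
  proof -
    define h where "h = (\<lambda>s. f (s *\<^sub>R x))"
    have *: "(h has_derivative (\<lambda>r. frechet_derivative f (at (s *\<^sub>R x)) (r *\<^sub>R x))) (at s)"
      if "0 \<le> s" "s \<le> 1" for s
    proof -
      have "norm (s *\<^sub>R x) < 1"
        using that x mult_left_le_one_le[of "norm x" s] by simp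
      then have "s *\<^sub>R x \<in> ball 0 1" by simp
      note 1 = D(1)[OF this]
      have 2: "((\<lambda>s. s *\<^sub>R x) has_derivative (\<lambda>r. r *\<^sub>R x)) (at s)"
        by (auto intro!: derivative_eq_intros)
      show ?thesis unfolding h_def by (rule has_derivative_compose[OF 2 1])
    qed
    have "continuous_on {0..1} h"
    proof (rule continuous_at_imp_continuous_on, rule ballI)
      fix s :: real assume "s \<in> {0..1}"
      then show "isCont h s" using has_derivative_continuous[OF *[of s]] by simp
    qed
    then obtain s where s: "0 < s" "s < 1" "h 1 - h 0 = frechet_derivative f (at (s *\<^sub>R x)) ((1 - 0) *\<^sub>R x)"
      by (rule mvt[of 0 1 h, OF zero_less_one _ *]) auto
    have sx: "s *\<^sub>R x \<in> ball 0 1"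
      using s(1,2) x mult_left_le_one_le[of "norm x" s] by simp
    have "\<bar>frechet_derivative f (at (s *\<^sub>R x)) x\<bar> \<le> (\<Sum>b\<in>Basis. \<bar>x \<bullet> b\<bar>) * M1"
      using linear_bound_by_basis[OF has_derivative_linear[OF D(1)[OF sx]] D(3)[OF sx]] .
    also have "\<dots> \<le> real DIM('a) * M1"
      using sum_abs_Basis_le_DIM[of x] x assms(2) by (intro mult_right_mono) auto
    finally show ?thesis using s(3) by (simp add: h_def)
  qed
qed (use C2_leD[OF assms(1)] in auto)

section \<open>Products of a function of \<open>t\<close> with a function of
  \<open>x\<close>\<close>

text \<open>The derivatives are existentially quantified, so closed formulas can be supplied as
  witnesses without computing \<open>deriv\<close>.\<close>

definition D2_le :: "real \<Rightarrow> real set \<Rightarrow> (real \<Rightarrow> real) \<Rightarrow> bool" where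
  "D2_le A I \<alpha> \<longleftrightarrow> (\<exists>\<alpha>' \<alpha>''. \<forall>t\<in>I. (\<alpha> has_real_derivative \<alpha>' t) (at t) \<and>
     (\<alpha>' has_real_derivative \<alpha>'' t) (at t) \<and> \<bar>\<alpha> t\<bar> \<le> A \<and> \<bar>\<alpha>' t\<bar> \<le> A \<and> \<bar>\<alpha>'' t\<bar> \<le> A)"

lemma D2_leI:
  assumes "\<And>t. t \<in> I \<Longrightarrow> (\<alpha> has_real_derivative \<alpha>' t) (at t)"
    and "\<And>t. t \<in> I \<Longrightarrow> (\<alpha>' has_real_derivative \<alpha>'' t) (at t)"
    and "\<And>t. t \<in> I \<Longrightarrow> \<bar>\<alpha> t\<bar> \<le> A" "\<And>t. t \<in> I \<Longrightarrow> \<bar>\<alpha>' t\<bar> \<le> A" "\<And>t. t \<in> I \<Longrightarrow> \<bar>\<alpha>'' t\<bar> \<le> A"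
  shows "D2_le A I \<alpha>"
  unfolding D2_le_def using assms by blast

lemma D2_le_mono: "D2_le A I \<alpha> \<Longrightarrow> A \<le> B \<Longrightarrow> D2_le B I \<alpha>"
  unfolding D2_le_def by (meson order_trans)

lemma D2_le_add:
  assumes "D2_le A I \<alpha>" "D2_le B I \<beta>"
  shows "D2_le (A + B) I (\<lambda>t. \<alpha> t + \<beta> t)"
proof -
  obtain \<alpha>' \<alpha>'' where a: "\<forall>t\<in>I. (\<alpha> has_real_derivative \<alpha>' t) (at t) \<and>
     (\<alpha>' has_real_derivative \<alpha>'' t) (at t) \<and> \<bar>\<alpha> t\<bar> \<le> A \<and> \<bar>\<alpha>' t\<bar> \<le> A \<and> \<bar>\<alpha>'' t\<bar> \<le> A"
    using assms(1) unfolding D2_le_def by blast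
  obtain \<beta>' \<beta>'' where b: "\<forall>t\<in>I. (\<beta> has_real_derivative \<beta>' t) (at t) \<and>
     (\<beta>' has_real_derivative \<beta>'' t) (at t) \<and> \<bar>\<beta> t\<bar> \<le> B \<and> \<bar>\<beta>' t\<bar> \<le> B \<and> \<bar>\<beta>'' t\<bar> \<le> B"
    using assms(2) unfolding D2_le_def by blast
  show ?thesis
    by (rule D2_leI[where \<alpha>'="\<lambda>t. \<alpha>' t + \<beta>' t" and \<alpha>''="\<lambda>t. \<alpha>'' t + \<beta>'' t"])
      (use a b in \<open>auto intro!: DERIV_add intro: order_trans[OF abs_triangle_ineq add_mono]\<close>)
qed

lemma D2_le_cmult:
  assumes "D2_le A I \<alpha>"
  shows "D2_le (\<bar>r\<bar> * A) I (\<lambda>t. r * \<alpha> t)"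
proof -
  obtain \<alpha>' \<alpha>'' where a: "\<forall>t\<in>I. (\<alpha> has_real_derivative \<alpha>' t) (at t) \<and>
     (\<alpha>' has_real_derivative \<alpha>'' t) (at t) \<and> \<bar>\<alpha> t\<bar> \<le> A \<and> \<bar>\<alpha>' t\<bar> \<le> A \<and> \<bar>\<alpha>'' t\<bar> \<le> A"
    using assms(1) unfolding D2_le_def by blast
  show ?thesis
    by (rule D2_leI[where \<alpha>'="\<lambda>t. r * \<alpha>' t" and \<alpha>''="\<lambda>t. r * \<alpha>'' t"])
      (use a in \<open>auto intro!: DERIV_cmult mult_left_mono simp: abs_mult\<close>)
qed

text \<open>The 4 is the sum \<open>1 + 2 + 1\<close> of the Leibniz coefficients of the second
  derivative.\<close>

lemma D2_le_mult:
  assumes "D2_le A I \<alpha>" "D2_le B I \<beta>" "0 \<le> A" "0 \<le> B"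
  shows "D2_le (4 * A * B) I (\<lambda>t. \<alpha> t * \<beta> t)"
proof -
  obtain \<alpha>' \<alpha>'' where a: "\<forall>t\<in>I. (\<alpha> has_real_derivative \<alpha>' t) (at t) \<and>
     (\<alpha>' has_real_derivative \<alpha>'' t) (at t) \<and> \<bar>\<alpha> t\<bar> \<le> A \<and> \<bar>\<alpha>' t\<bar> \<le> A \<and> \<bar>\<alpha>'' t\<bar> \<le> A"
    using assms(1) unfolding D2_le_def by blast
  obtain \<beta>' \<beta>'' where b: "\<forall>t\<in>I. (\<beta> has_real_derivative \<beta>' t) (at t) \<and>
     (\<beta>' has_real_derivative \<beta>'' t) (at t) \<and> \<bar>\<beta> t\<bar> \<le> B \<and> \<bar>\<beta>' t\<bar> \<le> B \<and> \<bar>\<beta>'' t\<bar> \<le> B"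
    using assms(2) unfolding D2_le_def by blast
  have m: "\<bar>x * y\<bar> \<le> A * B" if "\<bar>x\<bar> \<le> A" "\<bar>y\<bar> \<le> B" for x y
    using that assms(3) by (simp add: abs_mult mult_mono)
  show ?thesis
  proof (rule D2_leI)
    fix t assume t: "t \<in> I"
    show "((\<lambda>t. \<alpha> t * \<beta> t) has_real_derivative \<alpha>' t * \<beta> t + \<alpha> t * \<beta>' t) (at t)"
      using a b t by (auto intro!: derivative_eq_intros)
    show "((\<lambda>t. \<alpha>' t * \<beta> t + \<alpha> t * \<beta>' t) has_real_derivative
        \<alpha>'' t * \<beta> t + 2 * (\<alpha>' t * \<beta>' t) + \<alpha> t * \<beta>'' t) (at t)"
      using a b t by (auto intro!: derivative_eq_intros)
    have "\<bar>\<alpha> t * \<beta> t\<bar> \<le> A * B" "\<bar>\<alpha>' t * \<beta> t\<bar> \<le> A * B" "\<bar>\<alpha>'' t * \<beta> t\<bar> \<le> A * B"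
      "\<bar>\<alpha> t * \<beta>' t\<bar> \<le> A * B" "\<bar>\<alpha>' t * \<beta>' t\<bar> \<le> A * B" "\<bar>\<alpha> t * \<beta>'' t\<bar> \<le> A * B"
      using a b t by (auto intro!: m)
    then show "\<bar>\<alpha> t * \<beta> t\<bar> \<le> 4 * A * B" "\<bar>\<alpha>' t * \<beta> t + \<alpha> t * \<beta>' t\<bar> \<le> 4 * A * B"
      "\<bar>\<alpha>'' t * \<beta> t + 2 * (\<alpha>' t * \<beta>' t) + \<alpha> t * \<beta>'' t\<bar> \<le> 4 * A * B"
      by linarith+
  qed
qed

lemma has_derivative_separated_product:
  assumes "(\<alpha> has_real_derivative \<alpha>') (at (snd p))" "(\<beta> has_derivative \<beta>') (at (fst p))"
  shows "((\<lambda>p. \<alpha> (snd p) * \<beta> (fst p)) has_derivative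
    (\<lambda>v. \<alpha> (snd p) * \<beta>' (fst v) + snd v * \<alpha>' * \<beta> (fst p))) (at p)"
proof -
  have 1: "((\<lambda>p. \<beta> (fst p)) has_derivative (\<lambda>v. \<beta>' (fst v))) (at p)"
    by (rule has_derivative_compose[OF has_derivative_fst[OF has_derivative_ident] assms(2)])
  have 2: "((\<lambda>p. \<alpha> (snd p)) has_derivative (\<lambda>v. \<alpha>' * snd v)) (at p)"
    by (rule has_derivative_compose[OF has_derivative_snd[OF has_derivative_ident]
          assms(1)[unfolded has_field_derivative_def]])
  show ?thesis
    using has_derivative_mult[OF 2 1] by (rule has_derivative_eq_rhs) (simp add: algebra_simps)
qed

text \<open>No combinatorial factor appears: since the variables are separated, each partial
  derivative of order at most two is a single product of a derivative of \<open>\<alpha>\<close> and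
  one of \<open>\<beta>\<close>.\<close>

lemma C2_le_separated_product:
  fixes \<beta> :: "'a::euclidean_space \<Rightarrow> real"
  assumes "open V" "open I" "D2_le A I \<alpha>" "C2_le B B V \<beta>" "0 \<le> A"
  shows "C2_le (A * B) (A * B) (V \<times> I) (\<lambda>p. \<alpha> (snd p) * \<beta> (fst p))"
proof -
  obtain \<alpha>' \<alpha>'' where a: "\<forall>t\<in>I. (\<alpha> has_real_derivative \<alpha>' t) (at t) \<and>
     (\<alpha>' has_real_derivative \<alpha>'' t) (at t) \<and> \<bar>\<alpha> t\<bar> \<le> A \<and> \<bar>\<alpha>' t\<bar> \<le> A \<and> \<bar>\<alpha>'' t\<bar> \<le> A"
    using assms(3) unfolding D2_le_def by blast
  note b = C2_leD[OF assms(4)]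
  have m: "\<bar>x * y\<bar> \<le> A * B" if "\<bar>x\<bar> \<le> A" "\<bar>y\<bar> \<le> B" for x y
    using that assms(5) by (simp add: abs_mult mult_mono)
  let ?D = "\<lambda>x v. frechet_derivative \<beta> (at x) v"
  let ?DD = "\<lambda>i x. frechet_derivative (\<lambda>x. ?D x i) (at x)"
  \<comment> \<open>The table of second derivatives. A vanishing first component marks the radial
    direction \<open>(0, 1)\<close>, because a basis vector \<open>(k, 0)\<close> has nonzero
    \<open>k\<close>.\<close>
  define G :: "'a \<times> real \<Rightarrow> 'a \<times> real \<Rightarrow> 'a \<times> real \<Rightarrow> real"
    where "G = (\<lambda>i p. if fst i = 0 then (\<lambda>v. \<alpha>' (snd p) * ?D (fst p) (fst v) + snd v * \<alpha>'' (snd p) * \<beta> (fst p))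
     else (\<lambda>v. \<alpha> (snd p) * ?DD (fst i) (fst p) (fst v) + snd v * \<alpha>' (snd p) * ?D (fst p) (fst i)))"
  show ?thesis
  proof (rule C2_leI[where f''=G, OF open_Times[OF assms(1,2)]])
  fix p assume "p \<in> V \<times> I"
  then have p: "fst p \<in> V" "snd p \<in> I" by auto
  show "((\<lambda>p. \<alpha> (snd p) * \<beta> (fst p)) has_derivative
      (\<lambda>v. \<alpha> (snd p) * ?D (fst p) (fst v) + snd v * \<alpha>' (snd p) * \<beta> (fst p))) (at p)"
    using a p b(1) by (intro has_derivative_separated_product) auto
  show "\<bar>\<alpha> (snd p) * \<beta> (fst p)\<bar> \<le> A * B" using a p b(2) by (intro m) auto
  fix i :: "'a \<times> real" assume "i \<in> Basis"
  then have i: "(\<exists>k\<in>Basis. i = (k, 0)) \<or> i = (0, 1)" by (auto simp: Basis_prod_def)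
  have L: "linear (?D (fst p))" using b(1)[OF p(1)] has_derivative_linear by blast
  show "\<bar>\<alpha> (snd p) * ?D (fst p) (fst i) + snd i * \<alpha>' (snd p) * \<beta> (fst p)\<bar> \<le> A * B"
    using i a p b(2,3) linear_0[OF L] by (auto intro!: m)
  have nz: "k \<noteq> 0" if "k \<in> Basis" for k :: 'a using that by auto
  show "((\<lambda>p. \<alpha> (snd p) * ?D (fst p) (fst i) + snd i * \<alpha>' (snd p) * \<beta> (fst p)) has_derivative G i p) (at p)"
    using i
  proof
    assume "\<exists>k\<in>Basis. i = (k, 0)"
    then obtain k where k: "k \<in> Basis" "i = (k, 0)" by blast
    have "((\<lambda>p. \<alpha> (snd p) * ?D (fst p) k) has_derivative
        (\<lambda>v. \<alpha> (snd p) * ?DD k (fst p) (fst v) + snd v * \<alpha>' (snd p) * ?D (fst p) k)) (at p)"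
      using a p b(4)[OF p(1) k(1)] by (intro has_derivative_separated_product) auto
    then show ?thesis using k nz by (simp add: G_def)
  next
    assume i: "i = (0, 1)"
    have "((\<lambda>p. \<alpha>' (snd p) * \<beta> (fst p)) has_derivative
        (\<lambda>v. \<alpha>' (snd p) * ?D (fst p) (fst v) + snd v * \<alpha>'' (snd p) * \<beta> (fst p))) (at p)"
      using a p b(1) by (intro has_derivative_separated_product) auto
    then have "((\<lambda>p. snd i * \<alpha>' (snd p) * \<beta> (fst p)) has_derivative G i p) (at p)"
      using i by (simp add: G_def)
    \<comment> \<open>The first-derivative formula carries the extra term
      \<open>?D (fst q) 0\<close>, which is 0 by linearity, but only for base points in
      \<open>V\<close>; hence the passage through an open set.\<close>
    then show ?thesis
    proof (rule has_derivative_transform_within_open[OF _ open_Times[OF assms(1,2)]])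
      show "p \<in> V \<times> I" using p by (auto simp: mem_Times_iff)
      fix q assume "q \<in> V \<times> I"
      then have "linear (?D (fst q))" using b(1)[of "fst q"] has_derivative_linear by auto
      then show "snd i * \<alpha>' (snd q) * \<beta> (fst q) = \<alpha> (snd q) * ?D (fst q) (fst i) + snd i * \<alpha>' (snd q) * \<beta> (fst q)"
        using i linear_0 by auto
    qed
  qed
  fix j :: "'a \<times> real" assume "j \<in> Basis"
  then have j: "(\<exists>k\<in>Basis. j = (k, 0)) \<or> j = (0, 1)" by (auto simp: Basis_prod_def)
  have L2: "?DD k (fst p) 0 = 0" if "k \<in> Basis" for k
    using linear_0[OF has_derivative_linear[OF b(4)[OF p(1) that]]] .
  show "\<bar>G i p j\<bar> \<le> A * B"
    using i j a p b(2,3,5)[OF p(1)] linear_0[OF L] L2 nz by (auto simp: G_def intro!: m)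
  qed
qed

section \<open>Translation between \<open>C2_norm\<close> and \<open>C2_le\<close>\<close>

lemma sup_norm_le: "(\<And>x. x \<in> U \<Longrightarrow> \<bar>f x\<bar> \<le> M) \<Longrightarrow> sup_norm U f \<le> ereal M"
  unfolding sup_norm_def by (auto intro: SUP_least)

text \<open>Pointwise bounds yield only a supremum at most \<open>M\<close>; the gap
  \<open>M < \<epsilon>\<close> restores strictness.\<close>

lemma C2_norm_less:
  assumes "\<And>u v. u \<in> Basis \<Longrightarrow> v \<in> Basis \<Longrightarrow> C2_le M M U (\<lambda>x. F x u v)" "M < \<epsilon>"
  shows "C2_norm U F < ereal \<epsilon>"
proof -
  have "C2_norm U F \<le> ereal M"
    unfolding C2_norm_def
    using assms(1) unfolding C2_le_def by (intro SUP_least max.boundedI sup_norm_le) auto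
  then show ?thesis using assms(2) by (metis ereal_less_eq(3) less_ereal.simps(1) order_le_less_trans)
qed

lemma sup_norm_less_imp: "sup_norm U f < ereal c \<Longrightarrow> x \<in> U \<Longrightarrow> \<bar>f x\<bar> \<le> c"
  unfolding sup_norm_def using SUP_lessD[of "\<lambda>x. ereal \<bar>f x\<bar>" U "ereal c" x] by auto

text \<open>Smoothness is assumed because the norm is formed from \<open>frechet_derivative\<close>
  and does not itself certify differentiability.\<close>

lemma C2_norm_less_imp_C2_le:
  assumes "C2_norm U F < ereal c" "smooth_on U (\<lambda>x. F x u v)" "u \<in> Basis" "v \<in> Basis"
  shows "C2_le c c U (\<lambda>x. F x u v)"
proof -
  let ?f = "\<lambda>x. F x u v"
  note S1 = SUP_lessD[OF _ assms(3)] and S2 = SUP_lessD[OF _ assms(4)]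
  have *: "max (sup_norm U ?f) (max (SUP i\<in>Basis. sup_norm U (partial_deriv i ?f))
     (SUP i\<in>Basis. SUP j\<in>Basis. sup_norm U (partial_deriv j (partial_deriv i ?f)))) < ereal c"
    using S2[OF S1[OF assms(1)[unfolded C2_norm_def]]] .
  have 1: "sup_norm U ?f < ereal c" using * by simp
  have 2: "sup_norm U (partial_deriv i ?f) < ereal c" if "i \<in> Basis" for i
    using * that by (auto dest: SUP_lessD)
  have 3: "sup_norm U (partial_deriv j (partial_deriv i ?f)) < ereal c" if "i \<in> Basis" "j \<in> Basis" for i j
  proof -
    have "(SUP i\<in>Basis. SUP j\<in>Basis. sup_norm U (partial_deriv j (partial_deriv i ?f))) < ereal c"
      using * by simp
    from SUP_lessD[OF SUP_lessD[OF this that(1)] that(2)] show ?thesis .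
  qed
  have "smooth_on U (partial_deriv i ?f)" for i
    unfolding partial_deriv_def by (rule smooth_on_derivative[OF assms(2)])
  then have "partial_deriv i ?f differentiable at x" if "x \<in> U" for i x
    using smooth_on_has_derivative[of U "partial_deriv i ?f"] that by (auto simp: differentiable_def)
  moreover have "?f differentiable at x" if "x \<in> U" for x
    using smooth_on_has_derivative[OF assms(2)] that by (auto simp: differentiable_def)
  ultimately show ?thesis
    using sup_norm_less_imp[OF 1] sup_norm_less_imp[OF 2] sup_norm_less_imp[OF 3]
    unfolding C2_le_def by blast
qed

section \<open>The deformed metric in polar coordinates\<close>

lemma subspace_tangent: "subspace (tangent p)"
  by (auto simp: subspace_def tangent_def inner_add_left)

lemma inner_product_on_inner: "inner_product_on V (\<lambda>u v. u \<bullet> v)" for V :: "'a::real_inner set"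
  unfolding inner_product_on_def by (auto simp: inner_add_left intro: inner_commute)

text \<open>A convex combination, written in the shape in which \<open>deformed_family\<close>
  interpolates.\<close>

lemma inner_product_on_convex:
  assumes "inner_product_on V B" "inner_product_on V C" "0 \<le> r" "r \<le> 1"
  shows "inner_product_on V (\<lambda>u v. B u v + r * (C u v - B u v))"
proof -
  have pos: "B u u + r * (C u u - B u u) > 0" if "u \<in> V" "u \<noteq> 0" for u
  proof -
    have "B u u + r * (C u u - B u u) = (1 - r) * B u u + r * C u u" by (simp add: algebra_simps)
    moreover have "B u u > 0" "C u u > 0" using assms(1,2) that inner_product_on_D(3) by blast+
    ultimately show ?thesis
      using assms(3,4) by (cases "r = 0") (auto intro!: add_nonneg_pos mult_pos_pos)
  qed
  show ?thesis
    unfolding inner_product_on_def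
  proof (intro conjI ballI allI impI)
    fix u v assume uv: "u \<in> V" "v \<in> V"
    then show "B u v + r * (C u v - B u v) = B v u + r * (C v u - B v u)"
      using inner_product_on_D(1)[OF assms(1) uv] inner_product_on_D(1)[OF assms(2) uv] by simp
    fix w k assume w: "w \<in> V"
    show "B (k *\<^sub>R u + v) w + r * (C (k *\<^sub>R u + v) w - B (k *\<^sub>R u + v) w) =
       k * (B u w + r * (C u w - B u w)) + (B v w + r * (C v w - B v w))"
      unfolding inner_product_on_D(2)[OF assms(1) uv w] inner_product_on_D(2)[OF assms(2) uv w]
      by (simp add: algebra_simps)
  qed (use pos in auto)
qed

lemma from_polar_has_derivative:
  "(from_polar has_derivative (\<lambda>w. t *\<^sub>R fst w + snd w *\<^sub>R p)) (at (p, t))"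
  unfolding from_polar_def case_prod_unfold
  by (auto intro!: derivative_eq_intros)

lemma sgn_has_derivative:
  fixes x :: "'a::real_inner"
  assumes "x \<noteq> 0"
  shows "(sgn has_derivative (\<lambda>v. (v - (sgn x \<bullet> v) *\<^sub>R sgn x) /\<^sub>R norm x)) (at x)"
proof -
  have "((\<lambda>x. inverse (norm x) *\<^sub>R x) has_derivative (\<lambda>v. (v - (sgn x \<bullet> v) *\<^sub>R sgn x) /\<^sub>R norm x)) (at x)"
    using assms
    by (auto intro!: derivative_eq_intros has_derivative_norm simp: sgn_div_norm scaleR_diff_right inner_commute)
  then show ?thesis by (simp add: sgn_div_norm[abs_def])
qed

lemma to_polar_derivative:
  assumes "x \<noteq> 0"
  shows "frechet_derivative to_polar (at x) = (\<lambda>v. ((v - (sgn x \<bullet> v) *\<^sub>R sgn x) /\<^sub>R norm x, sgn x \<bullet> v))"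
proof -
  have "(to_polar has_derivative (\<lambda>v. ((v - (sgn x \<bullet> v) *\<^sub>R sgn x) /\<^sub>R norm x, sgn x \<bullet> v))) (at x)"
    unfolding to_polar_def[abs_def] inner_commute[of "sgn x"]
    by (intro has_derivative_Pair)
      (use sgn_has_derivative[OF assms] has_derivative_norm[OF assms] in \<open>simp_all add: inner_commute\<close>)
  then show ?thesis by (rule frechet_derivative_at[symmetric])
qed

lemma two_var_warp_nonzero:
  assumes "x \<noteq> 0"
  shows "two_var_warp \<rho> a d g x v w =
    (sinh (norm x))\<^sup>2 * deformed_family \<rho> a d g (norm x) (sgn x)
      ((v - (sgn x \<bullet> v) *\<^sub>R sgn x) /\<^sub>R norm x) ((w - (sgn x \<bullet> w) *\<^sub>R sgn x) /\<^sub>R norm x) +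
    (sgn x \<bullet> v) * (sgn x \<bullet> w)"
  using assms
  by (simp add: two_var_warp_def pullback_def to_polar_derivative warped_def) (simp add: to_polar_def)

text \<open>The differential of \<open>from_polar\<close> sends \<open>(u, s)\<close> to
  \<open>t *\<^sub>R u + s *\<^sub>R p\<close>. For tangent \<open>u\<close> its radial part is
  \<open>s\<close> and its angular part, divided by \<open>t\<close>, is \<open>u\<close>, so the
  two polar maps cancel.\<close>

lemma pullback_two_var_warp:
  assumes "p \<in> sph" "t > 0" "u \<in> tangent p" "v \<in> tangent p"
  shows "pullback from_polar (two_var_warp \<rho> a d g) (p, t) (u, s) (v, s') =
    (sinh t)\<^sup>2 * deformed_family \<rho> a d g t p u v + s * s'"
proof -
  have p: "norm p = 1" "p \<bullet> p = 1" using assms(1) by (auto simp: sph_def dot_square_norm)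
  have x: "t *\<^sub>R p \<noteq> 0" using assms p by auto
  have sg: "sgn (t *\<^sub>R p) = p" "norm (t *\<^sub>R p) = t"
    using assms p by (auto simp: sgn_div_norm)
  have D: "frechet_derivative from_polar (at (p, t)) = (\<lambda>w. t *\<^sub>R fst w + snd w *\<^sub>R p)"
    by (rule frechet_derivative_at[OF from_polar_has_derivative, symmetric])
  have fp: "from_polar (p, t) = t *\<^sub>R p" by (simp add: from_polar_def)
  have e: "p \<bullet> (t *\<^sub>R w + r *\<^sub>R p) = r" "(t *\<^sub>R w + r *\<^sub>R p - r *\<^sub>R p) /\<^sub>R t = w" if "w \<in> tangent p" for w r
    using that p assms(2) by (auto simp: tangent_def inner_add_right inner_commute)
  show ?thesis
    unfolding pullback_def D fp two_var_warp_nonzero[OF x] sg fst_conv snd_conv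
      e[OF assms(3)] e[OF assms(4)] ..
qed

section \<open>Charts of the sphere and pullbacks along them\<close>

text \<open>Tangency comes from differentiating the constant
  \<open>\<psi> y \<bullet> \<psi> y\<close>, injectivity of the differential from differentiating
  the identity \<open>\<theta> (\<psi> y) = y\<close>.\<close>

lemma sphere_chart_D:
  assumes "sphere_chart U \<psi>" "x \<in> U"
  shows "open U" "\<psi> x \<in> sph" "(\<psi> has_derivative frechet_derivative \<psi> (at x)) (at x)"
    "frechet_derivative \<psi> (at x) u \<in> tangent (\<psi> x)"
    "frechet_derivative \<psi> (at x) u = 0 \<Longrightarrow> u = 0"
proof -
  obtain W \<theta> where W: "open U" "smooth_on U \<psi>" "open W" "\<psi> ` U = W \<inter> sph" "smooth_on W \<theta>" "\<forall>x\<in>U. \<theta> (\<psi> x) = x"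
    using assms unfolding sphere_chart_def by blast
  show "open U" by fact
  have sph: "\<psi> y \<in> sph" "\<psi> y \<in> W" if "y \<in> U" for y using W(4) that by blast+
  then show "\<psi> x \<in> sph" using assms by blast
  show d: "(\<psi> has_derivative frechet_derivative \<psi> (at x)) (at x)"
    using smooth_on_has_derivative[OF W(2) assms(2)] .
  have "((\<lambda>y. \<psi> y \<bullet> \<psi> y) has_derivative (\<lambda>u. \<psi> x \<bullet> frechet_derivative \<psi> (at x) u + frechet_derivative \<psi> (at x) u \<bullet> \<psi> x)) (at x)"
    using has_derivative_inner[OF d d] .
  moreover have "((\<lambda>y. \<psi> y \<bullet> \<psi> y) has_derivative (\<lambda>u. 0)) (at x)"
    using has_derivative_const[of "1::real"]
    by (rule has_derivative_transform_within_open[OF _ W(1) assms(2)])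
      (use sph in \<open>auto simp: sph_def dot_square_norm\<close>)
  ultimately have "(\<lambda>u. \<psi> x \<bullet> frechet_derivative \<psi> (at x) u + frechet_derivative \<psi> (at x) u \<bullet> \<psi> x) = (\<lambda>u. 0)"
    by (rule has_derivative_unique)
  then have "\<psi> x \<bullet> frechet_derivative \<psi> (at x) u + frechet_derivative \<psi> (at x) u \<bullet> \<psi> x = 0" by metis
  then show "frechet_derivative \<psi> (at x) u \<in> tangent (\<psi> x)"
    by (simp add: tangent_def inner_commute)
  have "((\<lambda>y. \<theta> (\<psi> y)) has_derivative (\<lambda>u. frechet_derivative \<theta> (at (\<psi> x)) (frechet_derivative \<psi> (at x) u))) (at x)"
    by (rule has_derivative_compose[OF d smooth_on_has_derivative[OF W(5) sph(2)[OF assms(2)]]])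
  moreover have "((\<lambda>y. \<theta> (\<psi> y)) has_derivative (\<lambda>u. u)) (at x)"
    using has_derivative_ident
    by (rule has_derivative_transform_within_open[OF _ W(1) assms(2)]) (use W in auto)
  ultimately have *: "frechet_derivative \<theta> (at (\<psi> x)) (frechet_derivative \<psi> (at x) u) = u"
    using has_derivative_unique by metis
  have "frechet_derivative \<theta> (at (\<psi> x)) 0 = 0"
    using smooth_on_has_derivative[OF W(5) sph(2)[OF assms(2)]] has_derivative_linear linear_0 by blast
  then show "frechet_derivative \<psi> (at x) u = 0 \<Longrightarrow> u = 0" using * by simp
qed

lemma inner_product_on_pullback_chart:
  assumes "sphere_chart U \<psi>" "x \<in> U" "inner_product_on (tangent (\<psi> x)) (g (\<psi> x))"
  shows "inner_product_on UNIV (pullback \<psi> g x)"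
proof -
  note D = sphere_chart_D[OF assms(1,2)]
  have L: "linear (frechet_derivative \<psi> (at x))" using D(3) has_derivative_linear by blast
  show ?thesis
    unfolding inner_product_on_def pullback_def
  proof (intro conjI ballI allI impI)
    fix u v w r
    show "g (\<psi> x) (frechet_derivative \<psi> (at x) u) (frechet_derivative \<psi> (at x) v) =
      g (\<psi> x) (frechet_derivative \<psi> (at x) v) (frechet_derivative \<psi> (at x) u)"
      using inner_product_on_D(1)[OF assms(3) D(4,4)] .
    show "g (\<psi> x) (frechet_derivative \<psi> (at x) (r *\<^sub>R u + v)) (frechet_derivative \<psi> (at x) w) =
      r * g (\<psi> x) (frechet_derivative \<psi> (at x) u) (frechet_derivative \<psi> (at x) w) +
      g (\<psi> x) (frechet_derivative \<psi> (at x) v) (frechet_derivative \<psi> (at x) w)"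
      unfolding linear_add[OF L] linear_scale[OF L] using inner_product_on_D(2)[OF assms(3) D(4,4,4)] .
    assume "u \<noteq> 0"
    then show "0 < g (\<psi> x) (frechet_derivative \<psi> (at x) u) (frechet_derivative \<psi> (at x) u)"
      using inner_product_on_D(3)[OF assms(3) D(4)[of u]] D(5)[of u] by blast
  qed
qed

lemma sphere_metric_round_metric: "sphere_metric (round_metric :: ('n::finite) space tensor2)"
  unfolding sphere_metric_def
proof (intro conjI ballI allI impI)
  fix p :: "'n space"
  show "inner_product_on (tangent p) (round_metric p)"
    unfolding round_metric_def by (rule inner_product_on_inner)
  fix U and \<psi> :: "real ^ 'n \<Rightarrow> 'n space" and u v
  assume "sphere_chart U \<psi>"
  then have "open U" "smooth_on U \<psi>" by (auto simp: sphere_chart_def)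
  then show "smooth_on U (\<lambda>x. pullback \<psi> round_metric x u v)"
    unfolding pullback_def round_metric_def by (intro smooth_on_inner smooth_on_derivative)
qed

lemma has_derivative_affine:
  fixes T :: "'a::euclidean_space \<Rightarrow> 'b::real_normed_vector"
  assumes "linear T"
  shows "((\<lambda>y. z + T y) has_derivative T) (at y)"
  using linear_imp_has_derivative[OF assms] by (auto intro!: derivative_eq_intros)

lemma pullback_affine:
  fixes T :: "'a::euclidean_space \<Rightarrow> 'b::euclidean_space"
  assumes "(\<psi> has_derivative D) (at (z + T y))" "linear T"
  shows "pullback (\<lambda>y. \<psi> (z + T y)) g y u v = pullback \<psi> g (z + T y) (T u) (T v)"
    and "frechet_derivative (\<lambda>y. \<psi> (z + T y)) (at y) u = frechet_derivative \<psi> (at (z + T y)) (T u)"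
proof -
  have "(\<psi> has_derivative frechet_derivative \<psi> (at (z + T y))) (at (z + T y))"
    using assms(1) frechet_derivative_works differentiable_def by blast
  from has_derivative_compose[OF has_derivative_affine[OF assms(2)] this]
  have *: "frechet_derivative (\<lambda>y. \<psi> (z + T y)) (at y) = (\<lambda>v. frechet_derivative \<psi> (at (z + T y)) (T v))"
    by (rule frechet_derivative_at[symmetric])
  show "pullback (\<lambda>y. \<psi> (z + T y)) g y u v = pullback \<psi> g (z + T y) (T u) (T v)"
    "frechet_derivative (\<lambda>y. \<psi> (z + T y)) (at y) u = frechet_derivative \<psi> (at (z + T y)) (T u)"
    unfolding pullback_def * by (rule refl)+
qed

text \<open>The smooth inverse is \<open>\<theta>\<close> followed by the inverse affine map. Its
  domain must be cut down to the preimage of the unit ball, so that the new image is exactly an open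
  set intersected with the sphere.\<close>

lemma sphere_chart_affine:
  fixes \<psi> :: "real ^ 'n \<Rightarrow> ('n::finite) space"
  assumes chart: "sphere_chart U \<psi>" and T: "linear T" "inj T"
    and sub: "\<And>y. y \<in> ball 0 1 \<Longrightarrow> z + T y \<in> U"
  shows "sphere_chart (ball 0 1) (\<lambda>y. \<psi> (z + T y))"
proof -
  obtain W \<theta> where W: "open U" "smooth_on U \<psi>" "open W" "\<psi> ` U = W \<inter> sph" "smooth_on W \<theta>" "\<forall>x\<in>U. \<theta> (\<psi> x) = x"
    using chart unfolding sphere_chart_def by blast
  obtain S where S: "linear S" "\<And>y. S (T y) = y" "\<And>y. T (S y) = y"
    using linear_injective_isomorphism[OF T] by blast
  have bl: "bounded_linear T" "bounded_linear S"
    using T(1) S(1) linear_conv_bounded_linear by blast+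
  define \<theta>' where "\<theta>' = (\<lambda>w. S (\<theta> w - z))"
  have sm: "smooth_on W \<theta>'"
    unfolding \<theta>'_def using W by (intro smooth_on_bounded_linear[OF _ bl(2)] smooth_on_diff smooth_on_const)
  define W' where "W' = {w \<in> W. \<theta>' w \<in> ball 0 1}"
  have "open (W \<inter> \<theta>' -` ball 0 1)"
    using smooth_on_imp_continuous_on[OF sm] W(3) by (intro continuous_open_preimage) auto
  moreover have "W' = W \<inter> \<theta>' -` ball 0 1" by (auto simp: W'_def)
  ultimately have oW': "open W'" by simp
  have inv: "\<theta>' (\<psi> (z + T y)) = y" if "y \<in> ball 0 1" for y
    using W(6) sub[OF that] S(2) by (simp add: \<theta>'_def)
  show ?thesis
    unfolding sphere_chart_def
  proof (intro conjI exI)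
    show "open (ball (0::real ^ 'n) 1)" by simp
    show "smooth_on (ball 0 1) (\<lambda>y. \<psi> (z + T y))"
      by (rule smooth_on_compose[OF _ W(1) smooth_on_add[OF _ smooth_on_const smooth_on_linear[OF _ bl(1)]] W(2)])
        (use sub in auto)
    show "open W'" by fact
    show "smooth_on W' \<theta>'" using sm by (rule smooth_on_subset) (auto simp: W'_def)
    show "\<forall>x\<in>ball 0 1. \<theta>' (\<psi> (z + T x)) = x" using inv by blast
    show "(\<lambda>y. \<psi> (z + T y)) ` ball 0 1 = W' \<inter> sph"
    proof (intro equalityI subsetI)
      fix w assume "w \<in> (\<lambda>y. \<psi> (z + T y)) ` ball 0 1"
      then obtain y where y: "y \<in> ball 0 1" "w = \<psi> (z + T y)" by blast
      then have "w \<in> W \<inter> sph" using sub W(4) by blast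
      then show "w \<in> W' \<inter> sph" using inv[OF y(1)] y by (auto simp: W'_def)
    next
      fix w assume w: "w \<in> W' \<inter> sph"
      then have "w \<in> W \<inter> sph" by (auto simp: W'_def)
      then obtain x where x: "x \<in> U" "w = \<psi> x" using W(4) by blast
      have "z + T (\<theta>' w) = x" using W(6) x S(3) by (simp add: \<theta>'_def)
      then show "w \<in> (\<lambda>y. \<psi> (z + T y)) ` ball 0 1"
        using w x by (intro image_eqI[of _ _ "\<theta>' w"]) (auto simp: W'_def)
    qed
  qed
qed

section \<open>Estimates for the model metric\<close>

text \<open>The second derivative is the largest, and 36 bounds \<open>4 e^2\<close> through
  \<open>e \<le> 3\<close>.\<close>

lemma D2_le_exp: "D2_le 36 {-1<..<1} (\<lambda>t. exp (2 * t))"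
proof (rule D2_leI)
  fix t :: real assume t: "t \<in> {-1<..<1}"
  show "((\<lambda>t. exp (2 * t)) has_real_derivative 2 * exp (2 * t)) (at t)"
    "((\<lambda>t. 2 * exp (2 * t)) has_real_derivative 4 * exp (2 * t)) (at t)"
    by (auto intro!: derivative_eq_intros)
  have "exp (2 * t) \<le> exp 1 * exp (1::real)" using t by (simp flip: exp_add)
  also have "\<dots> \<le> 3 * 3" using exp_le by (intro mult_mono) auto
  finally show "\<bar>exp (2 * t)\<bar> \<le> 36" "\<bar>2 * exp (2 * t)\<bar> \<le> 36" "\<bar>4 * exp (2 * t)\<bar> \<le> 36"
    by simp_all
qed

text \<open>The scale \<open>2 * exp (- t0)\<close> turns \<open>sinh (t + t0)\<close> into
  \<open>exp t - exp (- t - 2 * t0)\<close>; squaring isolates the model factor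
  \<open>exp (2 * t)\<close>.\<close>

lemma scaled_sinh_squared:
  "(2 * exp (- t0))\<^sup>2 * (sinh (t + t0))\<^sup>2 = exp (2 * t) + (exp (- 2 * t - 4 * t0) - 2 * exp (- 2 * t0))"
  for t t0 :: real
proof -
  have "2 * exp (- t0) * sinh (t + t0) = exp (- t0 + (t + t0)) - exp (- t0 + - (t + t0))"
    unfolding exp_add[of "- t0"] by (simp add: sinh_def algebra_simps)
  then have "2 * exp (- t0) * sinh (t + t0) = exp t - exp (- t - 2 * t0)"
    by (simp add: algebra_simps)
  then have "(2 * exp (- t0) * sinh (t + t0))\<^sup>2 = (exp t - exp (- t - 2 * t0))\<^sup>2" by simp
  also have "\<dots> = exp t * exp t - 2 * (exp t * exp (- t - 2 * t0)) + exp (- t - 2 * t0) * exp (- t - 2 * t0)"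
    by (simp add: power2_eq_square algebra_simps)
  also have "\<dots> = exp (2 * t) + (exp (- 2 * t - 4 * t0) - 2 * exp (- 2 * t0))"
    by (simp flip: exp_add)
  finally show ?thesis by (simp add: power_mult_distrib)
qed

text \<open>The remainder has the better order \<open>exp (- 2 * t0)\<close>, but
  \<open>exp (- t0)\<close> is the order at which the chart variation enters anyway. The 4 comes
  from the second derivative.\<close>

lemma D2_le_sinh_error:
  assumes "t0 \<ge> 1"
  shows "D2_le (4 * exp (- t0)) {-1<..<1} (\<lambda>t. exp (- 2 * t - 4 * t0) - 2 * exp (- 2 * t0))"
proof (rule D2_leI)
  fix t :: real assume t: "t \<in> {-1<..<1}"
  show "((\<lambda>t. exp (- 2 * t - 4 * t0) - 2 * exp (- 2 * t0)) has_real_derivative - 2 * exp (- 2 * t - 4 * t0)) (at t)"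
    "((\<lambda>t. - 2 * exp (- 2 * t - 4 * t0)) has_real_derivative 4 * exp (- 2 * t - 4 * t0)) (at t)"
    by (auto intro!: derivative_eq_intros)
  have 1: "exp (- 2 * t - 4 * t0) \<le> exp (- t0)" "exp (- 2 * t0) \<le> exp (- t0)" using t assms by simp_all
  have 2: "exp (- 2 * t - 4 * t0) > 0" "exp (- 2 * t0) > 0" by simp_all
  from 1 2 show "\<bar>exp (- 2 * t - 4 * t0) - 2 * exp (- 2 * t0)\<bar> \<le> 4 * exp (- t0)"
    "\<bar>- 2 * exp (- 2 * t - 4 * t0)\<bar> \<le> 4 * exp (- t0)" "\<bar>4 * exp (- 2 * t - 4 * t0)\<bar> \<le> 4 * exp (- t0)"
    unfolding abs_le_iff by linarith+
qed

text \<open>Connects the \<open>deriv\<close> in which the cut-off is bounded with the Frechet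
  derivative behind \<open>smooth_on\<close>.\<close>

lemma smooth_on_UNIV_deriv:
  fixes f :: "real \<Rightarrow> real"
  assumes "smooth_on UNIV f"
  shows "(f has_real_derivative deriv f x) (at x)" "smooth_on UNIV (deriv f)"
proof -
  have d: "(f has_real_derivative frechet_derivative f (at x) 1) (at x)" for x
  proof -
    have D: "(f has_derivative frechet_derivative f (at x)) (at x)"
      using smooth_on_has_derivative[OF assms] by simp
    have "frechet_derivative f (at x) h = frechet_derivative f (at x) 1 * h" for h
      using linear_scale[OF has_derivative_linear[OF D], of h 1] by (simp add: mult.commute)
    then show ?thesis unfolding has_field_derivative_def by (intro has_derivative_eq_rhs[OF D] ext)
  qed
  then have e: "deriv f = (\<lambda>x. frechet_derivative f (at x) 1)"
    by (intro ext DERIV_imp_deriv)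
  show "(f has_real_derivative deriv f x) (at x)" unfolding e by (rule d)
  show "smooth_on UNIV (deriv f)" unfolding e by (rule smooth_on_derivative[OF assms])
qed

text \<open>The inner function has slope \<open>2 / d\<close>, so the bounds 3 and 12 become
  \<open>6 / d\<close> and \<open>48 / d^2\<close>. The value at the centre is subtracted since it
  belongs to the slice metric; the increment is then at most \<open>6 / d\<close> by the mean value
  theorem.\<close>

lemma D2_le_cutoff_difference:
  assumes "cutoff \<rho>" "d > 0"
  shows "D2_le (6 / d + 48 / d\<^sup>2) {-1<..<1} (\<lambda>t. \<rho> (2 * ((t + t0 - a) / d)) - \<rho> (2 * ((t0 - a) / d)))"
proof (rule D2_leI)
  have sm: "smooth_on UNIV \<rho>" and b1: "\<And>t. \<bar>deriv \<rho> t\<bar> < 3" and b2: "\<And>t. \<bar>deriv (deriv \<rho>) t\<bar> < 12"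
    using assms(1) by (auto simp: cutoff_def)
  note d1 = smooth_on_UNIV_deriv(1)[OF sm] and d2 = smooth_on_UNIV_deriv(1)[OF smooth_on_UNIV_deriv(2)[OF sm]]
  let ?s = "\<lambda>t. 2 * ((t + t0 - a) / d)"
  have s: "(?s has_real_derivative 2 / d) (at t)" for t
    using assms(2) by (auto intro!: derivative_eq_intros)
  have nn: "0 \<le> 6 / d" "0 \<le> 48 / d\<^sup>2" using assms(2) by auto
  fix t :: real assume t: "t \<in> {-1<..<1}"
  show "((\<lambda>t. \<rho> (?s t) - \<rho> (2 * ((t0 - a) / d))) has_real_derivative deriv \<rho> (?s t) * (2 / d)) (at t)"
    using DERIV_diff[OF DERIV_chain2[OF d1 s] DERIV_const] by simp
  show "((\<lambda>t. deriv \<rho> (?s t) * (2 / d)) has_real_derivative deriv (deriv \<rho>) (?s t) * (2 / d) * (2 / d)) (at t)"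
    using DERIV_cmult_right[OF DERIV_chain2[OF d2 s], of "2 / d"] by simp
  have "\<bar>deriv \<rho> (?s t) * (2 / d)\<bar> \<le> 3 * (2 / d)"
    unfolding abs_mult using b1[of "?s t"] assms(2) by (intro mult_mono) auto
  then show "\<bar>deriv \<rho> (?s t) * (2 / d)\<bar> \<le> 6 / d + 48 / d\<^sup>2" using nn by linarith
  have "\<bar>deriv (deriv \<rho>) (?s t) * (2 / d) * (2 / d)\<bar> \<le> 12 * (2 / d) * (2 / d)"
    unfolding abs_mult using b2[of "?s t"] assms(2) by (intro mult_mono) auto
  also have "\<dots> = 48 / d\<^sup>2" by (simp add: power2_eq_square)
  finally show "\<bar>deriv (deriv \<rho>) (?s t) * (2 / d) * (2 / d)\<bar> \<le> 6 / d + 48 / d\<^sup>2" using nn by linarith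
  have "norm (\<rho> (?s t) - \<rho> (2 * ((t0 - a) / d))) \<le> 3 * norm (?s t - 2 * ((t0 - a) / d))"
    by (rule field_differentiable_bound[of UNIV \<rho> "deriv \<rho>"]) (use d1 b1 in \<open>auto intro: less_imp_le\<close>)
  also have "?s t - 2 * ((t0 - a) / d) = 2 * t / d" by (simp add: diff_divide_distrib add_divide_distrib)
  also have "3 * norm (2 * t / d) \<le> 6 / d" using t assms(2) by (auto simp: abs_mult field_simps)
  finally show "\<bar>\<rho> (?s t) - \<rho> (2 * ((t0 - a) / d))\<bar> \<le> 6 / d + 48 / d\<^sup>2"
    using nn unfolding real_norm_def by linarith
qed

section \<open>Orthonormal frames and the difference to the model\<close>

lemma sum_abs_Basis_le: "(\<Sum>b\<in>Basis. \<bar>v \<bullet> b\<bar>) \<le> sqrt (real DIM('a)) * norm v" for v :: "'a::euclidean_space"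
proof -
  have "(\<Sum>b\<in>Basis. 1 * \<bar>v \<bullet> b\<bar>)\<^sup>2 \<le> (\<Sum>b\<in>(Basis::'a set). 1\<^sup>2) * (\<Sum>b\<in>Basis. \<bar>v \<bullet> b\<bar>\<^sup>2)"
    by (rule Cauchy_Schwarz_ineq_sum)
  also have "\<dots> = (sqrt (real DIM('a)) * norm v)\<^sup>2"
    unfolding power_mult_distrib power2_norm_eq_inner euclidean_inner[of v v] by (simp add: power2_eq_square)
  finally have "(\<Sum>b\<in>Basis. \<bar>v \<bullet> b\<bar>)\<^sup>2 \<le> (sqrt (real DIM('a)) * norm v)\<^sup>2"
    by simp
  then show ?thesis by (rule power2_le_imp_le) simp
qed

text \<open>Orthonormal vectors have Euclidean length at most \<open>sqrt m\<close> by
  \<open>low\<close>. The further factor \<open>sqrt DIM('a)\<close> in \<open>L\<close> pays for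
  the sum norm of each column and for the operator norm.\<close>

lemma exists_orthonormal_map:
  fixes B :: "'a::euclidean_space \<Rightarrow> 'a \<Rightarrow> real"
  assumes B: "inner_product_on UNIV B" and low: "\<And>u. u \<bullet> u \<le> m * B u u"
    and L: "L = sqrt (real DIM('a) * m)"
  obtains T :: "'a \<Rightarrow> 'a" where "linear T" "inj T"
    "\<And>i j. i \<in> Basis \<Longrightarrow> j \<in> Basis \<Longrightarrow> B (T i) (T j) = (if i = j then 1 else 0)"
    "\<And>i. i \<in> Basis \<Longrightarrow> (\<Sum>b\<in>Basis. \<bar>T i \<bullet> b\<bar>) \<le> L" "\<And>y. norm (T y) \<le> L * norm y"
proof -
  obtain f :: "'a \<Rightarrow> 'a" where f: "\<forall>i\<in>Basis. \<forall>j\<in>Basis. B (f i) (f j) = (if i = j then 1 else 0 :: real)"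
    using exists_orthonormal_family[OF B] by metis
  define T where "T = (\<lambda>y. \<Sum>i\<in>Basis. (y \<bullet> i) *\<^sub>R f i)"
  have lin: "linear T"
    unfolding T_def by (intro linear_compose_sum ballI linear_scaleR_left)
      (auto intro!: linearI simp: inner_add_left scaleR_add_left)
  have Ti: "T i = f i" if "i \<in> Basis" for i
  proof -
    have "T i = (\<Sum>j\<in>Basis. if j = i then f i else 0)"
      unfolding T_def using that by (intro sum.cong) (auto simp: inner_Basis)
    then show ?thesis using that by simp
  qed
  have nf: "norm (f i) \<le> sqrt m" if "i \<in> Basis" for i
    using low[of "f i"] f that by (intro real_le_rsqrt) (auto simp: dot_square_norm)
  have inj: "inj T"
  proof (rule linear_injective_0[OF lin, THEN iffD2], intro allI impI)
    fix y assume "T y = 0"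
    then have "B (T y) (f j) = 0" for j
      using inner_product_on_bilinear(7)[OF B subspace_UNIV] by simp
    then have z: "(\<Sum>i\<in>Basis. (y \<bullet> i) * B (f i) (f j)) = 0" for j
      unfolding T_def inner_product_on_sum(1)[OF B subspace_UNIV UNIV_I UNIV_I] .
    have "y \<bullet> j = 0" if "j \<in> Basis" for j
    proof -
      have "(\<Sum>i\<in>Basis. (y \<bullet> i) * B (f i) (f j)) = (\<Sum>i\<in>Basis. if i = j then y \<bullet> i else 0)"
        using f that by (intro sum.cong) auto
      then show ?thesis unfolding z using that by simp
    qed
    then show "y = 0" by (auto intro: euclidean_eqI[of y 0])
  qed
  have "norm (T y) \<le> L * norm y" for y
  proof -
    have "norm (T y) \<le> (\<Sum>i\<in>Basis. \<bar>y \<bullet> i\<bar> * sqrt m)"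
      unfolding T_def by (intro sum_norm_le) (auto intro!: mult_left_mono nf)
    also have "\<dots> \<le> (sqrt (real DIM('a)) * norm y) * sqrt m"
    proof -
      obtain b :: 'a where "b \<in> Basis" using nonempty_Basis by blast
      from nf[OF this] have "0 \<le> sqrt m" by (rule order_trans[OF norm_ge_zero])
      then show ?thesis
        unfolding sum_distrib_right[symmetric] by (intro mult_right_mono sum_abs_Basis_le)
    qed
    finally show ?thesis by (simp add: L real_sqrt_mult algebra_simps)
  qed
  moreover have "(\<Sum>b\<in>Basis. \<bar>T i \<bullet> b\<bar>) \<le> L" if "i \<in> Basis" for i
    using order_trans[OF sum_abs_Basis_le mult_left_mono[OF nf[OF that]]] by (simp add: Ti that L real_sqrt_mult)
  ultimately show ?thesis using that[of T] lin inj f Ti by auto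
qed

lemma bilinear_expansion:
  fixes B :: "'a::euclidean_space \<Rightarrow> 'a \<Rightarrow> real"
  assumes "bilinear B"
  shows "B u v = (\<Sum>b\<in>Basis. (u \<bullet> b) * (\<Sum>b'\<in>Basis. (v \<bullet> b') * B b b'))"
proof -
  have l: "linear (\<lambda>y. B x y)" "linear (\<lambda>x. B x y)" for x y using assms by (auto simp: bilinear_def)
  have "B (\<Sum>b\<in>Basis. (u \<bullet> b) *\<^sub>R b) w = (\<Sum>b\<in>Basis. (u \<bullet> b) * B b w)" for w
    by (simp only: linear_sum[OF l(2)] linear_scale[OF l(2)] real_scaleR_def)
  then have 1: "B u w = (\<Sum>b\<in>Basis. (u \<bullet> b) * B b w)" for w
    by (simp only: euclidean_representation)
  have "B b (\<Sum>b'\<in>Basis. (v \<bullet> b') *\<^sub>R b') = (\<Sum>b'\<in>Basis. (v \<bullet> b') * B b b')" for b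
    by (simp only: linear_sum[OF l(1)] linear_scale[OF l(1)] real_scaleR_def)
  then have 2: "B b v = (\<Sum>b'\<in>Basis. (v \<bullet> b') * B b b')" for b
    by (simp only: euclidean_representation)
  show ?thesis
    unfolding 1[of v] by (rule sum.cong[OF refl], rule arg_cong[where f="(*) _"], rule 2)
qed

lemma bilinear_inner_product_on: "inner_product_on UNIV B \<Longrightarrow> bilinear B"
  unfolding bilinear_def
  using inner_product_on_bilinear[of UNIV B] by (auto intro!: linearI simp: subspace_UNIV)

lemma bilinear_combination:
  assumes "bilinear B" "bilinear C"
  shows "bilinear (\<lambda>u v. r * B u v + s * C u v :: real)"
  unfolding bilinear_def
  by (auto intro!: linearI simp: bilinear_ladd[OF assms(1)] bilinear_ladd[OF assms(2)]
      bilinear_radd[OF assms(1)] bilinear_radd[OF assms(2)] bilinear_lmul[OF assms(1)] bilinear_lmul[OF assms(2)]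
      bilinear_rmul[OF assms(1)] bilinear_rmul[OF assms(2)] algebra_simps)

text \<open>Two frame vectors cost \<open>L\<^sup>2\<close>, and each derivative gains
  \<open>\<mu> * L\<close> from the affine map. The vectors stay unscaled, so that
  \<open>\<mu>\<^sup>2\<close> remains free to be paired with the square of
  \<open>sinh\<close>.\<close>

lemma C2_le_frame_entry:
  fixes F :: "'a::euclidean_space tensor2"
  assumes bil: "\<And>z. z \<in> U \<Longrightarrow> bilinear (F z)"
    and F: "\<And>b b'. b \<in> Basis \<Longrightarrow> b' \<in> Basis \<Longrightarrow> C2_le k k U (\<lambda>z. F z b b')"
    and T: "linear T" "\<And>i. i \<in> Basis \<Longrightarrow> (\<Sum>b\<in>Basis. \<bar>T i \<bullet> b\<bar>) \<le> L"
    and sub: "\<And>y. y \<in> ball 0 1 \<Longrightarrow> z0 + \<mu> *\<^sub>R T y \<in> U"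
    and \<mu>: "0 < \<mu>" "\<mu> * L \<le> 1" and "0 \<le> k" "i \<in> Basis" "j \<in> Basis"
  shows "C2_le (k * L\<^sup>2) (\<mu> * L * (k * L\<^sup>2)) (ball 0 1) (\<lambda>y. F (z0 + \<mu> *\<^sub>R T y) (T i) (T j))"
proof -
  have lin: "linear (\<lambda>y. \<mu> *\<^sub>R T y)" using T(1) by (rule linear_compose_scale_right)
  have \<tau>: "(\<Sum>b\<in>Basis. \<bar>(\<mu> *\<^sub>R T i) \<bullet> b\<bar>) \<le> \<mu> * L" if "i \<in> Basis" for i
    using mult_left_mono[OF T(2)[OF that], of \<mu>] \<mu>(1) by (simp add: abs_mult sum_distrib_left)
  have aff: "C2_le k (\<mu> * L * k) (ball 0 1) (\<lambda>y. F (z0 + \<mu> *\<^sub>R T y) b b')" if "b \<in> Basis" "b' \<in> Basis" for b b'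
    by (rule C2_le_affine[OF open_ball F[OF that] lin sub \<tau> \<mu>(2) \<open>0 \<le> k\<close>])
  let ?s = "\<lambda>i. \<Sum>b\<in>Basis. \<bar>T i \<bullet> b\<bar>"
  have "C2_le (?s i * (?s j * k)) (?s i * (?s j * (\<mu> * L * k))) (ball 0 1)
     (\<lambda>y. \<Sum>b\<in>Basis. (T i \<bullet> b) * (\<Sum>b'\<in>Basis. (T j \<bullet> b') * F (z0 + \<mu> *\<^sub>R T y) b b'))"
    by (intro C2_le_sum open_ball finite_Basis aff)
  then have C: "C2_le (?s i * (?s j * k)) (?s i * (?s j * (\<mu> * L * k))) (ball 0 1) (\<lambda>y. F (z0 + \<mu> *\<^sub>R T y) (T i) (T j))"
    by (rule C2_le_cong[OF open_ball]) (rule bilinear_expansion[OF bil[OF sub], symmetric])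
  have "0 \<le> ?s i" "0 \<le> ?s j" by (auto intro: sum_nonneg)
  moreover have "?s i \<le> L" "?s j \<le> L" using T(2) assms by auto
  ultimately have m: "?s i * (?s j * r) \<le> r * L\<^sup>2" if "0 \<le> r" for r
    using that mult_mono[of "?s i * ?s j" "L * L" r r] mult_mono[of "?s i" L "?s j" L]
    by (simp add: power2_eq_square mult_ac)
  have "0 \<le> L" using \<open>0 \<le> ?s i\<close> \<open>?s i \<le> L\<close> by linarith
  then show ?thesis
    using m[of k] m[of "\<mu> * L * k"] \<open>0 \<le> k\<close> \<mu>(1) by (intro C2_le_mono[OF C]) (auto simp: mult_ac)
qed

text \<open>The difference splits into \<open>exp (2 * t) * (G - G 0)\<close>, the
  \<open>sinh\<close> remainder times \<open>G\<close>, and the cut-off increment times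
  \<open>k\<close>; these give the three summands of \<open>M\<close>.\<close>

lemma C2_le_model_difference:
  fixes G k :: "'a::euclidean_space \<Rightarrow> real"
  assumes "cutoff \<rho>" "d \<ge> 1" "t0 \<ge> 1" "X \<ge> 0"
    and \<tau>: "0 \<le> \<tau>" "\<tau> \<le> 1"
    and G: "C2_le X (\<tau> * X) (ball 0 1) G" and k: "C2_le X (\<tau> * X) (ball 0 1) k"
    and M: "M = 36 * (real DIM('a) * (\<tau> * X)) + 4 * exp (- t0) * X + 8640 / d * X"
  shows "C2_le M M (ball 0 1 \<times> {-1<..<1}) (\<lambda>q. (2 * exp (- t0))\<^sup>2 * (sinh (snd q + t0))\<^sup>2 *
     (G (fst q) + (\<rho> (2 * ((snd q + t0 - a) / d)) - \<rho> (2 * ((t0 - a) / d))) * k (fst q)) - exp (2 * snd q) * G 0)"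
proof -
  let ?q = "\<lambda>t. exp (- 2 * t - 4 * t0) - 2 * exp (- 2 * t0)"
  let ?w = "\<lambda>t. \<rho> (2 * ((t + t0 - a) / d)) - \<rho> (2 * ((t0 - a) / d))"
  have \<tau>X: "0 \<le> \<tau> * X" "\<tau> * X \<le> X" using \<tau> \<open>X \<ge> 0\<close> by (auto simp: mult_left_le_one_le)
  have "1 * (\<tau> * X) \<le> real DIM('a) * (\<tau> * X)" using \<tau>X DIM_positive[where 'a='a] by (intro mult_right_mono) auto
  then have 1: "C2_le (36 * (real DIM('a) * (\<tau> * X))) (36 * (real DIM('a) * (\<tau> * X))) (ball 0 1 \<times> {-1<..<1})
      (\<lambda>q. exp (2 * snd q) * (G (fst q) - G 0))"
    by (intro C2_le_separated_product D2_le_exp C2_le_mono[OF C2_le_minus_center[OF G]]) (use \<tau>X in auto)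
  have G': "C2_le X X (ball 0 1) G" and k': "C2_le X X (ball 0 1) k"
    using C2_le_mono[OF G] C2_le_mono[OF k] \<tau>X by auto
  have 2: "C2_le (4 * exp (- t0) * X) (4 * exp (- t0) * X) (ball 0 1 \<times> {-1<..<1}) (\<lambda>q. ?q (snd q) * G (fst q))"
    by (intro C2_le_separated_product D2_le_sinh_error G') (use assms in auto)
  have "48 / d\<^sup>2 \<le> 48 / d" using assms(2) by (intro divide_left_mono) (auto simp: power2_eq_square)
  then have w: "D2_le (54 / d) {-1<..<1} ?w"
    using assms(1,2) by (intro D2_le_mono[OF D2_le_cutoff_difference]) auto
  have "exp (- t0) \<le> 1" using assms(3) by simp
  then have "D2_le 40 {-1<..<1} (\<lambda>t. exp (2 * t) + ?q t)"
    by (intro D2_le_mono[OF D2_le_add[OF D2_le_exp D2_le_sinh_error]]) (use assms in auto)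
  \<comment> \<open>Here \<open>8640 = 4 * 40 * 54\<close>, where \<open>40 = 36 + 4\<close> and
    \<open>54 = 6 + 48\<close>.\<close>
  from D2_le_mult[OF this w] have "D2_le (8640 / d) {-1<..<1} (\<lambda>t. (exp (2 * t) + ?q t) * ?w t)"
    using assms(2) by simp
  then have 3: "C2_le (8640 / d * X) (8640 / d * X) (ball 0 1 \<times> {-1<..<1})
      (\<lambda>q. (exp (2 * snd q) + ?q (snd q)) * ?w (snd q) * k (fst q))"
    by (intro C2_le_separated_product k') (use assms in auto)
  have op: "open (ball (0::'a) 1 \<times> {-1<..<1::real})" by (intro open_Times) auto
  show ?thesis
    using C2_le_add[OF op C2_le_add[OF op 1 2] 3] unfolding M scaled_sinh_squared
    by (rule C2_le_cong[OF op]) (simp add: algebra_simps)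
qed

text \<open>Nothing but the model term survives as \<open>\<mu>\<close> tends to 0. \<open>Q\<close>
  may be huge, since \<open>d\<close> is arbitrary, but it is chosen before \<open>\<mu>\<close>,
  \<open>G\<close> and \<open>k\<close>: in the application the latter two depend on
  \<open>\<mu>\<close>.\<close>

lemma C2_le_model_difference_small_scale:
  assumes "cutoff \<rho>" "d > 0" "t0 \<ge> 1" "X \<ge> 0"
  shows "\<exists>Q\<ge>0. \<forall>\<mu> (G :: 'a::euclidean_space \<Rightarrow> real) k. C2_le X X (ball 0 1) G \<longrightarrow> C2_le X X (ball 0 1) k \<longrightarrow> \<bar>G 0\<bar> \<le> 1 \<longrightarrow>
    C2_le (36 + \<mu>\<^sup>2 * Q) (36 + \<mu>\<^sup>2 * Q) (ball 0 1 \<times> {-1<..<1}) (\<lambda>q. \<mu>\<^sup>2 * (sinh (snd q + t0))\<^sup>2 *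
     (G (fst q) + (\<rho> (2 * ((snd q + t0 - a) / d)) - \<rho> (2 * ((t0 - a) / d))) * k (fst q)) - exp (2 * snd q) * G 0)"
proof -
  let ?q = "\<lambda>t. exp (- 2 * t - 4 * t0) - 2 * exp (- 2 * t0)"
  let ?w = "\<lambda>t. \<rho> (2 * ((t + t0 - a) / d)) - \<rho> (2 * ((t0 - a) / d))"
  define r where "r = 1 / (2 * exp (- t0))\<^sup>2"
  define N where "N = \<bar>r\<bar> * (36 + 4 * exp (- t0))"
  define W where "W = 6 / d + 48 / d\<^sup>2"
  have N: "N \<ge> 0" and W: "W \<ge> 0" using assms(2) by (auto simp: N_def W_def)
  \<comment> \<open>The exact formula for the scaled square is read backwards, to bound the unscaled
    one.\<close>
  have s: "(sinh (t + t0))\<^sup>2 = r * (exp (2 * t) + ?q t)" for t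
    unfolding scaled_sinh_squared[symmetric] by (simp add: r_def)
  have sN: "D2_le N {-1<..<1} (\<lambda>t. (sinh (t + t0))\<^sup>2)"
    unfolding s N_def by (intro D2_le_cmult D2_le_add D2_le_exp D2_le_sinh_error assms)
  have w: "D2_le W {-1<..<1} ?w" unfolding W_def by (rule D2_le_cutoff_difference[OF assms(1,2)])
  define Q where "Q = N * X + 4 * N * W * X"
  have "0 \<le> Q" using N W assms(4) by (simp add: Q_def)
  moreover
  {
    fix \<mu> :: real and G k :: "'a \<Rightarrow> real"
    assume G: "C2_le X X (ball 0 1) G" and k: "C2_le X X (ball 0 1) k" and G0: "\<bar>G 0\<bar> \<le> 1"
    have "C2_le 1 1 (ball 0 1) (\<lambda>y::'a. - G 0)"
      by (rule C2_le_mono[OF C2_le_const]) (use G0 in auto)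
    then have 1: "C2_le (36 * 1) (36 * 1) (ball (0::'a) 1 \<times> {-1<..<1}) (\<lambda>q. exp (2 * snd q) * (- G 0))"
      by (intro C2_le_separated_product D2_le_exp) auto
    have 2: "C2_le (N * X) (N * X) (ball 0 1 \<times> {-1<..<1}) (\<lambda>q. (sinh (snd q + t0))\<^sup>2 * G (fst q))"
      by (intro C2_le_separated_product sN G N) auto
    have 3: "C2_le (4 * N * W * X) (4 * N * W * X) (ball 0 1 \<times> {-1<..<1}) (\<lambda>q. (sinh (snd q + t0))\<^sup>2 * ?w (snd q) * k (fst q))"
      by (rule C2_le_separated_product[OF _ _ D2_le_mult[OF sN w N W] k]) (use N W in auto)
    have op: "open (ball (0::'a) 1 \<times> {-1<..<1::real})" by (intro open_Times) auto
    have "C2_le (36 * 1 + \<bar>\<mu>\<^sup>2\<bar> * (N * X + 4 * N * W * X)) (36 * 1 + \<bar>\<mu>\<^sup>2\<bar> * (N * X + 4 * N * W * X)) (ball 0 1 \<times> {-1<..<1})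
       (\<lambda>q. exp (2 * snd q) * (- G 0) + \<mu>\<^sup>2 * ((sinh (snd q + t0))\<^sup>2 * G (fst q) + (sinh (snd q + t0))\<^sup>2 * ?w (snd q) * k (fst q)))"
      by (rule C2_le_add[OF op 1 C2_le_cmult[OF op C2_le_add[OF op 2 3]]])
    then have "C2_le (36 + \<mu>\<^sup>2 * Q) (36 + \<mu>\<^sup>2 * Q) (ball 0 1 \<times> {-1<..<1}) (\<lambda>q. \<mu>\<^sup>2 * (sinh (snd q + t0))\<^sup>2 *
     (G (fst q) + ?w (snd q) * k (fst q)) - exp (2 * snd q) * G 0)"
      unfolding Q_def by (simp add: algebra_simps)
  }
  ultimately show ?thesis by blast
qed

text \<open>
  This is \<open>8700 n x L\<^sup>4\<close>, where \<open>L = sqrt (n (n n!)\<^sup>2 x ^ (n + 1))\<close> bounds the sum norms of a frame orthonormal for a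
  metric that is \<open>x\<close>-bounded.
\<close>

definition warp_bound :: "nat \<Rightarrow> real \<Rightarrow> real" where
  "warp_bound n x = 8700 * (real n ^ 7 * fact n ^ 4 * x ^ (2 * n + 3))"

lemma pullback_radial_chart:
  fixes \<phi>1 :: "real ^ 'n \<Rightarrow> ('n::finite) space" and x :: "real ^ 'n"
  assumes "(\<phi>1 has_derivative D) (at x)"
  shows "pullback (\<lambda>(x, t). (\<phi>1 x, t + t0)) h (x, t) (u, s) (v, s') = h (\<phi>1 x, t + t0) (D u, s) (D v, s')"
proof -
  have "((\<lambda>q. \<phi>1 (fst q)) has_derivative (\<lambda>w. D (fst w))) (at (x, t))"
    by (rule has_derivative_compose[OF has_derivative_fst[OF has_derivative_ident]]) (use assms in simp)
  then have "((\<lambda>q. (\<phi>1 (fst q), snd q + t0)) has_derivative (\<lambda>w. (D (fst w), snd w))) (at (x, t))"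
    by (auto intro!: derivative_eq_intros)
  then have "frechet_derivative (\<lambda>(x, t). (\<phi>1 x, t + t0)) (at (x, t)) = (\<lambda>w. (D (fst w), snd w))"
    unfolding case_prod_unfold by (rule frechet_derivative_at[symmetric])
  then show ?thesis by (simp add: pullback_def)
qed

text \<open>The determinants enter only at \<open>z\<close>, because orthonormality is imposed only
  at the centre; elsewhere the C2 bounds control the coefficients.\<close>

lemma exists_close_chart:
  fixes g :: "('n::finite) space tensor2" and \<psi> :: "real ^ 'n \<Rightarrow> 'n space"
  assumes \<rho>: "cutoff \<rho>" and chart: "sphere_chart U \<psi>" and ball: "ball z 1 \<subseteq> U"
    and cS: "cS > 1" and c: "c > 1" and g: "sphere_metric g"
    and normS: "C2_norm U (pullback \<psi> round_metric) < ereal cS"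
    and normH: "C2_norm U (pullback \<psi> g) < ereal c"
    and detS: "\<bar>det (\<chi> i j. pullback \<psi> round_metric z (axis i 1) (axis j 1))\<bar> > 1 / cS"
    and detH: "\<bar>det (\<chi> i j. pullback \<psi> g z (axis i 1) (axis j 1))\<bar> > 1 / c"
    and d: "d > 0" and t0: "t0 > 1" and K: "warp_bound CARD('n) (c + cS) * (exp (- t0) + 1 / d) \<le> \<epsilon>"
  shows "\<exists>\<phi>1. sphere_chart (ball 0 1) \<phi>1 \<and> \<phi>1 0 = \<psi> z \<and>
    C2_norm model_domain (\<lambda>y u v. pullback (\<lambda>(x, t). (\<phi>1 x, t + t0))
      (pullback from_polar (two_var_warp \<rho> a d g)) y u v - model_metric y u v) < ereal \<epsilon>"
proof -
  let ?n = "CARD('n)"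
  let ?x = "c + cS"
  define S where "S = pullback \<psi> (round_metric :: 'n space tensor2)"
  define H where "H = pullback \<psi> g"
  define r where "r = \<rho> (2 * ((t0 - a) / d))"
  have r: "0 \<le> r" "r \<le> 1" using \<rho> by (auto simp: r_def cutoff_def)
  \<comment> \<open>For every \<open>s\<close>, \<open>S + s * (H - S) = F + (s - r) * k\<close>.
    This separates the slice through the centre from the increment of the cut-off.\<close>
  define F where "F = (\<lambda>z u v. (1 - r) * S z u v + r * H z u v)"
  define k where "k = (\<lambda>z u v. 1 * H z u v + (-1) * S z u v)"
  have op: "open U" using chart by (simp add: sphere_chart_def)
  have z: "z \<in> U" using ball by auto
  have ip: "inner_product_on UNIV (S y)" "inner_product_on UNIV (H y)" if "y \<in> U" for y
    unfolding S_def H_def using sphere_chart_D(2)[OF chart that] g sphere_metric_round_metric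
    by (auto intro!: inner_product_on_pullback_chart[OF chart that] simp: sphere_metric_def)
  have bil: "bilinear (S y)" "bilinear (H y)" "bilinear (F y)" "bilinear (k y)" if "y \<in> U" for y
  proof -
    show b: "bilinear (S y)" "bilinear (H y)" by (rule bilinear_inner_product_on[OF ip(1)[OF that]], rule bilinear_inner_product_on[OF ip(2)[OF that]])
    show "bilinear (F y)" "bilinear (k y)"
      unfolding F_def k_def by (rule bilinear_combination[OF b] bilinear_combination[OF b(2,1)])+
  qed
  have C2S: "C2_le cS cS U (\<lambda>y. S y b b')" and C2H: "C2_le c c U (\<lambda>y. H y b b')"
    if "b \<in> Basis" "b' \<in> Basis" for b b'
    unfolding S_def H_def
    using C2_norm_less_imp_C2_le[OF normS _ that] C2_norm_less_imp_C2_le[OF normH _ that]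
      chart g sphere_metric_round_metric[where 'n='n] by (auto simp: sphere_metric_def)
  have C2F: "C2_le ?x ?x U (\<lambda>y. F y b b')" if "b \<in> Basis" "b' \<in> Basis" for b b'
  proof -
    have "C2_le (\<bar>1 - r\<bar> * cS + \<bar>r\<bar> * c) (\<bar>1 - r\<bar> * cS + \<bar>r\<bar> * c) U (\<lambda>y. F y b b')"
      unfolding F_def by (rule C2_le_add[OF op C2_le_cmult[OF op C2S[OF that]] C2_le_cmult[OF op C2H[OF that]]])
    moreover have "(1 - r) * cS \<le> cS" "r * c \<le> c" using r c cS by (auto simp: mult_left_le_one_le)
    ultimately show ?thesis using r by (elim C2_le_mono) auto
  qed
  have C2k: "C2_le ?x ?x U (\<lambda>y. k y b b')" if "b \<in> Basis" "b' \<in> Basis" for b b'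
  proof -
    have "C2_le (\<bar>1\<bar> * c + \<bar>-1\<bar> * cS) (\<bar>1\<bar> * c + \<bar>-1\<bar> * cS) U (\<lambda>y. k y b b')"
      unfolding k_def by (rule C2_le_add[OF op C2_le_cmult[OF op C2H[OF that]] C2_le_cmult[OF op C2S[OF that]]])
    then show ?thesis by simp
  qed
  define m where "m = (real ?n * fact ?n)\<^sup>2 * ?x ^ (?n + 1)"
  \<comment> \<open>Applied to \<open>S\<close> with \<open>e = cS\<close> and to \<open>H\<close>
    with \<open>e = c\<close>. Having the same \<open>m\<close> for both lets the bound pass to
    their convex combination \<open>F z\<close>.\<close>
  have low: "u \<bullet> u \<le> m * B u u"
    if B: "inner_product_on UNIV B" and e: "\<And>b b'. b \<in> Basis \<Longrightarrow> b' \<in> Basis \<Longrightarrow> \<bar>B b b'\<bar> \<le> e" and "1 < e" "e \<le> ?x"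
      and det: "\<bar>det (\<chi> i j. B (axis i 1) (axis j 1))\<bar> > 1 / e" for B e and u :: "real ^ 'n"
  proof -
    have "0 \<le> B u u"
      using inner_product_on_D(3)[OF B, of u] inner_product_on_bilinear(7)[OF B subspace_UNIV, of 0 0 0]
      by (cases "u = 0") (auto simp: less_imp_le)
    have "u \<bullet> u \<le> (real ?n * fact ?n)\<^sup>2 * e ^ (?n + 1) * B u u"
      by (rule inner_product_lower_bound[OF B _ e det]) (use that in \<open>auto simp: axis_in_Basis_iff\<close>)
    also have "\<dots> \<le> m * B u u"
      unfolding m_def using that(3,4) \<open>0 \<le> B u u\<close> by (intro mult_right_mono mult_left_mono power_mono) auto
    finally show ?thesis .
  qed
  have ipF: "inner_product_on UNIV (F z)"
  proof -
    have "F z = (\<lambda>u v. S z u v + r * (H z u v - S z u v))" by (simp add: F_def fun_eq_iff algebra_simps)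
    then show ?thesis using inner_product_on_convex[OF ip[OF z] r] by simp
  qed
  have lowF: "u \<bullet> u \<le> m * F z u u" for u
  proof -
    have "u \<bullet> u \<le> m * S z u u"
      by (rule low[OF ip(1)[OF z], of cS]) (use C2_leD(2)[OF C2S z] detS c cS in \<open>auto simp: S_def\<close>)
    moreover have "u \<bullet> u \<le> m * H z u u"
      by (rule low[OF ip(2)[OF z], of c]) (use C2_leD(2)[OF C2H z] detH c cS in \<open>auto simp: H_def\<close>)
    ultimately have "(1 - r) * (u \<bullet> u) + r * (u \<bullet> u) \<le> (1 - r) * (m * S z u u) + r * (m * H z u u)"
      using r by (intro add_mono mult_left_mono) auto
    then show ?thesis by (simp add: F_def algebra_simps)
  qed
  define L where "L = sqrt (real DIM(real ^ 'n) * m)"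
  obtain T :: "real ^ 'n \<Rightarrow> real ^ 'n" where T: "linear T" "inj T"
    "\<And>i j. i \<in> Basis \<Longrightarrow> j \<in> Basis \<Longrightarrow> F z (T i) (T j) = (if i = j then 1 else 0)"
    "\<And>i. i \<in> Basis \<Longrightarrow> (\<Sum>b\<in>Basis. \<bar>T i \<bullet> b\<bar>) \<le> L" "\<And>y. norm (T y) \<le> L * norm y"
    using exists_orthonormal_map[OF ipF lowF L_def] by blast
  have n1: "real ?n \<ge> 1" and f1: "(fact ?n :: real) \<ge> 1" and x1: "?x \<ge> 1" using c cS by (auto simp: Suc_leI)
  have m1: "m \<ge> 1"
  proof -
    have "1 * 1 \<le> real ?n * fact ?n" using n1 f1 by (intro mult_mono) auto
    then have "1 \<le> (real ?n * fact ?n)\<^sup>2" by (simp add: one_le_power)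
    moreover have "1 \<le> ?x ^ (?n + 1)" using x1 by (rule one_le_power)
    ultimately have "1 * 1 \<le> m" unfolding m_def by (intro mult_mono) auto
    then show ?thesis by simp
  qed
  have L2: "L\<^sup>2 = real ?n * m" using m1 by (simp add: L_def)
  have L1: "L \<ge> 1"
  proof -
    have "1 * 1 \<le> real ?n * m" using n1 m1 by (intro mult_mono) auto
    then show ?thesis by (simp add: L_def)
  qed
  define X where "X = ?x * L\<^sup>2"
  have X: "X \<ge> 1" using mult_mono[of 1 ?x 1 "L\<^sup>2"] x1 L1 by (simp add: X_def one_le_power)
  \<comment> \<open>All coefficients met in the error, namely \<open>X\<close>, \<open>n L X\<close>
    and \<open>L\<close>, are dominated by this one quantity.\<close>
  define Y where "Y = real ?n * X * L\<^sup>2"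
  have Y: "warp_bound ?n ?x = 8700 * Y"
  proof -
    have alg: "p ^ 7 * q ^ 4 * (x * y\<^sup>2) = p * (x * (p * ((p * q)\<^sup>2 * y))) * (p * ((p * q)\<^sup>2 * y))"
      for p q x y :: real by (simp add: eval_nat_numeral)
    have "?x ^ (2 * ?n + 3) = ?x ^ (1 + (?n + 1) * 2)" by (rule arg_cong[where f="power _"]) simp
    also have "\<dots> = ?x * (?x ^ (?n + 1))\<^sup>2" by (simp only: power_add power_one_right power_mult)
    finally have pw: "?x ^ (2 * ?n + 3) = ?x * (?x ^ (?n + 1))\<^sup>2" .
    show ?thesis unfolding warp_bound_def Y_def X_def L2 m_def pw by (simp only: alg)
  qed
  have XY: "X \<le> Y" "real ?n * L * X \<le> Y" "L \<le> Y"
  proof -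
    have LL: "L \<le> L\<^sup>2" using L1 by (simp add: power2_eq_square mult_le_cancel_left1)
    show 2: "real ?n * L * X \<le> Y" using LL n1 X by (simp add: Y_def algebra_simps mult_left_mono)
    have "1 * 1 * X \<le> real ?n * L * X" using n1 L1 X by (intro mult_mono) auto
    then show "X \<le> Y" using 2 by simp
    have "1 * L * 1 \<le> real ?n * L * X" using n1 L1 X by (intro mult_mono) auto
    then show "L \<le> Y" using 2 by simp
  qed
  have Y1: "Y \<ge> 1" using XY X by simp
  have frame_in_U: "z + \<mu> *\<^sub>R T y \<in> U" if \<mu>: "0 < \<mu>" "\<mu> * L \<le> 1" and y: "y \<in> ball 0 1" for \<mu> y
  proof -
    have "norm (\<mu> *\<^sub>R T y) \<le> \<mu> * L * norm y" using T(5)[of y] \<mu>(1) by (simp add: mult.assoc)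
    also have "\<dots> \<le> 1 * norm y" using \<mu>(2) by (rule mult_right_mono) simp
    also have "\<dots> < 1" using y by simp
    finally show ?thesis using ball by (auto simp: dist_norm)
  qed
  \<comment> \<open>Both ranges of \<open>\<epsilon>\<close> end here: each has only to supply a
    scale \<open>\<mu>\<close> that keeps the chart in \<open>U\<close> and an estimate of the
    purely spherical entries.\<close>
  have close: ?thesis
    if \<mu>: "0 < \<mu>" "\<mu> * L \<le> 1" and M: "0 \<le> M" "M < \<epsilon>"
      and est: "\<And>i j. i \<in> Basis \<Longrightarrow> j \<in> Basis \<Longrightarrow> C2_le M M (ball 0 1 \<times> {-1<..<1}) (\<lambda>q. \<mu>\<^sup>2 * (sinh (snd q + t0))\<^sup>2 *
        (F (z + \<mu> *\<^sub>R T (fst q)) (T i) (T j) + (\<rho> (2 * ((snd q + t0 - a) / d)) - \<rho> (2 * ((t0 - a) / d))) *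
           k (z + \<mu> *\<^sub>R T (fst q)) (T i) (T j)) - exp (2 * snd q) * F (z + \<mu> *\<^sub>R T 0) (T i) (T j))" for \<mu> M
  proof -
    define \<phi>1 where "\<phi>1 = (\<lambda>y. \<psi> (z + \<mu> *\<^sub>R T y))"
    have lin: "linear (\<lambda>y. \<mu> *\<^sub>R T y)" using T(1) by (rule linear_compose_scale_right)
    have inj: "inj (\<lambda>y. \<mu> *\<^sub>R T y)" using T(2) \<mu>(1) by (auto simp: inj_def)
    note sub = frame_in_U[OF \<mu>]
    have chart1: "sphere_chart (ball 0 1) \<phi>1"
      unfolding \<phi>1_def by (rule sphere_chart_affine[OF chart lin inj sub])
    have T0: "T 0 = 0" using T(1) by (rule linear_0)
    have val: "pullback (\<lambda>(x, t). (\<phi>1 x, t + t0)) (pullback from_polar (two_var_warp \<rho> a d g)) (x, t) (u, s) (v, s') -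
        model_metric (x, t) (u, s) (v, s') =
      \<mu>\<^sup>2 * (sinh (t + t0))\<^sup>2 * (F (z + \<mu> *\<^sub>R T x) (T u) (T v) + (\<rho> (2 * ((t + t0 - a) / d)) - r) *
           k (z + \<mu> *\<^sub>R T x) (T u) (T v)) - exp (2 * t) * (u \<bullet> v)"
      if "x \<in> ball 0 1" "t \<in> {-1<..<1}" for x t u v s s'
    proof -
      note D1 = sphere_chart_D[OF chart1 that(1)] and D = sphere_chart_D(3)[OF chart sub[OF that(1)]]
      have pb: "h (\<phi>1 x) (frechet_derivative \<phi>1 (at x) u) (frechet_derivative \<phi>1 (at x) v) =
         pullback \<psi> h (z + \<mu> *\<^sub>R T x) (\<mu> *\<^sub>R T u) (\<mu> *\<^sub>R T v)" for h
      proof -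
        have "pullback \<phi>1 h x u v = pullback \<psi> h (z + \<mu> *\<^sub>R T x) (\<mu> *\<^sub>R T u) (\<mu> *\<^sub>R T v)"
          unfolding \<phi>1_def by (rule pullback_affine(1)[where T="\<lambda>y. \<mu> *\<^sub>R T y" and z=z and y=x, OF D lin])
        then show ?thesis by (simp add: pullback_def)
      qed
      have "pullback (\<lambda>(x, t). (\<phi>1 x, t + t0)) (pullback from_polar (two_var_warp \<rho> a d g)) (x, t) (u, s) (v, s') =
         (sinh (t + t0))\<^sup>2 * deformed_family \<rho> a d g (t + t0) (\<phi>1 x) (frechet_derivative \<phi>1 (at x) u) (frechet_derivative \<phi>1 (at x) v) + s * s'"
        unfolding pullback_radial_chart[OF D1(3)]
        by (rule pullback_two_var_warp) (use D1 that t0 in auto)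
      also have "\<dots> = (sinh (t + t0))\<^sup>2 * (S (z + \<mu> *\<^sub>R T x) (\<mu> *\<^sub>R T u) (\<mu> *\<^sub>R T v) + \<rho> (2 * ((t + t0 - a) / d)) *
           (H (z + \<mu> *\<^sub>R T x) (\<mu> *\<^sub>R T u) (\<mu> *\<^sub>R T v) - S (z + \<mu> *\<^sub>R T x) (\<mu> *\<^sub>R T u) (\<mu> *\<^sub>R T v))) + s * s'"
        unfolding deformed_family_def pb S_def H_def ..
      also have "\<dots> = \<mu>\<^sup>2 * (sinh (t + t0))\<^sup>2 * (F (z + \<mu> *\<^sub>R T x) (T u) (T v) + (\<rho> (2 * ((t + t0 - a) / d)) - r) *
           k (z + \<mu> *\<^sub>R T x) (T u) (T v)) + s * s'"
        unfolding bilinear_lmul[OF bil(1)[OF sub[OF that(1)]]] bilinear_rmul[OF bil(1)[OF sub[OF that(1)]]]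
          bilinear_lmul[OF bil(2)[OF sub[OF that(1)]]] bilinear_rmul[OF bil(2)[OF sub[OF that(1)]]] F_def k_def
        by (simp add: power2_eq_square algebra_simps)
      finally show ?thesis by (simp add: model_metric_def)
    qed
    have "C2_norm model_domain (\<lambda>y u v. pullback (\<lambda>(x, t). (\<phi>1 x, t + t0))
      (pullback from_polar (two_var_warp \<rho> a d g)) y u v - model_metric y u v) < ereal \<epsilon>"
    proof (rule C2_norm_less[OF _ M(2)])
      have opd: "open (ball (0::real ^ 'n) 1 \<times> {-1<..<1::real})" by (intro open_Times) auto
      fix u v :: "'n space" assume uv: "u \<in> Basis" "v \<in> Basis"
      show "C2_le M M model_domain (\<lambda>y. pullback (\<lambda>(x, t). (\<phi>1 x, t + t0))
        (pullback from_polar (two_var_warp \<rho> a d g)) y u v - model_metric y u v)"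
      \<comment> \<open>Entries involving the radial direction agree exactly: both metrics have the
        same \<open>dt\<^sup>2\<close> and no mixed terms.\<close>
      proof (cases "fst u = 0 \<or> fst v = 0")
        case True
        have "C2_le M M (ball (0::real ^ 'n) 1 \<times> {-1<..<1::real}) (\<lambda>y. 0)"
          by (rule C2_le_mono[OF C2_le_const]) (use M(1) in auto)
        then show ?thesis
          unfolding model_domain_def
        proof (rule C2_le_cong[OF opd])
          fix y assume "y \<in> ball (0::real ^ 'n) 1 \<times> {-1<..<1::real}"
          then obtain x t where y: "y = (x, t)" and xt: "x \<in> ball 0 1" "t \<in> {-1<..<1}" by auto
          note b = bil(3,4)[OF sub[OF xt(1)]]
          show "0 = pullback (\<lambda>(x, t). (\<phi>1 x, t + t0)) (pullback from_polar (two_var_warp \<rho> a d g)) y u v - model_metric y u v"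
            using True val[OF xt, of "fst u" "snd u" "fst v" "snd v"]
              bilinear_lzero[OF b(1)] bilinear_rzero[OF b(1)] bilinear_lzero[OF b(2)] bilinear_rzero[OF b(2)]
            by (auto simp: y T0)
        qed
      next
        case False
        then obtain i j where ij: "u = (i, 0)" "v = (j, 0)" "i \<in> Basis" "j \<in> Basis"
          using uv by (auto simp: Basis_prod_def)
        show ?thesis
          unfolding model_domain_def
        proof (rule C2_le_cong[OF opd est[OF ij(3,4)]])
          fix y assume "y \<in> ball (0::real ^ 'n) 1 \<times> {-1<..<1::real}"
          then obtain x t where y: "y = (x, t)" and xt: "x \<in> ball 0 1" "t \<in> {-1<..<1}" by auto
          have "F (z + \<mu> *\<^sub>R T 0) (T i) (T j) = i \<bullet> j"
            using T(3)[OF ij(3,4)] ij(3,4) by (simp add: T0 inner_Basis)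
          then show "\<mu>\<^sup>2 * (sinh (snd y + t0))\<^sup>2 *
            (F (z + \<mu> *\<^sub>R T (fst y)) (T i) (T j) + (\<rho> (2 * ((snd y + t0 - a) / d)) - \<rho> (2 * ((t0 - a) / d))) *
             k (z + \<mu> *\<^sub>R T (fst y)) (T i) (T j)) - exp (2 * snd y) * F (z + \<mu> *\<^sub>R T 0) (T i) (T j) =
            pullback (\<lambda>(x, t). (\<phi>1 x, t + t0)) (pullback from_polar (two_var_warp \<rho> a d g)) y u v - model_metric y u v"
            using val[OF xt, of i 0 j 0] by (simp add: y ij r_def)
        qed
      qed
    qed
    moreover have "\<phi>1 0 = \<psi> z" by (simp add: \<phi>1_def T0)
    ultimately show ?thesis using chart1 by blast
  qed
  have entry: "C2_le X (\<mu> * L * X) (ball 0 1) (\<lambda>y. F (z + \<mu> *\<^sub>R T y) (T i) (T j))"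
    "C2_le X (\<mu> * L * X) (ball 0 1) (\<lambda>y. k (z + \<mu> *\<^sub>R T y) (T i) (T j))"
    if \<mu>: "0 < \<mu>" "\<mu> * L \<le> 1" and ij: "i \<in> Basis" "j \<in> Basis" for \<mu> i j
  proof -
    note sub = frame_in_U[OF \<mu>]
    show "C2_le X (\<mu> * L * X) (ball 0 1) (\<lambda>y. F (z + \<mu> *\<^sub>R T y) (T i) (T j))"
      unfolding X_def by (rule C2_le_frame_entry[OF bil(3) C2F T(1,4) sub \<mu> _ ij]) (use x1 in auto)
    show "C2_le X (\<mu> * L * X) (ball 0 1) (\<lambda>y. k (z + \<mu> *\<^sub>R T y) (T i) (T j))"
      unfolding X_def by (rule C2_le_frame_entry[OF bil(4) C2k T(1,4) sub \<mu> _ ij]) (use x1 in auto)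
  qed
  show ?thesis
  proof (cases "\<epsilon> \<le> 37")
    case True
    have e0: "0 < exp (- t0)" "0 < 1 / d" using d by auto
    have "8700 * Y * exp (- t0) \<le> 8700 * Y * (exp (- t0) + 1 / d)" "8700 * Y * (1 / d) \<le> 8700 * Y * (exp (- t0) + 1 / d)"
      using e0 Y1 by (simp_all add: algebra_simps)
    \<comment> \<open>As \<open>L \<le> Y\<close> and \<open>1 \<le> Y\<close>, these two bounds put
      \<open>2 * exp (- t0) * L\<close> and \<open>1 / d\<close> far below 1.\<close>
    then have small: "8700 * Y * exp (- t0) \<le> 37" "8700 * Y * (1 / d) \<le> 37"
      using K True unfolding Y by linarith+
    have "L * exp (- t0) \<le> Y * exp (- t0)" using XY(3) by (rule mult_right_mono) simp
    then have "2 * (L * exp (- t0)) \<le> 1" using small(1)[unfolded mult.assoc] by linarith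
    then have \<tau>: "2 * exp (- t0) * L \<le> 1" by (simp add: mult_ac)
    have "1 * (1 / d) \<le> Y * (1 / d)" using Y1 e0(2) by (intro mult_right_mono) auto
    then have "1 / d \<le> 1" using small(2)[unfolded mult.assoc] by linarith
    then have d1: "1 \<le> d" using d by simp
    define M where "M = 36 * (real DIM(real ^ 'n) * (2 * exp (- t0) * L * X)) + 4 * exp (- t0) * X + 8640 / d * X"
    have "M = 72 * (real ?n * L * X) * exp (- t0) + 4 * X * exp (- t0) + 8640 * X * (1 / d)"
      by (simp add: M_def)
    also have "\<dots> \<le> 72 * Y * exp (- t0) + 4 * Y * exp (- t0) + 8640 * Y * (1 / d)"
      using XY e0 by (intro add_mono mult_right_mono) auto
    \<comment> \<open>Strict because \<open>72 + 4\<close> and \<open>8640\<close> both lie below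
      8700.\<close>
    also have "\<dots> < 8700 * Y * exp (- t0) + 8700 * Y * (1 / d)"
    proof -
      have "0 < Y * exp (- t0)" "0 < Y * (1 / d)" using Y1 e0 by (auto intro!: mult_pos_pos)
      then show ?thesis unfolding mult.assoc by linarith
    qed
    also have "\<dots> = warp_bound ?n ?x * (exp (- t0) + 1 / d)" by (simp add: Y algebra_simps)
    also have "\<dots> \<le> \<epsilon>" by (rule K)
    finally have M: "M < \<epsilon>" .
    have M0: "0 \<le> M" using X L1 d unfolding M_def by (intro add_nonneg_nonneg mult_nonneg_nonneg) auto
    show ?thesis
    proof (rule close[OF _ \<tau> M0 M])
      fix i j :: "real ^ 'n" assume ij: "i \<in> Basis" "j \<in> Basis"
      have p: "0 < 2 * exp (- t0)" by simp
      show "C2_le M M (ball 0 1 \<times> {-1<..<1}) (\<lambda>q. (2 * exp (- t0))\<^sup>2 * (sinh (snd q + t0))\<^sup>2 *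
        (F (z + (2 * exp (- t0)) *\<^sub>R T (fst q)) (T i) (T j) + (\<rho> (2 * ((snd q + t0 - a) / d)) - \<rho> (2 * ((t0 - a) / d))) *
           k (z + (2 * exp (- t0)) *\<^sub>R T (fst q)) (T i) (T j)) - exp (2 * snd q) * F (z + (2 * exp (- t0)) *\<^sub>R T 0) (T i) (T j))"
        by (rule C2_le_model_difference[OF \<rho> d1 _ _ _ \<tau> entry[OF p \<tau> ij] M_def]) (use t0 X L1 in auto)
    qed simp
  next
    case False
    have X0: "0 \<le> X" using X by simp
    obtain Q where Q: "0 \<le> Q" "\<And>\<mu> (G :: real ^ 'n \<Rightarrow> real) k. C2_le X X (ball 0 1) G \<Longrightarrow> C2_le X X (ball 0 1) k \<Longrightarrow> \<bar>G 0\<bar> \<le> 1 \<Longrightarrow>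
      C2_le (36 + \<mu>\<^sup>2 * Q) (36 + \<mu>\<^sup>2 * Q) (ball 0 1 \<times> {-1<..<1}) (\<lambda>q. \<mu>\<^sup>2 * (sinh (snd q + t0))\<^sup>2 *
       (G (fst q) + (\<rho> (2 * ((snd q + t0 - a) / d)) - \<rho> (2 * ((t0 - a) / d))) * k (fst q)) - exp (2 * snd q) * G 0)"
      using C2_le_model_difference_small_scale[OF \<rho> d less_imp_le[OF t0] X0] by blast
    \<comment> \<open>The first entry keeps the chart inside the unit ball, the second makes
      \<open>\<mu>\<^sup>2 * Q \<le> 1\<close>. With \<open>36 + 1 < \<epsilon>\<close> this is the
      origin of the threshold 37.\<close>
    define \<mu> where "\<mu> = min (1 / L) (1 / (Q + 1))"
    have \<mu>0: "0 < \<mu>" using L1 Q(1) by (simp add: \<mu>_def)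
    have \<mu>L: "\<mu> * L \<le> 1" using L1 by (simp add: \<mu>_def min_def field_simps)
    have \<mu>1: "\<mu> \<le> 1" using mult_left_mono[OF L1 less_imp_le[OF \<mu>0]] \<mu>L by simp
    have "\<mu>\<^sup>2 * Q \<le> \<mu> * Q" using \<mu>0 \<mu>1 Q(1) by (intro mult_right_mono) (auto simp: power2_eq_square mult_left_le_one_le)
    also have "\<dots> \<le> 1 / (Q + 1) * Q" using Q(1) by (intro mult_right_mono) (auto simp: \<mu>_def)
    also have "\<dots> \<le> 1" using Q(1) by (simp add: field_simps)
    finally have "36 + \<mu>\<^sup>2 * Q < \<epsilon>" using False by simp
    then show ?thesis
    proof (rule close[OF \<mu>0 \<mu>L, rotated])
      show "0 \<le> 36 + \<mu>\<^sup>2 * Q" using Q(1) by simp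
      fix i j :: "real ^ 'n" assume ij: "i \<in> Basis" "j \<in> Basis"
      have \<tau>X: "\<mu> * L * X \<le> X" using mult_right_mono[OF \<mu>L X0] by simp
      show "C2_le (36 + \<mu>\<^sup>2 * Q) (36 + \<mu>\<^sup>2 * Q) (ball 0 1 \<times> {-1<..<1}) (\<lambda>q. \<mu>\<^sup>2 * (sinh (snd q + t0))\<^sup>2 *
        (F (z + \<mu> *\<^sub>R T (fst q)) (T i) (T j) + (\<rho> (2 * ((snd q + t0 - a) / d)) - \<rho> (2 * ((t0 - a) / d))) *
           k (z + \<mu> *\<^sub>R T (fst q)) (T i) (T j)) - exp (2 * snd q) * F (z + \<mu> *\<^sub>R T 0) (T i) (T j))"
        by (rule Q(2)) (use C2_le_mono[OF entry(1)[OF \<mu>0 \<mu>L ij]] C2_le_mono[OF entry(2)[OF \<mu>0 \<mu>L ij]] \<tau>X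
            T(3)[OF ij] linear_0[OF T(1)] in auto)
    qed
  qed
qed

section \<open>Smoothness of the deformed metric\<close>

text \<open>Taylor coefficients of the square of \<open>sinh r / r\<close> in the variable
  \<open>r\<^sup>2\<close>, obtained from \<open>(cosh (2 * r) - 1) / 2\<close>; the leading one is
  1.\<close>

definition sinh_sq_coeff :: "nat \<Rightarrow> real" where
  "sinh_sq_coeff k = 2 ^ (2 * k + 1) / fact (2 * k + 2)"

lemma summable_sinh_sq_coeff: "summable (\<lambda>k. sinh_sq_coeff k * y ^ k)"
proof (rule summable_comparison_test')
  show "summable (\<lambda>k. 2 * ((4 * \<bar>y\<bar>) ^ k /\<^sub>R fact k))"
    by (intro summable_mult summable_exp_generic)
  fix k :: nat
  have "(fact k :: real) \<le> fact (2 * k + 2)" by (rule fact_mono) simp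
  then have "2 * 4 ^ k / fact (2 * k + 2) \<le> 2 * 4 ^ k / (fact k :: real)"
    by (intro divide_left_mono) auto
  then have "2 * 4 ^ k / fact (2 * k + 2) * \<bar>y\<bar> ^ k \<le> 2 * 4 ^ k / fact k * \<bar>y\<bar> ^ k"
    by (rule mult_right_mono) simp
  moreover have "norm (sinh_sq_coeff k * y ^ k) = 2 * 4 ^ k / fact (2 * k + 2) * \<bar>y\<bar> ^ k"
    by (simp add: sinh_sq_coeff_def abs_mult power_abs power_mult del: fact_Suc)
  moreover have "2 * ((4 * \<bar>y\<bar>) ^ k /\<^sub>R fact k) = 2 * 4 ^ k / fact k * \<bar>y\<bar> ^ k"
    by (simp add: power_mult_distrib divide_inverse)
  ultimately show "norm (sinh_sq_coeff k * y ^ k) \<le> 2 * ((4 * \<bar>y\<bar>) ^ k /\<^sub>R fact k)"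
    by simp
qed

lemma summable_sinh_sq_coeff_Suc: "summable (\<lambda>k. sinh_sq_coeff (Suc k) * y ^ k)"
proof (cases "y = 0")
  case True
  then show ?thesis by (simp add: powser_zero summable_0_powser)
next
  case False
  have "summable (\<lambda>k. sinh_sq_coeff (Suc k) * y ^ Suc k)"
    using summable_sinh_sq_coeff[of y] by (subst summable_Suc_iff)
  then have "summable (\<lambda>k. sinh_sq_coeff (Suc k) * y ^ Suc k * (1 / y))" by (rule summable_mult2)
  then show ?thesis using False by simp
qed

lemma sinh_squared_series: "(sinh r)\<^sup>2 = r\<^sup>2 * (\<Sum>k. sinh_sq_coeff k * (r\<^sup>2) ^ k)"
proof -
  \<comment> \<open>The series of \<open>cosh (2 * r)\<close>: reindexing removes the vanishing odd
    terms, and the shift by one removes the constant term.\<close>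
  let ?f = "\<lambda>n. if even n then (2 * r) ^ n /\<^sub>R fact n else 0"
  have "strict_mono (\<lambda>n::nat. 2 * n)" by (simp add: strict_mono_def)
  moreover have "?f n = 0" if "n \<notin> range (\<lambda>n::nat. 2 * n)" for n using that by (auto elim: evenE)
  ultimately have "(\<lambda>k. ?f (2 * k)) sums cosh (2 * r)"
    using sums_mono_reindex[of "\<lambda>n. 2 * n" ?f "cosh (2 * r)"] cosh_converges[of "2 * r"] by blast
  then have "(\<lambda>k. ?f (2 * (k + 1))) sums (cosh (2 * r) - (\<Sum>k<1. ?f (2 * k)))"
    by (rule sums_split_initial_segment)
  then have "(\<lambda>k. (2 * r) ^ (2 * k + 2) / fact (2 * k + 2)) sums (cosh (2 * r) - 1)"
    by (simp add: divide_inverse mult.commute)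
  then have "(\<lambda>k. (2 * r) ^ (2 * k + 2) / fact (2 * k + 2) / 2) sums ((cosh (2 * r) - 1) / 2)"
    by (rule sums_divide)
  moreover have "(2 * r) ^ (2 * k + 2) / fact (2 * k + 2) / 2 = r\<^sup>2 * (sinh_sq_coeff k * (r\<^sup>2) ^ k)" for k
  proof -
    have e: "(2 * r) ^ (2 * k + 2) = 2 * 2 ^ (2 * k + 1) * (r\<^sup>2 * (r\<^sup>2) ^ k)"
      by (simp add: power_mult_distrib power_mult power2_eq_square)
    have "2 * A * (B * C) / F / 2 = B * (A / F * C)" for A B C F :: real by simp
    then show ?thesis unfolding e sinh_sq_coeff_def by blast
  qed
  moreover have "(cosh (2 * r) - 1) / 2 = (sinh r)\<^sup>2"
    by (simp add: cosh_double cosh_square_eq)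
  ultimately have "(\<lambda>k. r\<^sup>2 * (sinh_sq_coeff k * (r\<^sup>2) ^ k)) sums (sinh r)\<^sup>2" by simp
  then show ?thesis
    using suminf_mult[OF summable_sinh_sq_coeff, of "r\<^sup>2" "r\<^sup>2"] sums_unique by force
qed

text \<open>Because the leading coefficient is 1, subtracting 1 leaves a series divisible by
  \<open>y\<close>; this compensates the division by \<open>x \<bullet> x\<close> hidden in the
  radial projection.\<close>

lemma sinh_sq_series_head:
  "(\<Sum>k. sinh_sq_coeff k * y ^ k) = 1 + y * (\<Sum>k. sinh_sq_coeff (Suc k) * y ^ k)"
proof -
  have "(\<Sum>k. sinh_sq_coeff (Suc k) * y ^ Suc k) = y * (\<Sum>k. sinh_sq_coeff (Suc k) * y ^ k)"
    by (subst suminf_mult[symmetric, OF summable_sinh_sq_coeff_Suc]) (simp add: mult_ac)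
  then show ?thesis
    using suminf_split_head[OF summable_sinh_sq_coeff[of y]] by (simp add: sinh_sq_coeff_def)
qed

text \<open>Written with everywhere convergent power series in \<open>x \<bullet> x\<close>, the metric is visibly smooth at the origin.\<close>

lemma two_var_warp_inside:
  assumes "cutoff \<rho>" "d > 0" "norm x < a"
  shows "two_var_warp \<rho> a d g x v w =
    (\<Sum>k. sinh_sq_coeff k * (x \<bullet> x) ^ k) * (v \<bullet> w) -
    (\<Sum>k. sinh_sq_coeff (Suc k) * (x \<bullet> x) ^ k) * ((x \<bullet> v) * (x \<bullet> w))"
proof (cases "x = 0")
  case True
  then show ?thesis using sinh_sq_series_head[of 0] by (simp add: two_var_warp_def)
next
  case False
  define r where "r = norm x"
  have r: "r > 0" "x \<bullet> x = r\<^sup>2" using False by (auto simp: r_def power2_norm_eq_inner)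
  define P where "P = (\<Sum>k. sinh_sq_coeff k * (r\<^sup>2) ^ k)"
  define Q where "Q = (\<Sum>k. sinh_sq_coeff (Suc k) * (r\<^sup>2) ^ k)"
  have P: "(sinh r)\<^sup>2 = r\<^sup>2 * P" "P = 1 + r\<^sup>2 * Q"
    unfolding P_def Q_def by (rule sinh_squared_series, rule sinh_sq_series_head)
  have "\<rho> (2 * ((norm x - a) / d)) = 0"
    using assms by (auto simp: cutoff_def divide_nonpos_pos)
  then have "two_var_warp \<rho> a d g x v w = (sinh r)\<^sup>2 *
      (((v - (sgn x \<bullet> v) *\<^sub>R sgn x) /\<^sub>R r) \<bullet> ((w - (sgn x \<bullet> w) *\<^sub>R sgn x) /\<^sub>R r)) + (sgn x \<bullet> v) * (sgn x \<bullet> w)"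
    by (simp add: two_var_warp_nonzero[OF False] deformed_family_def round_metric_def r_def)
  also have "\<dots> = P * ((v - (sgn x \<bullet> v) *\<^sub>R sgn x) \<bullet> (w - (sgn x \<bullet> w) *\<^sub>R sgn x)) + (sgn x \<bullet> v) * (sgn x \<bullet> w)"
  proof -
    have "r\<^sup>2 * P * (inverse r * (inverse r * q)) = P * q" for q
      using r(1) by (simp add: power2_eq_square field_simps)
    then show ?thesis unfolding P(1) by simp
  qed
  also have "(v - (sgn x \<bullet> v) *\<^sub>R sgn x) \<bullet> (w - (sgn x \<bullet> w) *\<^sub>R sgn x) = v \<bullet> w - (sgn x \<bullet> v) * (sgn x \<bullet> w)"
  proof -
    have "sgn x \<bullet> sgn x = 1" using False by (simp add: dot_square_norm norm_sgn)
    then show ?thesis by (simp add: inner_diff_left inner_diff_right inner_commute algebra_simps)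
  qed
  \<comment> \<open>The products of \<open>sgn x\<close> are singular at the origin. With
    \<open>P = 1 + r\<^sup>2 * Q\<close> the bare product cancels, and the remaining one carries the
    factor \<open>r\<^sup>2\<close>, which makes it polynomial.\<close>
  also have "P * (v \<bullet> w - (sgn x \<bullet> v) * (sgn x \<bullet> w)) + (sgn x \<bullet> v) * (sgn x \<bullet> w) =
      P * (v \<bullet> w) - Q * (r\<^sup>2 * ((sgn x \<bullet> v) * (sgn x \<bullet> w)))"
    unfolding P(2) by (simp add: algebra_simps)
  also have "r\<^sup>2 * ((sgn x \<bullet> v) * (sgn x \<bullet> w)) = (x \<bullet> v) * (x \<bullet> w)"
    using r(1) by (simp add: sgn_div_norm r_def[symmetric] power2_eq_square field_simps)
  finally show ?thesis by (simp add: P_def Q_def r(2))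
qed

lemma smooth_on_two_var_warp_inside:
  assumes "cutoff \<rho>" "d > 0"
  shows "smooth_on (ball 0 a) (\<lambda>x. two_var_warp \<rho> a d g x v w)"
proof -
  have sq: "smooth_on UNIV (\<lambda>x::'a space. x \<bullet> x)"
    by (intro smooth_on_inner smooth_on_linear bounded_linear_ident open_UNIV)
  have l: "smooth_on UNIV (\<lambda>x::'a space. x \<bullet> v)" for v
    by (rule smooth_on_linear[OF open_UNIV bounded_linear_inner_left])
  have P: "smooth_on UNIV (\<lambda>x::'a space. \<Sum>k. sinh_sq_coeff k * (x \<bullet> x) ^ k)"
    by (rule smooth_on_compose[OF open_UNIV open_UNIV sq smooth_on_power_series[OF summable_sinh_sq_coeff]]) auto
  have Q: "smooth_on UNIV (\<lambda>x::'a space. \<Sum>k. sinh_sq_coeff (Suc k) * (x \<bullet> x) ^ k)"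
    by (rule smooth_on_compose[OF open_UNIV open_UNIV sq smooth_on_power_series[OF summable_sinh_sq_coeff_Suc]]) auto
  have "smooth_on UNIV (\<lambda>x. (\<Sum>k. sinh_sq_coeff k * (x \<bullet> x) ^ k) * (v \<bullet> w) -
    (\<Sum>k. sinh_sq_coeff (Suc k) * (x \<bullet> x) ^ k) * ((x \<bullet> v) * (x \<bullet> w)))"
    by (rule smooth_on_diff[OF open_UNIV smooth_on_mult[OF open_UNIV P smooth_on_const]
          smooth_on_mult[OF open_UNIV Q smooth_on_mult[OF open_UNIV l l]]])
  then have "smooth_on (ball 0 a) (\<lambda>x. (\<Sum>k. sinh_sq_coeff k * (x \<bullet> x) ^ k) * (v \<bullet> w) -
    (\<Sum>k. sinh_sq_coeff (Suc k) * (x \<bullet> x) ^ k) * ((x \<bullet> v) * (x \<bullet> w)))"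
    by (rule smooth_on_subset) simp
  then show ?thesis
    by (rule smooth_on_cong[OF open_ball, rotated])
      (rule two_var_warp_inside[OF assms, symmetric], simp)
qed

text \<open>A \<open>sphere_metric\<close> is known to be smooth only through its chart
  coefficients. The local chart inverse composed with \<open>sgn\<close> gives smooth coordinates
  \<open>\<eta>\<close>, and differentiating \<open>\<psi> (\<eta> x) = sgn x\<close> expresses the
  tangential vectors through these coordinates.\<close>

lemma smooth_on_radial_extension:
  fixes g :: "('n::finite) space tensor2" and \<A> :: "((real ^ 'n) set \<times> (real ^ 'n \<Rightarrow> 'n space)) set"
  assumes atlas: "sphere_atlas \<A>" and g: "sphere_metric g"
  shows "smooth_on (- {0}) (\<lambda>x. g (sgn x) ((v - (sgn x \<bullet> v) *\<^sub>R sgn x) /\<^sub>R norm x)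
     ((w - (sgn x \<bullet> w) *\<^sub>R sgn x) /\<^sub>R norm x))"
proof (rule smooth_on_local)
  fix x0 :: "'n space" assume "x0 \<in> - {0}"
  then have sph: "sgn x \<in> sph" if "x \<noteq> 0" for x :: "'n space" using that by (simp add: sph_def norm_sgn)
  have "x0 \<noteq> 0" using \<open>x0 \<in> - {0}\<close> by simp
  obtain U \<psi> where "(U, \<psi>) \<in> \<A>" "sgn x0 \<in> \<psi> ` U"
  proof -
    have "\<exists>(U, \<psi>)\<in>\<A>. \<exists>x\<in>U. \<psi> x = sgn x0 \<and> infdist x (- U) \<ge> 1"
      using atlas sph[OF \<open>x0 \<noteq> 0\<close>] by (simp add: sphere_atlas_def)
    then obtain U \<psi> x where "(U, \<psi>) \<in> \<A>" "x \<in> U" "\<psi> x = sgn x0" by auto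
    then show ?thesis using that by (metis imageI)
  qed
  then have chart: "sphere_chart U \<psi>" using atlas by (auto simp: sphere_atlas_def)
  obtain W \<theta> where W: "open U" "smooth_on U \<psi>" "open W" "\<psi> ` U = W \<inter> sph" "smooth_on W \<theta>" "\<forall>x\<in>U. \<theta> (\<psi> x) = x"
    using chart unfolding sphere_chart_def by blast
  define N where "N = - {0} \<inter> sgn -` W"
  have oN: "open N"
    unfolding N_def
    by (rule continuous_open_preimage[OF smooth_on_imp_continuous_on[OF smooth_on_sgn] _ W(3)]) (simp add: open_Compl)
  have x0: "x0 \<in> N" using \<open>sgn x0 \<in> \<psi> ` U\<close> \<open>x0 \<noteq> 0\<close> W(4) by (auto simp: N_def)
  define \<eta> where "\<eta> = (\<lambda>x. \<theta> (sgn x))"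
  have smN: "smooth_on N sgn" by (rule smooth_on_subset[OF smooth_on_sgn]) (auto simp: N_def)
  have \<eta>: "smooth_on N \<eta>"
    unfolding \<eta>_def by (rule smooth_on_compose[OF oN W(3) smN W(5)]) (auto simp: N_def)
  have \<psi>\<eta>: "\<eta> x \<in> U" "\<psi> (\<eta> x) = sgn x" if "x \<in> N" for x
  proof -
    have "sgn x \<in> \<psi> ` U" using that sph W(4) by (auto simp: N_def)
    then show "\<eta> x \<in> U" "\<psi> (\<eta> x) = sgn x" using W(6) by (auto simp: \<eta>_def)
  qed
  have D: "frechet_derivative \<psi> (at (\<eta> x)) (frechet_derivative \<eta> (at x) u) = (u - (sgn x \<bullet> u) *\<^sub>R sgn x) /\<^sub>R norm x"
    if "x \<in> N" for x u
  proof -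
    have "((\<lambda>x. \<psi> (\<eta> x)) has_derivative (\<lambda>u. frechet_derivative \<psi> (at (\<eta> x)) (frechet_derivative \<eta> (at x) u))) (at x)"
      by (rule has_derivative_compose[OF smooth_on_has_derivative[OF \<eta> that]
            smooth_on_has_derivative[OF W(2) \<psi>\<eta>(1)[OF that]]])
    then have "(sgn has_derivative (\<lambda>u. frechet_derivative \<psi> (at (\<eta> x)) (frechet_derivative \<eta> (at x) u))) (at x)"
      by (rule has_derivative_transform_within_open[OF _ oN that]) (rule \<psi>\<eta>(2))
    moreover have "x \<noteq> 0" using that by (simp add: N_def)
    ultimately show ?thesis using has_derivative_unique[OF _ sgn_has_derivative] by metis
  qed
  have "smooth_on N (\<lambda>x. \<Sum>b\<in>Basis. (frechet_derivative \<eta> (at x) v \<bullet> b) *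
     (\<Sum>b'\<in>Basis. (frechet_derivative \<eta> (at x) w \<bullet> b') * pullback \<psi> g (\<eta> x) b b'))"
  proof (rule smooth_on_sum[OF oN])
    have d: "smooth_on N (\<lambda>x. frechet_derivative \<eta> (at x) u \<bullet> b)" for u b
      by (rule smooth_on_inner[OF oN smooth_on_derivative[OF \<eta>] smooth_on_const])
    have p: "smooth_on N (\<lambda>x. pullback \<psi> g (\<eta> x) b b')" for b b'
      by (rule smooth_on_compose[OF oN W(1) \<eta>, of "\<lambda>y. pullback \<psi> g y b b'"])
        (use g chart \<psi>\<eta>(1) in \<open>auto simp: sphere_metric_def\<close>)
    fix b :: "real ^ 'n"
    show "smooth_on N (\<lambda>x. (frechet_derivative \<eta> (at x) v \<bullet> b) *
     (\<Sum>b'\<in>Basis. (frechet_derivative \<eta> (at x) w \<bullet> b') * pullback \<psi> g (\<eta> x) b b'))"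
      by (rule smooth_on_mult[OF oN d smooth_on_sum[OF oN smooth_on_mult[OF oN d p]]])
  qed
  then have "smooth_on N (\<lambda>x. g (sgn x) ((v - (sgn x \<bullet> v) *\<^sub>R sgn x) /\<^sub>R norm x)
     ((w - (sgn x \<bullet> w) *\<^sub>R sgn x) /\<^sub>R norm x))"
  proof (rule smooth_on_cong[OF oN, rotated])
    fix x assume x: "x \<in> N"
    have "inner_product_on (tangent (\<psi> (\<eta> x))) (g (\<psi> (\<eta> x)))"
      using g sphere_chart_D(2)[OF chart \<psi>\<eta>(1)[OF x]] by (auto simp: sphere_metric_def)
    then have bil: "bilinear (pullback \<psi> g (\<eta> x))"
      by (intro bilinear_inner_product_on inner_product_on_pullback_chart[OF chart \<psi>\<eta>(1)[OF x]])
    show "(\<Sum>b\<in>Basis. (frechet_derivative \<eta> (at x) v \<bullet> b) *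
     (\<Sum>b'\<in>Basis. (frechet_derivative \<eta> (at x) w \<bullet> b') * pullback \<psi> g (\<eta> x) b b')) =
     g (sgn x) ((v - (sgn x \<bullet> v) *\<^sub>R sgn x) /\<^sub>R norm x) ((w - (sgn x \<bullet> w) *\<^sub>R sgn x) /\<^sub>R norm x)"
      unfolding bilinear_expansion[OF bil, symmetric] unfolding pullback_def D[OF x] \<psi>\<eta>(2)[OF x] ..
  qed
  then show "\<exists>T. open T \<and> x0 \<in> T \<and> smooth_on T (\<lambda>x. g (sgn x) ((v - (sgn x \<bullet> v) *\<^sub>R sgn x) /\<^sub>R norm x)
     ((w - (sgn x \<bullet> w) *\<^sub>R sgn x) /\<^sub>R norm x))"
    using oN x0 by blast
qed

lemma smooth_on_two_var_warp_nonzero: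
  fixes g :: "('n::finite) space tensor2" and \<A> :: "((real ^ 'n) set \<times> (real ^ 'n \<Rightarrow> 'n space)) set"
  assumes "cutoff \<rho>" "sphere_atlas \<A>" "sphere_metric g" "d > 0"
  shows "smooth_on (- {0}) (\<lambda>x. two_var_warp \<rho> a d g x v w)"
proof -
  let ?N = "- {0} :: 'n space set"
  let ?T = "\<lambda>v x. (v - (sgn x \<bullet> v) *\<^sub>R sgn x) /\<^sub>R norm x"
  have op: "open ?N" by (simp add: open_Compl)
  have G: "smooth_on ?N (\<lambda>x. g (sgn x) (?T v x) (?T w x))"
    and R: "smooth_on ?N (\<lambda>x. round_metric (sgn x) (?T v x) (?T w x))"
    using smooth_on_radial_extension[OF assms(2)] assms(3) sphere_metric_round_metric by blast+
  have sh: "smooth_on ?N (\<lambda>x. sinh (norm x))"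
    by (rule smooth_on_compose[OF op open_UNIV smooth_on_norm smooth_on_sinh]) simp
  have "smooth_on UNIV \<rho>" using assms(1) by (simp add: cutoff_def)
  moreover have "smooth_on ?N (\<lambda>x. (2 / d) * norm x + - (2 * a / d))"
    by (intro smooth_on_add smooth_on_mult smooth_on_const smooth_on_norm op)
  ultimately have "smooth_on ?N (\<lambda>x. \<rho> ((2 / d) * norm x + - (2 * a / d)))"
    using smooth_on_compose[OF op open_UNIV, where g="\<lambda>x. (2 / d) * norm x + - (2 * a / d)" and f=\<rho>] by blast
  moreover have "(2 / d) * norm x + - (2 * a / d) = 2 * ((norm x - a) / d)" for x :: "'n space"
    by (simp add: diff_divide_distrib algebra_simps)
  ultimately have rh: "smooth_on ?N (\<lambda>x. \<rho> (2 * ((norm x - a) / d)))" by simp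
  have sv: "smooth_on ?N (\<lambda>x. sgn x \<bullet> u)" for u
    by (rule smooth_on_inner[OF op smooth_on_sgn smooth_on_const])
  have "smooth_on ?N (\<lambda>x. (sinh (norm x) * sinh (norm x)) *
      (round_metric (sgn x) (?T v x) (?T w x) + \<rho> (2 * ((norm x - a) / d)) *
         (g (sgn x) (?T v x) (?T w x) - round_metric (sgn x) (?T v x) (?T w x))) + (sgn x \<bullet> v) * (sgn x \<bullet> w))"
    by (rule smooth_on_add[OF op smooth_on_mult[OF op smooth_on_mult[OF op sh sh]
          smooth_on_add[OF op R smooth_on_mult[OF op rh smooth_on_diff[OF op G R]]]] smooth_on_mult[OF op sv sv]])
  then show ?thesis
    by (rule smooth_on_cong[OF op, rotated])
      (auto simp: two_var_warp_nonzero deformed_family_def power2_eq_square)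
qed

lemma inner_product_on_two_var_warp:
  assumes "cutoff \<rho>" "sphere_metric g"
  shows "inner_product_on UNIV (two_var_warp \<rho> a d g x)"
proof (cases "x = 0")
  case True
  then show ?thesis by (simp add: two_var_warp_def inner_product_on_inner)
next
  case False
  let ?T = "\<lambda>v. (v - (sgn x \<bullet> v) *\<^sub>R sgn x) /\<^sub>R norm x"
  let ?B = "deformed_family \<rho> a d g (norm x) (sgn x)"
  have sg: "sgn x \<bullet> sgn x = 1" "sgn x \<in> sph" using False by (auto simp: dot_square_norm norm_sgn sph_def)
  have B: "inner_product_on (tangent (sgn x)) ?B"
    unfolding deformed_family_def
    by (rule inner_product_on_convex)
      (use assms sg(2) sphere_metric_round_metric in \<open>auto simp: sphere_metric_def cutoff_def\<close>)
  have T: "?T v \<in> tangent (sgn x)" for v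
  proof -
    have "(v - (sgn x \<bullet> v) *\<^sub>R sgn x) \<bullet> sgn x = 0"
      by (simp add: inner_diff_left sg(1) inner_commute[of v])
    then show ?thesis by (simp add: tangent_def)
  qed
  have lin: "?T (r *\<^sub>R u + v) = r *\<^sub>R ?T u + ?T v" for r u v
    by (simp add: inner_add_right algebra_simps)
  show ?thesis
    unfolding inner_product_on_def two_var_warp_nonzero[OF False]
  proof (intro conjI ballI allI impI)
    fix u v w r
    show "(sinh (norm x))\<^sup>2 * ?B (?T u) (?T v) + (sgn x \<bullet> u) * (sgn x \<bullet> v) =
      (sinh (norm x))\<^sup>2 * ?B (?T v) (?T u) + (sgn x \<bullet> v) * (sgn x \<bullet> u)"
      using inner_product_on_D(1)[OF B T T, of u v] by simp
    show "(sinh (norm x))\<^sup>2 * ?B (?T (r *\<^sub>R u + v)) (?T w) + (sgn x \<bullet> (r *\<^sub>R u + v)) * (sgn x \<bullet> w) =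
      r * ((sinh (norm x))\<^sup>2 * ?B (?T u) (?T w) + (sgn x \<bullet> u) * (sgn x \<bullet> w)) +
      ((sinh (norm x))\<^sup>2 * ?B (?T v) (?T w) + (sgn x \<bullet> v) * (sgn x \<bullet> w))"
      unfolding lin inner_product_on_D(2)[OF B T T T] by (simp add: inner_add_right algebra_simps)
    \<comment> \<open>Either the angular part of \<open>u\<close> is nonzero and the first summand
      is positive, or \<open>u\<close> is radial and the second one is.\<close>
    assume "u \<noteq> 0"
    show "0 < (sinh (norm x))\<^sup>2 * ?B (?T u) (?T u) + (sgn x \<bullet> u) * (sgn x \<bullet> u)"
    proof (cases "?T u = 0")
      case True
      then have "u = (sgn x \<bullet> u) *\<^sub>R sgn x" using False by simp
      with \<open>u \<noteq> 0\<close> have "sgn x \<bullet> u \<noteq> 0" by (metis scale_zero_left)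
      moreover have "?B (?T u) (?T u) = 0"
        unfolding True using inner_product_on_bilinear(7)[OF B subspace_tangent] subspace_0[OF subspace_tangent] by blast
      ultimately show ?thesis by (simp add: zero_less_mult_iff linorder_neq_iff disj_commute)
    next
      case False
      then have "0 < ?B (?T u) (?T u)" using inner_product_on_D(3)[OF B T] by blast
      then show ?thesis using \<open>x \<noteq> 0\<close> by (intro add_pos_nonneg mult_pos_pos) auto
    qed
  qed
qed

text \<open>Smoothness is glued from \<open>ball 0 a\<close>, where the cut-off vanishes and the
  power series apply, and the complement of the origin.\<close>

lemma riemannian_metric_two_var_warp:
  fixes g :: "('n::finite) space tensor2" and \<A> :: "((real ^ 'n) set \<times> (real ^ 'n \<Rightarrow> 'n space)) set"
  assumes "cutoff \<rho>" "sphere_atlas \<A>" "sphere_metric g" "d > 0" "a > 0"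
  shows "riemannian_metric (two_var_warp \<rho> a d g)"
  unfolding riemannian_metric_def
proof (intro conjI allI)
  fix v w :: "'n space"
  show "smooth_on UNIV (\<lambda>x. two_var_warp \<rho> a d g x v w)"
  proof (rule smooth_on_local)
    fix x :: "'n space"
    show "\<exists>T. open T \<and> x \<in> T \<and> smooth_on T (\<lambda>x. two_var_warp \<rho> a d g x v w)"
    proof (cases "x = 0")
      case True
      then show ?thesis
        using smooth_on_two_var_warp_inside[OF assms(1,4), of a g v w] assms(5) by (intro exI[of _ "ball 0 a"]) auto
    next
      case False
      then show ?thesis
        using smooth_on_two_var_warp_nonzero[OF assms(1-4), of a v w] by (intro exI[of _ "- {0}"]) (auto simp: open_Compl)
    qed
  qed
qed (rule inner_product_on_two_var_warp[OF assms(1,3)])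

section \<open>The constants and the theorem\<close>

text \<open>The constant is uniform in the point because every point outside the ball has
  \<open>t0 \<ge> b\<close>. The bound \<open>b > 1\<close> keeps the slab of width two around
  \<open>t0\<close> inside the positive radii.\<close>

lemma radially_close_two_var_warp:
  fixes g :: "('n::finite) space tensor2" and \<A> :: "((real ^ 'n) set \<times> (real ^ 'n \<Rightarrow> 'n space)) set"
  assumes \<rho>: "cutoff \<rho>" and atlas: "sphere_atlas \<A>"
    and cS: "cS > 1" "c_bounded \<A> cS round_metric" and c: "c > 1" "c_bounded \<A> c g"
    and g: "sphere_metric g" and d: "d > 0" and b: "b > 1"
    and K: "warp_bound CARD('n) (c + cS) * (exp (- b) + 1 / d) \<le> \<epsilon>"
  shows "radially_close \<epsilon> (pullback from_polar (two_var_warp \<rho> a d g)) (outside_ball b)"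
  unfolding radially_close_def Let_def
proof (intro conjI ballI)
  show "radial_form (pullback from_polar (two_var_warp \<rho> a d g))"
    unfolding radial_form_def by (simp add: pullback_two_var_warp)
  fix q :: "'n space \<times> real" assume "q \<in> outside_ball b"
  then obtain p t0 where q: "q = (p, t0)" and p: "p \<in> sph" and t: "t0 \<ge> b"
    by (auto simp: outside_ball_def from_polar_def sph_def)
  obtain U \<psi> z where U: "(U, \<psi>) \<in> \<A>" "z \<in> U" "\<psi> z = p" "infdist z (- U) \<ge> 1"
    using atlas p by (fastforce simp: sphere_atlas_def)
  have chart: "sphere_chart U \<psi>" using atlas U(1) by (auto simp: sphere_atlas_def)
  \<comment> \<open>This is where the unit margin of the atlas is used.\<close>
  have ball: "ball z 1 \<subseteq> U"
  proof
    fix y assume "y \<in> ball z 1"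
    then show "y \<in> U" using infdist_le[of y "- U" z] U(4) by (cases "y \<in> U") auto
  qed
  have nS: "C2_norm U (pullback \<psi> round_metric) < ereal cS"
    "\<bar>det (\<chi> i j. pullback \<psi> round_metric z (axis i 1) (axis j 1))\<bar> > 1 / cS"
    using cS(2) U(1,2) by (auto simp: c_bounded_def)
  have nH: "C2_norm U (pullback \<psi> g) < ereal c"
    "\<bar>det (\<chi> i j. pullback \<psi> g z (axis i 1) (axis j 1))\<bar> > 1 / c"
    using c(2) U(1,2) by (auto simp: c_bounded_def)
  have "0 \<le> warp_bound CARD('n) (c + cS)" using c cS by (simp add: warp_bound_def)
  then have "warp_bound CARD('n) (c + cS) * (exp (- t0) + 1 / d) \<le> warp_bound CARD('n) (c + cS) * (exp (- b) + 1 / d)"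
    using t by (intro mult_left_mono) auto
  then have K': "warp_bound CARD('n) (c + cS) * (exp (- t0) + 1 / d) \<le> \<epsilon>" using K by linarith
  have t1: "t0 > 1" using t b by simp
  obtain \<phi>1 where \<phi>1: "sphere_chart (ball 0 1) \<phi>1" "\<phi>1 0 = \<psi> z"
    "C2_norm model_domain (\<lambda>y u v. pullback (\<lambda>(x, t). (\<phi>1 x, t + t0))
      (pullback from_polar (two_var_warp \<rho> a d g)) y u v - model_metric y u v) < ereal \<epsilon>"
    using exists_close_chart[OF \<rho> chart ball cS(1) c(1) g nS(1) nH(1) nS(2) nH(2) d t1 K'] by blast
  have "(\<lambda>(x, t). (\<phi>1 x, t + t0)) ` model_domain \<subseteq> sph \<times> {0<..}"
    using sphere_chart_D(2)[OF \<phi>1(1)] t1 by (auto simp: model_domain_def)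
  moreover have "(\<lambda>(x, t). (\<phi>1 x, t + t0)) (0, 0) = q" using \<phi>1(2) U(3) q by simp
  ultimately show "\<exists>\<phi>1 t0. sphere_chart (ball 0 1) \<phi>1 \<and>
      (\<lambda>(x, t). (\<phi>1 x, t + t0)) ` model_domain \<subseteq> sph \<times> {0<..} \<and>
      (\<lambda>(x, t). (\<phi>1 x, t + t0)) (0, 0) = q \<and>
      C2_norm model_domain (\<lambda>y u v. pullback (\<lambda>(x, t). (\<phi>1 x, t + t0))
        (pullback from_polar (two_var_warp \<rho> a d g)) y u v - model_metric y u v) < ereal \<epsilon>"
    using \<phi>1 by blast
qed

text \<open>Keeping only the second summand of \<open>c3\<close> and \<open>e^2 \<ge> 4\<close>
  leaves \<open>14580 * n^6 * (n!)^3 * y^(3 n + 4)\<close> with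
  \<open>14580 = 30 * 27 * 4 * 9/2\<close>. The power of 6 contained in \<open>y\<close> absorbs the
  missing factor \<open>n * n!\<close>, and the exponent of \<open>x\<close> only grows.\<close>

lemma warp_bound_le_C1_formula:
  assumes "n \<ge> 1" "x \<ge> 1"
  shows "warp_bound n x \<le> C1_formula n x"
proof -
  define y where "y = 6 ^ n * x"
  have x0: "0 \<le> x" and y0: "0 \<le> y" using assms by (auto simp: y_def)
  have c3: "c3 n y \<ge> 9/2 * fact n * y ^ (n + 2)" by (simp add: c3_def)
  have c4: "c4 n y ^ 4 = (real n * fact n * y ^ n)\<^sup>2"
  proof -
    have "c4 n y ^ 4 = ((c4 n y)\<^sup>2)\<^sup>2" by (simp flip: power_mult)
    moreover have "(c4 n y)\<^sup>2 = real n * fact n * y ^ n" using y0 by (simp add: c4_def)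
    ultimately show ?thesis by simp
  qed
  have e: "(exp 1)\<^sup>2 \<ge> (4::real)"
  proof -
    have "(2::real) \<le> exp 1" using exp_ge_add_one_self[of 1] by simp
    then have "2\<^sup>2 \<le> (exp 1 :: real)\<^sup>2" by (rule power_mono) simp
    then show ?thesis by simp
  qed
  have nf: "real n * fact n \<le> 6 ^ (n * (n + 1))"
  proof -
    have n6: "real n \<le> 6 ^ n"
    proof -
      have "n < 6 ^ n" by (rule less_exp[THEN less_le_trans]) (simp add: power_mono)
      then have "real n \<le> real (6 ^ n)" by (simp only: of_nat_le_iff less_imp_le)
      then show ?thesis by simp
    qed
    have "fact n \<le> real n ^ n" using fact_le_power[of n] by simp
    then have "real n * fact n \<le> real n * real n ^ n" by (rule mult_left_mono) simp
    also have "\<dots> = real n ^ (n + 1)" by simp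
    also have "\<dots> \<le> (6 ^ n) ^ (n + 1)" using n6 by (rule power_mono) simp
    finally show ?thesis by (simp only: power_mult)
  qed
  have "(6::real) ^ (n * (n + 1)) \<le> 6 ^ (n * (3 * n + 4))"
    by (rule power_increasing[OF mult_le_mono2]) auto
  with nf have nf': "real n * fact n \<le> 6 ^ (n * (3 * n + 4))" by linarith
  have xp: "x ^ (2 * n + 3) \<le> x ^ (3 * n + 4)" using assms by (intro power_increasing) auto
  have "warp_bound n x = 8700 * (real n ^ 6 * fact n ^ 3) * ((real n * fact n) * x ^ (2 * n + 3))"
    by (simp add: warp_bound_def eval_nat_numeral)
  also have "\<dots> \<le> 8700 * (real n ^ 6 * fact n ^ 3) * (6 ^ (n * (3 * n + 4)) * x ^ (3 * n + 4))"
    using nf' xp x0 by (intro mult_left_mono mult_mono) auto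
  also have "6 ^ (n * (3 * n + 4)) * x ^ (3 * n + 4) = y ^ (3 * n + 4)"
    by (simp only: y_def power_mult_distrib power_mult)
  also have "8700 * (real n ^ 6 * fact n ^ 3) * y ^ (3 * n + 4) \<le>
     14580 * (real n ^ 6 * fact n ^ 3) * y ^ (3 * n + 4)"
    using y0 by (intro mult_right_mono) auto
  also have "14580 * (real n ^ 6 * fact n ^ 3) * y ^ (3 * n + 4) =
     30 * (27 * 4 * real n ^ 4 * (real n * fact n * y ^ n)\<^sup>2 * (9/2 * fact n * y ^ (n + 2)) * y\<^sup>2)"
  proof -
    have "y ^ (3 * n + 4) = (y ^ n)\<^sup>2 * y ^ (n + 2) * y\<^sup>2"
    proof -
      have "3 * n + 4 = n * 2 + (n + 2) + 2" by simp
      then show ?thesis by (simp only: power_add power_mult)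
    qed
    then show ?thesis by (simp add: eval_nat_numeral)
  qed
  also have "\<dots> \<le> 30 * (27 * (exp 1)\<^sup>2 * real n ^ 4 * (real n * fact n * y ^ n)\<^sup>2 * c3 n y * y\<^sup>2)"
    using e c3 y0 by (intro mult_left_mono mult_right_mono mult_mono) auto
  also have "\<dots> = C1_formula n x"
    by (simp add: C1_formula_def C0_def y_def[symmetric] c4)
  finally show ?thesis .
qed

lemma C1_formula_le_C2_formula:
  assumes "c + cS \<ge> 0"
  shows "C1_formula n (c + cS) \<le> C2_formula n cS c"
proof -
  have "0 \<le> A_fun n (c + cS)" using assms by (simp add: A_fun_def Let_def)
  moreover have "0 \<le> C1_formula n (c + cS)" using assms by (simp add: C1_formula_def C0_def c3_def c4_def)
  ultimately have "1 * C1_formula n (c + cS) \<le> (1 + 12 * A_fun n (c + cS)) * C1_formula n (c + cS)"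
    by (intro mult_right_mono) auto
  then show ?thesis by (simp add: C2_formula_def)
qed

lemma C2_property_mono:
  assumes "C2_property \<rho> \<A> c K" "K \<le> K'"
  shows "C2_property \<rho> \<A> c K'"
  unfolding C2_property_def
proof (intro allI impI)
  fix g :: "'a space tensor2" and a d b \<epsilon> :: real
  assume *: "sphere_metric g" "c_bounded \<A> c g" "0 < a" "0 < d" "1 < b" "K' * (exp (- b) + 1 / d) \<le> \<epsilon>"
  have "K * (exp (- b) + 1 / d) \<le> K' * (exp (- b) + 1 / d)"
    using assms(2) *(4) by (intro mult_right_mono add_nonneg_nonneg) auto
  then have "K * (exp (- b) + 1 / d) \<le> \<epsilon>" using *(6) by linarith
  then show "radially_close \<epsilon> (pullback from_polar (two_var_warp \<rho> a d g)) (outside_ball b)"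
    using assms(1) * unfolding C2_property_def by blast
qed

text \<open>Positivity is recorded as well, since the theorem multiplies an inequality by this
  constant.\<close>

lemma C2_const_property:
  fixes \<A> :: "((real ^ 'n) set \<times> (real ^ 'n \<Rightarrow> ('n::finite) space)) set"
  assumes "cutoff \<rho>" "sphere_atlas \<A>" "cS > 1" "c_bounded \<A> cS round_metric" "c > 1"
  shows "C2_property \<rho> \<A> c (C2_const \<rho> \<A> cS c)" "C2_const \<rho> \<A> cS c > 0"
proof -
  let ?W = "warp_bound CARD('n) (c + cS)"
  have W: "C2_property \<rho> \<A> c ?W"
    unfolding C2_property_def using radially_close_two_var_warp[OF assms(1-5)] by blast
  have W0: "?W > 0" using assms by (simp add: warp_bound_def)
  have "C2_property \<rho> \<A> c (C2_const \<rho> \<A> cS c) \<and> C2_const \<rho> \<A> cS c > 0"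
  proof (cases "CARD('n) \<ge> 2")
    case True
    have "?W \<le> C1_formula CARD('n) (c + cS)"
      using assms by (intro warp_bound_le_C1_formula) (auto simp: Suc_leI)
    also have "\<dots> \<le> C2_formula CARD('n) cS c"
      using assms by (intro C1_formula_le_C2_formula) auto
    finally have le: "?W \<le> C2_formula CARD('n) cS c" .
    then show ?thesis
      using C2_property_mono[OF W le] W0 True by (simp add: C2_const_def)
  next
    case False
    have "\<exists>K. K > 0 \<and> C2_property \<rho> \<A> c K" using W W0 by blast
    from someI_ex[OF this] show ?thesis using False by (simp add: C2_const_def)
  qed
  then show "C2_property \<rho> \<A> c (C2_const \<rho> \<A> cS c)" "C2_const \<rho> \<A> cS c > 0" by auto
qed

theorem mainTheorem3:
  fixes \<rho> :: "real \<Rightarrow> real"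
    and \<A> :: "((real ^ 'n) set \<times> (real ^ 'n \<Rightarrow> ('n::finite) space)) set"
    and cS c \<epsilon> a d :: real
    and g :: "'n space tensor2"
  assumes "cutoff \<rho>"
    and "sphere_atlas \<A>"
    and "cS > 1" and "c_bounded \<A> cS round_metric"
    and "c > 1" and "sphere_metric g" and "c_bounded \<A> c g"
    and "\<epsilon> > 0" and "d > 0"
    and "a > hyp_radius TYPE('n) cS \<epsilon> + 1"
    and "a > 2"
    and "exp 1 * C2_const \<rho> \<A> cS c * (exp (- a) + 1 / d) \<le> \<epsilon>"
  shows "B_close_to_hyperbolic a \<epsilon> (two_var_warp \<rho> a d g)"
  unfolding B_close_to_hyperbolic_def
proof (intro conjI ballI allI)
  have a: "a > 0" using assms by simp
  show "riemannian_metric (two_var_warp \<rho> a d g)"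
    by (rule riemannian_metric_two_var_warp[OF assms(1,2,6,9) a])
next
  fix p :: "'n space" and t u v s s'
  assume p: "p \<in> sph" "t \<in> {0<..<a}" "u \<in> tangent p" "v \<in> tangent p"
  \<comment> \<open>For \<open>t < a\<close> the cut-off is evaluated at a negative argument, so
    only the round metric is left.\<close>
  have "\<rho> (2 * ((t - a) / d)) = 0"
    using assms(1,9) p(2) by (auto simp: cutoff_def divide_nonpos_pos)
  then show "pullback from_polar (two_var_warp \<rho> a d g) (p, t) (u, s) (v, s') = hyperbolic_polar (p, t) (u, s) (v, s')"
    using pullback_two_var_warp[of p t u v \<rho> a d g s s'] p
    by (simp add: deformed_family_def hyperbolic_polar_def warped_def)
next
  let ?C = "C2_const \<rho> \<A> cS c"
  note C = C2_const_property[OF assms(1-5)]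
  \<comment> \<open>\<open>exp (- (a - 1))\<close> equals \<open>e\<close> times
    \<open>exp (- a)\<close>, and \<open>1 / d\<close> may be enlarged by the same factor as
    \<open>e \<ge> 1\<close>.\<close>
  have "1 / d \<le> exp 1 * (1 / d)" using assms(9) mult_right_mono[of 1 "exp 1" "1 / d"] by simp
  then have "exp (- (a - 1)) + 1 / d \<le> exp 1 * (exp (- a) + 1 / d)"
    by (simp add: exp_diff exp_minus algebra_simps divide_inverse)
  then have "?C * (exp (- (a - 1)) + 1 / d) \<le> ?C * (exp 1 * (exp (- a) + 1 / d))"
    using C(2) by (intro mult_left_mono) auto
  also have "\<dots> = exp 1 * ?C * (exp (- a) + 1 / d)" by (simp only: mult_ac)
  also have "\<dots> \<le> \<epsilon>" by fact
  finally have "?C * (exp (- (a - 1)) + 1 / d) \<le> \<epsilon>" .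
  \<comment> \<open>The property of the constant asks for a radius above 1, which
    \<open>a > 2\<close> provides for \<open>a - 1\<close>.\<close>
  moreover have "0 < a" "1 < a - 1" using assms(11) by auto
  ultimately show "radially_close \<epsilon> (pullback from_polar (two_var_warp \<rho> a d g)) (outside_ball (a - 1))"
    using C(1) assms(6,7,9) unfolding C2_property_def by blast
qed

end
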